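(* Let $q$ be a real-valued function on $\mathbb{R}$ with $q(x+1)=q(x)$ which is summable on $[0,1]$, and let $l_n$ ($n\ge 1$) be the length of the $n$-th finite instability interval of the Hill operator $Ly=-y''+q(x)y$. Assume that $l_n=o(n^{-2})$ as $n\to\infty$, and let $n_0=n_0(\varepsilon)$ be a positive large number such that, for some $\varepsilon>0$, $l_n<\varepsilon n^{-2}$ for all $n>n_0$. Then: (i) if $\{(n\pi)^2 : n \text{ even and } n>n_0\}$ is a subset of the periodic spectrum of the Hill operator, then $q=0$ a.e.; (ii) if $\{(n\pi)^2 : n \text{ odd and } n>n_0\}$ is a subset of the anti-periodic spectrum of the Hill operator, then $q=0$ a.e.
   Context: Let $\lambda_n$ and $\mu_n$ ($n=0,1,\ldots$) denote, respectively, the $n$-th eigenvalue (counted with multiplicity, in nondecreasing order) of $-y''+q(x)y=\lambda y$ on $[0,1]$ with the periodic boundary conditions $y(0)=y(1)$, $y'(0)=y'(1)$, and with the anti-periodic boundary conditions $y(0)=-y(1)$, $y'(0)=-y'(1)$. The periodic spectrum is $\{\lambda_n: n\ge 0\}$ and the anti-periodic spectrum is $\{\mu_n: n\ge 0\}$. It is well known that $\lambda_0<\mu_0\le\mu_1<\lambda_1\le\lambda_2<\mu_2\le\mu_3<\cdots\to\infty$. For $m=0,1,\ldots$, the intervals $(\mu_{2m},\mu_{2m+1})$ and $(\lambda_{2m+1},\lambda_{2m+2})$ are called, respectively, the $(2m+1)$-th and the $(2m+2)$-th finite instability intervals of $L$ (they may be empty). Thus $l_{2m+1}=\mu_{2m+1}-\mu_{2m}$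 and $l_{2m+2}=\lambda_{2m+2}-\lambda_{2m+1}$. In (i) and (ii) the given eigenvalues are not assumed to have multiplicity 2. *)

theory Defs
  imports "HOL-Analysis.Analysis" "HOL-Library.Landau_Symbols" "HOL-Library.Function_Algebras"
begin

definition fun_scale :: "real \<Rightarrow> (real \<Rightarrow> real) \<Rightarrow> real \<Rightarrow> real" where
  "fun_scale c f = (\<lambda>x. c * f x)"

interpretation real_fun: vector_space fun_scale
  by unfold_locales (auto simp: fun_scale_def fun_eq_iff algebra_simps)

(* y' is an indefinite Lebesgue integral of y'', i.e. it is absolutely continuous on [0,1]
   with derivative y'' almost everywhere. This is the usual notion of solution when the
   potential q is merely summable. *)
definition hill_solution ::
  "(real \<Rightarrow> real) \<Rightarrow> real \<Rightarrow> (real \<Rightarrow> real) \<Rightarrow> (real \<Rightarrow> real) \<Rightarrow> bool" where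
  "hill_solution q lam y y' \<longleftrightarrow>
     (\<forall>x\<in>{0..1}. (y has_real_derivative y' x) (at x within {0..1})) \<and>
     (\<exists>y''. y'' absolutely_integrable_on {0..1} \<and>
        (\<forall>x\<in>{0..1}. y' x = y' 0 + integral {0..x} y'') \<and>
        (AE x in lebesgue. x \<in> {0..1} \<longrightarrow> - y'' x + q x * y x = lam * y x))"

(* The sign s = 1 gives the periodic and s = -1 the anti-periodic boundary conditions.
   A function on [0,1] is represented by its extension by zero to the real line, so that
   distinct elements of the eigenspace are distinct on [0,1]. *)
definition eigenspace :: "(real \<Rightarrow> real) \<Rightarrow> real \<Rightarrow> real \<Rightarrow> (real \<Rightarrow> real) set" where
  "eigenspace q s lam =
     {y. (\<forall>x. x \<notin> {0..1} \<longrightarrow> y x = 0) \<and>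
         (\<exists>y'. hill_solution q lam y y' \<and> y 0 = s * y 1 \<and> y' 0 = s * y' 1)}"

definition multiplicity_of :: "(real \<Rightarrow> real) \<Rightarrow> real \<Rightarrow> real \<Rightarrow> nat" where
  "multiplicity_of q s lam = real_fun.dim (eigenspace q s lam)"

(* a lists the eigenvalues in nondecreasing order, each repeated according to its
   multiplicity; numbers that are not eigenvalues have multiplicity 0 and do not occur. *)
definition eigenvalue_sequence :: "(real \<Rightarrow> real) \<Rightarrow> real \<Rightarrow> (nat \<Rightarrow> real) \<Rightarrow> bool" where
  "eigenvalue_sequence q s a \<longleftrightarrow>
     mono a \<and> (\<forall>t. finite {n. a n = t} \<and> card {n. a n = t} = multiplicity_of q s t)"

abbreviation periodic_eigenvalues :: "(real \<Rightarrow> real) \<Rightarrow> (nat \<Rightarrow> real) \<Rightarrow> bool" where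
  "periodic_eigenvalues q \<equiv> eigenvalue_sequence q 1"

abbreviation antiperiodic_eigenvalues :: "(real \<Rightarrow> real) \<Rightarrow> (nat \<Rightarrow> real) \<Rightarrow> bool" where
  "antiperiodic_eigenvalues q \<equiv> eigenvalue_sequence q (-1)"

lemma eigenvalue_sequence_unique:
  assumes "eigenvalue_sequence q s a" "eigenvalue_sequence q s b"
  shows "a = b"
proof
  have aux: False
    if A: "eigenvalue_sequence q s a" and B: "eigenvalue_sequence q s b"
      and IH: "\<And>k. k < n \<Longrightarrow> a k = b k" and less: "a n < b n" for a b n
  proof -
    have "b i \<noteq> a n" if "n \<le> i" for i
      using B less that unfolding eigenvalue_sequence_def by (metis monoD leD)
    then have "{i. b i = a n} \<subseteq> {i. a i = a n} - {n}"
      using IH less by (smt (verit) Diff_iff leI mem_Collect_eq order_less_irrefl singletonD subsetI)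
    then have "{i. b i = a n} \<subset> {i. a i = a n}" by auto
    moreover have "finite {i. a i = a n}" "card {i. a i = a n} = card {i. b i = a n}"
      using A B by (auto simp: eigenvalue_sequence_def)
    ultimately show False by (metis psubset_card_mono less_irrefl)
  qed
  fix n show "a n = b n"
  proof (induction n rule: less_induct)
    case (less n)
    then show ?case
      using aux[OF assms, of n] aux[OF assms(2,1), of n] by (metis linorder_neqE_linordered_idom)
  qed
qed

(* For n \<ge> 1: the n-th finite instability interval is (mu (n-1), mu n) for odd n
   and (lam (n-1), lam n) for even n. *)
definition instability_length :: "(nat \<Rightarrow> real) \<Rightarrow> (nat \<Rightarrow> real) \<Rightarrow> nat \<Rightarrow> real" where
  "instability_length lam mu n = (if odd n then mu n - mu (n - 1) else lam n - lam (n - 1))"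

end

theory Submission
  imports Defs
begin

text \<open>
  Write an eigenvalue as \<open>k\<^sup>2\<close>. For a smooth potential with mean zero, perturbation theory places the
  two eigenvalues near \<open>(n \<pi>)\<^sup>2\<close> at \<open>(n \<pi>)\<^sup>2 + V / (2 n \<pi>)\<^sup>2 \<plusminus> |q\<^sub>n| + o(n\<^sup>-\<^sup>2)\<close>, where \<open>V\<close> is the
  integral of \<open>q\<^sup>2\<close> and \<open>q\<^sub>n\<close> is the \<open>n\<close>-th Fourier coefficient. Small gaps make \<open>q\<^sub>n\<close> small, and an
  eigenvalue exactly at \<open>(n \<pi>)\<^sup>2\<close> then leaves only \<open>V = 0\<close>. For a merely summable \<open>q\<close> the
  smoothness needed for this expansion has to be extracted from the gaps as well.

  \<^bold>\<open>Solutions.\<close> Put \<open>z = y' + i k y\<close> and remove the phase \<open>\<theta>(x) = k x - q1 x / (2 k)\<close>, where \<open>q1\<close> is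
  the primitive of \<open>q\<close> that vanishes at 0. Then \<open>u = cis (- \<theta>) z\<close> solves \<open>u' = \<gamma> cnj u\<close> with the
  oscillating coefficient \<open>\<gamma> = (i q / 2k) cis (- 2 \<theta>)\<close> of size \<open>O(1/k)\<close>. The solutions are
  \<open>u = \<alpha> c + \<beta> cnj c\<close> for a pair with \<open>|\<alpha>|\<^sup>2 - |\<beta>|\<^sup>2 = 1\<close> (\<open>volterra_pair\<close>). With
  \<open>A = cis (\<theta> 1) \<alpha> 1\<close> and \<open>B = cis (\<theta> 1) \<beta> 1\<close> the boundary condition of sign \<open>s\<close> reads
  \<open>s (A c + B cnj c) = c\<close>, and it has a solution \<open>c \<noteq> 0\<close> iff \<open>s Re A = 1\<close>
  (\<open>eigenspace_eq\<close>, \<open>multiplicity_pos_iff\<close>).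

  \<^bold>\<open>Edges.\<close> Up to terms with Lipschitz constant \<open>O(1/k)\<close>, \<open>A\<close> is \<open>cis k\<close> and \<open>B\<close> vanishes. Hence near
  \<open>n \<pi>\<close> both functions \<open>s Im A \<plusminus> |B|\<close>, \<open>s = (-1)\<^sup>n\<close>, are strictly increasing, and their zeros
  \<open>km n \<le> kp n\<close> are exactly the square roots of the eigenvalues there (\<open>edge_pair_exists\<close>); moreover
  \<open>|B (km n)| + |B (kp n)| \<le> 2 (kp n - km n)\<close>. A gap of length \<open>o(n\<^sup>-\<^sup>2)\<close> in the numbered sequence is
  too short to lead from one pair to the next, so the distant instability intervals are those
  between \<open>(km n)\<^sup>2\<close> and \<open>(kp n)\<^sup>2\<close> (\<open>paired_gaps_small\<close>), and \<open>B = o(n\<^sup>-\<^sup>3)\<close> at the edges.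

  \<^bold>\<open>Regularity.\<close> The eigenvalues \<open>(n \<pi>)\<^sup>2\<close> force mean zero (\<open>mean_zero\<close>). Since \<open>2 k |B|\<close> is, up to
  \<open>o(k\<^sup>-\<^sup>2)\<close>, the modulus of the integral of \<open>q cis (- 2 \<theta>)\<close>, that integral is \<open>o(n\<^sup>-\<^sup>2)\<close>. Expanding the
  phase in \<open>1/k\<close> and integrating by parts turns this into \<open>o(n\<^sup>-\<^sup>2)\<close> for the Fourier coefficients of
  \<open>q - q1\<^sup>2\<close> (\<open>n_squared_riccati_coeff\<close>). By uniqueness of Fourier coefficients \<open>q\<close> agrees almost
  everywhere with a continuous \<open>r = f + q1\<^sup>2\<close>, where \<open>f\<close> is the sum of the absolutely
  convergent Fourier series of \<open>q - q1\<^sup>2\<close>.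

  \<^bold>\<open>Conclusion.\<close> At an eigenvalue \<open>k = n \<pi>\<close> one has \<open>|Im (\<alpha> 1)| = |B| = o(n\<^sup>-\<^sup>3)\<close>. The second-order term
  of \<open>\<alpha> 1\<close> is a double integral divided by \<open>4 k\<^sup>2\<close>, and \<open>n\<close> times the imaginary part of that double
  integral tends to \<open>- (1/2\<pi>)\<close> times the integral of \<open>r\<^sup>2\<close> (\<open>second_order_limit\<close>). Therefore \<open>r = 0\<close>.
\<close>

section \<open>Primitives of summable functions\<close>

text \<open>
  The unqualified names belong to Lebesgue integrals; the integrals below are gauge integrals.
\<close>

lemmas hk_integral_add = Henstock_Kurzweil_Integration.integral_add
  and hk_integral_diff = Henstock_Kurzweil_Integration.integral_diff
  and hk_integral_mult_right = Henstock_Kurzweil_Integration.integral_mult_right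
  and hk_integral_nonneg = Henstock_Kurzweil_Integration.integral_nonneg
  and hk_integral_norm_bound_integral = Henstock_Kurzweil_Integration.integral_norm_bound_integral
  and hk_integral_combine = Henstock_Kurzweil_Integration.integral_combine
  and hk_integral_cnj = Henstock_Kurzweil_Integration.integral_cnj

lemma L1_mult_continuous:
  fixes f g :: "real \<Rightarrow> complex"
  assumes f: "f absolutely_integrable_on {0..1}" and g: "continuous_on {0..1} g"
  shows "(\<lambda>x. f x * g x) absolutely_integrable_on {0..1}"
proof -
  have "(\<lambda>x. g x * f x) absolutely_integrable_on {0..1}"
  proof (rule absolutely_integrable_bounded_measurable_product[where h="(*)"])
    show "bilinear ((*) :: complex \<Rightarrow> complex \<Rightarrow> complex)"
      by (simp add: bilinear_times)
    show "g \<in> borel_measurable (lebesgue_on {0..1})"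
      by (intro continuous_imp_measurable_on_sets_lebesgue g) auto
    show "bounded (g ` {0..1})"
      by (intro compact_imp_bounded compact_continuous_image g) auto
  qed (use f in auto)
  then show ?thesis by (simp add: mult.commute)
qed

lemma L1_mult_real_continuous:
  fixes f g :: "real \<Rightarrow> real"
  assumes f: "f absolutely_integrable_on {0..1}" and g: "continuous_on {0..1} g"
  shows "(\<lambda>x. f x * g x) absolutely_integrable_on {0..1}"
proof -
  have "(\<lambda>x. g x * f x) absolutely_integrable_on {0..1}"
  proof (rule absolutely_integrable_bounded_measurable_product_real)
    show "g \<in> borel_measurable (lebesgue_on {0..1})"
      by (intro continuous_imp_measurable_on_sets_lebesgue g) auto
    show "bounded (g ` {0..1})"
      by (intro compact_imp_bounded compact_continuous_image g) auto
  qed (use f in auto)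
  then show ?thesis by (simp add: mult.commute)
qed

lemma L1_of_real:
  fixes f :: "real \<Rightarrow> real"
  assumes "f absolutely_integrable_on S"
  shows "(\<lambda>x. complex_of_real (f x)) absolutely_integrable_on S"
  using absolutely_integrable_linear[OF assms bounded_linear_of_real[where 'a=complex]] by (simp add: o_def)

lemma L1_cnj:
  fixes f :: "real \<Rightarrow> complex"
  assumes "f absolutely_integrable_on S"
  shows "(\<lambda>x. cnj (f x)) absolutely_integrable_on S"
  using absolutely_integrable_linear[OF assms bounded_linear_cnj] by (simp add: o_def)

lemma L1_mult_of_real_continuous:
  fixes f :: "real \<Rightarrow> real" and g :: "real \<Rightarrow> complex"
  assumes "f absolutely_integrable_on {0..1}" and "continuous_on {0..1} g"
  shows "(\<lambda>x. of_real (f x) * g x) absolutely_integrable_on {0..1}"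
  by (intro L1_mult_continuous L1_of_real assms)

lemma L1_integrable:
  fixes f :: "real \<Rightarrow> 'a::euclidean_space"
  assumes "f absolutely_integrable_on {0..1}" "0 \<le> a" "b \<le> 1"
  shows "f integrable_on {a..b}"
  by (rule set_lebesgue_integral_eq_integral(1), rule absolutely_integrable_on_subinterval[OF assms(1)])
    (use assms in auto)

lemma L1_norm_integrable:
  fixes f :: "real \<Rightarrow> 'a::euclidean_space"
  assumes "f absolutely_integrable_on {0..1}" "0 \<le> a" "b \<le> 1"
  shows "(\<lambda>x. norm (f x)) integrable_on {a..b}"
  using L1_integrable[OF absolutely_integrable_norm[OF assms(1)] assms(2,3)] by (simp add: o_def)

lemma norm_integral_le_L1:
  fixes f :: "real \<Rightarrow> 'a::euclidean_space" and g :: "real \<Rightarrow> 'b::euclidean_space"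
  assumes f: "f absolutely_integrable_on {0..1}" and g: "g absolutely_integrable_on {0..1}"
    and le: "\<And>t. 0 \<le> t \<Longrightarrow> t \<le> 1 \<Longrightarrow> norm (g t) \<le> M * norm (f t)" and "0 \<le> a" "b \<le> 1" "0 \<le> M"
  shows "norm (integral {a..b} g) \<le> M * integral {0..1} (\<lambda>t. norm (f t))"
proof -
  have "norm (integral {a..b} g) \<le> integral {a..b} (\<lambda>t. M * norm (f t))"
    by (intro integral_norm_bound_integral L1_integrable[OF g] integrable_on_mult_right
        L1_norm_integrable[OF f] le) (use assms in auto)
  also have "\<dots> = M * integral {a..b} (\<lambda>t. norm (f t))"
    by simp
  also have "\<dots> \<le> M * integral {0..1} (\<lambda>t. norm (f t))"
    by (intro mult_left_mono integral_subset_le L1_norm_integrable[OF f]) (use assms in auto)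
  finally show ?thesis .
qed

text \<open>
  Identities between primitives are checked on short intervals: if the increments of \<open>\<Psi>\<close> are bounded
  by arbitrarily small multiples of those of a fixed function, adding them up over a fine partition
  leaves nothing.
\<close>

lemma constant_if_oscillation_small:
  fixes \<Psi> :: "real \<Rightarrow> 'a::real_normed_vector" and M :: "real \<Rightarrow> real"
  assumes osc: "\<And>e. e > 0 \<Longrightarrow> \<exists>d>0. \<forall>a b. 0 \<le> a \<longrightarrow> a \<le> b \<longrightarrow> b \<le> 1 \<longrightarrow> b - a < d \<longrightarrow>
                   norm (\<Psi> b - \<Psi> a) \<le> e * (M b - M a)"
    and x: "0 \<le> x" "x \<le> 1"
  shows "\<Psi> x = \<Psi> 0"
proof -
  have main: "norm (\<Psi> x - \<Psi> 0) \<le> e * (M x - M 0)" if epos: "e > 0" for e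
  proof -
    obtain d where "d > 0" and d: "\<And>a b. 0 \<le> a \<Longrightarrow> a \<le> b \<Longrightarrow> b \<le> 1 \<Longrightarrow> b - a < d \<Longrightarrow>
                   norm (\<Psi> b - \<Psi> a) \<le> e * (M b - M a)"
      using osc[OF epos] by blast
    obtain n :: nat where n: "1 / d < real n" using reals_Archimedean2 by blast
    have npos: "real n > 0" using n \<open>d > 0\<close> by (smt (verit) zero_less_divide_1_iff)
    have step: "norm (\<Psi> (x * real i / real n) - \<Psi> 0) \<le> e * (M (x * real i / real n) - M 0)"
      if "i \<le> n" for i
      using that
    proof (induction i)
      case 0
      then show ?case by simp
    next
      case (Suc i)
      let ?a = "x * real i / real n" and ?b = "x * real (Suc i) / real n"
      have ba: "?b - ?a = x / n"
        by (simp add: diff_divide_distrib[symmetric] algebra_simps)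
      have "x / n \<le> 1 / n" using x npos by (simp add: divide_right_mono)
      also have "\<dots> < d" using n \<open>d > 0\<close> npos by (simp add: field_simps)
      finally have "?b - ?a < d" using ba by simp
      moreover have "?a \<le> ?b" using x npos by (simp add: divide_right_mono mult_left_mono)
      moreover have "?b \<le> 1"
      proof -
        have "x * real (Suc i) \<le> 1 * real n" using x Suc.prems by (intro mult_mono) auto
        then show ?thesis using npos by (simp add: field_simps)
      qed
      ultimately have 1: "norm (\<Psi> ?b - \<Psi> ?a) \<le> e * (M ?b - M ?a)"
        by (intro d) (use x in auto)
      have "norm (\<Psi> ?b - \<Psi> 0) \<le> norm (\<Psi> ?b - \<Psi> ?a) + norm (\<Psi> ?a - \<Psi> 0)"
        by (metis diff_add_cancel add_diff_eq norm_triangle_ineq)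
      also have "\<dots> \<le> e * (M ?b - M ?a) + e * (M ?a - M 0)"
        using 1 Suc by auto
      finally show ?case by (simp add: algebra_simps)
    qed
    show ?thesis using step[of n] npos by simp
  qed
  have "norm (\<Psi> x - \<Psi> 0) \<le> 0"
  proof (rule field_le_epsilon)
    fix \<epsilon> :: real assume "\<epsilon> > 0"
    let ?K = "\<bar>M x - M 0\<bar> + 1"
    have "norm (\<Psi> x - \<Psi> 0) \<le> (\<epsilon> / ?K) * (M x - M 0)"
      using \<open>\<epsilon> > 0\<close> by (intro main) auto
    also have "\<dots> \<le> (\<epsilon> / ?K) * ?K"
      using \<open>\<epsilon> > 0\<close> by (intro mult_left_mono) auto
    also have "\<dots> = \<epsilon>" by simp
    finally show "norm (\<Psi> x - \<Psi> 0) \<le> 0 + \<epsilon>" by simp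
  qed
  then show ?thesis by simp
qed

text \<open>
  Absolute continuity on the unit interval, encoded by a summable density in place of a derivative almost
  everywhere.
\<close>

definition primitive_of :: "(real \<Rightarrow> complex) \<Rightarrow> (real \<Rightarrow> complex) \<Rightarrow> bool" where
  "primitive_of F f \<longleftrightarrow>
     f absolutely_integrable_on {0..1} \<and> (\<forall>x\<in>{0..1}. integral {0..x} f = F x - F 0)"

lemma primitive_ofD:
  assumes "primitive_of F f"
  shows "f absolutely_integrable_on {0..1}" "\<And>x. 0 \<le> x \<Longrightarrow> x \<le> 1 \<Longrightarrow> integral {0..x} f = F x - F 0"
  using assms by (auto simp: primitive_of_def)

lemma primitive_diff:
  assumes "primitive_of F f" "0 \<le> a" "a \<le> b" "b \<le> 1"
  shows "F b - F a = integral {a..b} f"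
proof -
  have "integral {0..a} f + integral {a..b} f = integral {0..b} f"
    by (rule hk_integral_combine)
      (use assms in \<open>auto intro!: L1_integrable simp: primitive_of_def\<close>)
  then show ?thesis using primitive_ofD(2)[OF assms(1), of a] primitive_ofD(2)[OF assms(1), of b] assms(2-4)
    by (simp add: algebra_simps)
qed

lemma primitive_continuous:
  assumes "primitive_of F f"
  shows "continuous_on {0..1} F"
proof -
  have "continuous_on {0..1} (\<lambda>x. F 0 + integral {0..x} f)"
    by (intro continuous_intros indefinite_integral_continuous_1 L1_integrable) (use assms in \<open>auto simp: primitive_of_def\<close>)
  then show ?thesis
    by (rule continuous_on_eq) (use primitive_ofD(2)[OF assms] in auto)
qed

lemma primitive_integral:
  assumes "f absolutely_integrable_on {0..1}"
  shows "primitive_of (\<lambda>x. c + integral {0..x} f) f"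
  using assms by (auto simp: primitive_of_def)

lemma primitive_const: "primitive_of (\<lambda>x. c) (\<lambda>x. 0)"
  by (auto simp: primitive_of_def)

lemma primitive_linear: "primitive_of (\<lambda>x. c * of_real x) (\<lambda>x. c)"
proof -
  have "(\<lambda>x::real. c) absolutely_integrable_on {0..1}"
    by (intro absolutely_integrable_continuous_real continuous_intros)
  then show ?thesis
    by (auto simp: primitive_of_def scaleR_conv_of_real)
qed

lemma primitive_add:
  assumes "primitive_of F f" "primitive_of G g"
  shows "primitive_of (\<lambda>x. F x + G x) (\<lambda>x. f x + g x)"
proof -
  have "integral {0..x} (\<lambda>x. f x + g x) = integral {0..x} f + integral {0..x} g" if "x \<le> 1" for x
    by (intro integral_add L1_integrable) (use that assms in \<open>auto simp: primitive_of_def\<close>)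
  then show ?thesis using assms by (auto simp: primitive_of_def)
qed

lemma primitive_cmult:
  assumes "primitive_of F f"
  shows "primitive_of (\<lambda>x. c * F x) (\<lambda>x. c * f x)"
  using assms L1_mult_continuous[of f "\<lambda>_. c"]
  by (auto simp: primitive_of_def left_diff_distrib mult.commute[of c])

lemma primitive_cnj:
  assumes "primitive_of F f"
  shows "primitive_of (\<lambda>x. cnj (F x)) (\<lambda>x. cnj (f x))"
  using assms L1_cnj[where f=f] by (auto simp: primitive_of_def hk_integral_cnj[symmetric])

lemma primitive_of_real:
  assumes "f absolutely_integrable_on {0..1}"
  shows "primitive_of (\<lambda>x. of_real (integral {0..x} f)) (\<lambda>x. of_real (f x))"
proof -
  have "complex_of_real (integral {0..x} f) = integral {0..x} (\<lambda>x. of_real (f x))" if "x \<le> 1" for x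
    using integral_linear[OF L1_integrable[OF assms order_refl that] bounded_linear_of_real[where 'a=complex]]
    by (simp add: o_def)
  then show ?thesis using L1_of_real[OF assms] by (auto simp: primitive_of_def)
qed

lemma primitive_cong:
  assumes "primitive_of F f" "\<And>x. 0 \<le> x \<Longrightarrow> x \<le> 1 \<Longrightarrow> F x = G x" "\<And>x. 0 \<le> x \<Longrightarrow> x \<le> 1 \<Longrightarrow> f x = g x"
  shows "primitive_of G g"
proof -
  have "g absolutely_integrable_on {0..1}"
  proof -
    have "(f absolutely_integrable_on {0..1}) = (g absolutely_integrable_on {0..1})"
      by (rule set_integrable_cong) (use assms(3) in auto)
    then show ?thesis using primitive_ofD(1)[OF assms(1)] by blast
  qed
  moreover have "integral {0..x} f = integral {0..x} g" if "x \<le> 1" for x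
    by (rule integral_cong) (use that assms(3) in auto)
  ultimately show ?thesis using assms by (auto simp: primitive_of_def)
qed

text \<open>
  The common core of the product rule and the chain rule. Once \<open>H\<close> is written through other primitives,
  the error over a short interval is the oscillation of continuous functions times the integral of a
  fixed summable \<open>m\<close>.
\<close>

lemma primitive_of_calculus:
  fixes H h m :: "real \<Rightarrow> complex"
  assumes h: "h absolutely_integrable_on {0..1}" and m: "m absolutely_integrable_on {0..1}"
    and osc: "\<And>e. e > 0 \<Longrightarrow> \<exists>d>0. \<forall>a b. 0 \<le> a \<longrightarrow> a \<le> b \<longrightarrow> b \<le> 1 \<longrightarrow> b - a < d \<longrightarrow>
                norm (H b - H a - integral {a..b} h) \<le> e * integral {a..b} (\<lambda>t. norm (m t))"
  shows "primitive_of H h"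
proof -
  let ?\<Psi> = "\<lambda>x. H x - integral {0..x} h" and ?M = "\<lambda>x. integral {0..x} (\<lambda>t. norm (m t))"
  have "?\<Psi> x = ?\<Psi> 0" if "0 \<le> x" "x \<le> 1" for x
  proof (rule constant_if_oscillation_small[where M = ?M, OF _ that])
    fix e :: real assume "e > 0"
    then obtain d where "d > 0" and d: "\<And>a b. 0 \<le> a \<Longrightarrow> a \<le> b \<Longrightarrow> b \<le> 1 \<Longrightarrow> b - a < d \<Longrightarrow>
                norm (H b - H a - integral {a..b} h) \<le> e * integral {a..b} (\<lambda>t. norm (m t))"
      using osc by blast
    have "norm (?\<Psi> b - ?\<Psi> a) \<le> e * (?M b - ?M a)" if "0 \<le> a" "a \<le> b" "b \<le> 1" "b - a < d" for a b
    proof -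
      have "integral {0..a} h + integral {a..b} h = integral {0..b} h"
        "integral {0..a} (\<lambda>t. norm (m t)) + integral {a..b} (\<lambda>t. norm (m t)) = integral {0..b} (\<lambda>t. norm (m t))"
        by (rule hk_integral_combine;
            use that in \<open>auto intro!: L1_integrable[OF h] L1_norm_integrable[OF m]\<close>)+
      moreover have "H b - integral {0..b} h - (H a - integral {0..a} h)
          = H b - H a - (integral {0..b} h - integral {0..a} h)" by simp
      ultimately show ?thesis using d[OF that] by (smt (verit) add_diff_cancel_left')
    qed
    then show "\<exists>d>0. \<forall>a b. 0 \<le> a \<longrightarrow> a \<le> b \<longrightarrow> b \<le> 1 \<longrightarrow> b - a < d \<longrightarrow> norm (?\<Psi> b - ?\<Psi> a) \<le> e * (?M b - ?M a)"
      using \<open>d > 0\<close> by blast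
  qed
  then have eq: "H x - integral {0..x} h = H 0 - integral {0..0} h" if "0 \<le> x" "x \<le> 1" for x
    using that by blast
  have "integral {0..x} h = H x - H 0" if "0 \<le> x" "x \<le> 1" for x
  proof -
    have "integral {0..x} h = H x - (H x - integral {0..x} h)" by simp
    also have "\<dots> = H x - H 0" unfolding eq[OF that] by simp
    finally show ?thesis .
  qed
  then show ?thesis using h by (auto simp: primitive_of_def)
qed

lemma continuous_oscillation:
  fixes F :: "real \<Rightarrow> complex"
  assumes "continuous_on {0..1} F" "e > 0"
  shows "\<exists>d>0. \<forall>s\<in>{0..1}. \<forall>t\<in>{0..1}. \<bar>s - t\<bar> < d \<longrightarrow> norm (F s - F t) \<le> e"
proof -
  have "uniformly_continuous_on {0..1} F"
    by (rule compact_uniformly_continuous) (use assms in auto)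
  then obtain d where "d > 0" "\<forall>x\<in>{0..1}. \<forall>x'\<in>{0..1}. dist x' x < d \<longrightarrow> dist (F x') (F x) < e"
    using assms(2) unfolding uniformly_continuous_on_def by blast
  then show ?thesis
    by (intro exI[of _ d]) (fastforce simp: dist_norm less_imp_le norm_minus_commute)
qed

text \<open>
  The increment of \<open>F G\<close> over \<open>[a, b]\<close> is \<open>G b\<close> times the integral of \<open>f\<close> plus \<open>F a\<close> times the integral
  of \<open>g\<close>; moving the two factors under the integrals costs one oscillation each.
\<close>

lemma primitive_mult:
  assumes F: "primitive_of F f" and G: "primitive_of G g"
  shows "primitive_of (\<lambda>x. F x * G x) (\<lambda>x. f x * G x + g x * F x)"
proof (rule primitive_of_calculus)
  note fi = primitive_ofD(1)[OF F] and gi = primitive_ofD(1)[OF G]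
  note Fc = primitive_continuous[OF F] and Gc = primitive_continuous[OF G]
  have fG: "(\<lambda>x. f x * G x) absolutely_integrable_on {0..1}"
    and gF: "(\<lambda>x. g x * F x) absolutely_integrable_on {0..1}"
    by (intro L1_mult_continuous fi gi Fc Gc)+
  show "(\<lambda>x. f x * G x + g x * F x) absolutely_integrable_on {0..1}"
    using fG gF by (rule set_integral_add)
  let ?m = "\<lambda>x. complex_of_real (norm (f x) + norm (g x))"
  show m: "?m absolutely_integrable_on {0..1}"
    by (intro L1_of_real set_integral_add absolutely_integrable_norm[unfolded o_def] fi gi)
  fix e :: real assume "e > 0"
  obtain d1 where d1: "d1 > 0" "\<forall>s\<in>{0..1}. \<forall>t\<in>{0..1}. \<bar>s - t\<bar> < d1 \<longrightarrow> norm (F s - F t) \<le> e"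
    using continuous_oscillation[OF Fc \<open>e > 0\<close>] by blast
  obtain d2 where d2: "d2 > 0" "\<forall>s\<in>{0..1}. \<forall>t\<in>{0..1}. \<bar>s - t\<bar> < d2 \<longrightarrow> norm (G s - G t) \<le> e"
    using continuous_oscillation[OF Gc \<open>e > 0\<close>] by blast
  have "norm (F b * G b - F a * G a - integral {a..b} (\<lambda>x. f x * G x + g x * F x))
          \<le> e * integral {a..b} (\<lambda>t. norm (?m t))"
    if ab: "0 \<le> a" "a \<le> b" "b \<le> 1" "b - a < min d1 d2" for a b
  proof -
    have i: "f integrable_on {a..b}" "g integrable_on {a..b}" "(\<lambda>x. f x * G x) integrable_on {a..b}"
        "(\<lambda>x. g x * F x) integrable_on {a..b}" "(\<lambda>x. norm (?m x)) integrable_on {a..b}"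
      using ab by (auto intro!: L1_integrable[OF fi] L1_integrable[OF gi] L1_integrable[OF fG] L1_integrable[OF gF]
          L1_norm_integrable[OF m] simp del: norm_of_real of_real_add)
    have "F b * G b - F a * G a - integral {a..b} (\<lambda>x. f x * G x + g x * F x)
        = (F b - F a) * G b + (G b - G a) * F a - integral {a..b} (\<lambda>x. f x * G x + g x * F x)"
      by (simp add: algebra_simps)
    also have "\<dots> = integral {a..b} f * G b + integral {a..b} g * F a
        - (integral {a..b} (\<lambda>x. f x * G x) + integral {a..b} (\<lambda>x. g x * F x))"
      using primitive_diff[OF F, of a b] primitive_diff[OF G, of a b] ab
      by (simp add: hk_integral_add[OF i(3,4)])
    also have "\<dots> = integral {a..b} (\<lambda>x. (f x * G b + g x * F a) - (f x * G x + g x * F x))"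
      using i by (simp add: hk_integral_add hk_integral_diff integrable_add
          integrable_on_mult_left)
    also have "norm \<dots> \<le> integral {a..b} (\<lambda>x. e * norm (?m x))"
    proof (rule hk_integral_norm_bound_integral)
      fix x assume x: "x \<in> {a..b}"
      have "norm (f x * G b + g x * F a - (f x * G x + g x * F x)) = norm (f x * (G b - G x) + g x * (F a - F x))"
        by (simp add: algebra_simps)
      also have "\<dots> \<le> norm (f x) * norm (G b - G x) + norm (g x) * norm (F a - F x)"
        by (metis norm_mult norm_triangle_ineq)
      also have "\<dots> \<le> norm (f x) * e + norm (g x) * e"
        using ab x by (intro add_mono mult_left_mono d1(2)[rule_format] d2(2)[rule_format]) auto
      finally show "norm (f x * G b + g x * F a - (f x * G x + g x * F x)) \<le> e * norm (?m x)"
        by (simp add: algebra_simps del: of_real_add)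
    qed (use i in \<open>auto intro!: integrable_add integrable_diff integrable_on_mult_left integrable_on_mult_right\<close>)
    finally show ?thesis by simp
  qed
  then show "\<exists>d>0. \<forall>a b. 0 \<le> a \<longrightarrow> a \<le> b \<longrightarrow> b \<le> 1 \<longrightarrow> b - a < d \<longrightarrow>
      norm (F b * G b - F a * G a - integral {a..b} (\<lambda>x. f x * G x + g x * F x))
          \<le> e * integral {a..b} (\<lambda>t. norm (?m t))"
    using d1 d2 by (intro exI[of _ "min d1 d2"]) auto
qed

lemma norm_exp_remainder:
  fixes z :: complex
  assumes "norm z \<le> 1"
  shows "norm (exp z - 1 - z) \<le> exp 1 * norm z ^ 2"
proof -
  have "norm (exp z - (\<Sum>i\<le>1. z ^ i / fact i)) \<le> exp \<bar>Re z\<bar> * norm z ^ Suc 1 / fact 1"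
    by (rule Taylor_exp)
  also have "exp \<bar>Re z\<bar> * norm z ^ Suc 1 / fact 1 \<le> exp 1 * norm z ^ 2"
    using abs_Re_le_cmod[of z] assms by (auto simp: power2_eq_square intro!: mult_right_mono)
  finally show ?thesis by (simp add: diff_diff_eq)
qed

text \<open>
  The increment of \<open>exp F\<close> is compared with \<open>exp (F a)\<close> times that of \<open>F\<close>; the remainder is quadratic in
  the increment of \<open>F\<close>, and one of its two factors is small.
\<close>

lemma primitive_exp:
  assumes F: "primitive_of F f"
  shows "primitive_of (\<lambda>x. exp (F x)) (\<lambda>x. f x * exp (F x))"
proof (rule primitive_of_calculus)
  note fi = primitive_ofD(1)[OF F] and Fc = primitive_continuous[OF F]
  have Ec: "continuous_on {0..1} (\<lambda>x. exp (F x))" by (intro continuous_intros Fc)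
  show fE: "(\<lambda>x. f x * exp (F x)) absolutely_integrable_on {0..1}"
    by (intro L1_mult_continuous fi Ec)
  show "f absolutely_integrable_on {0..1}" by fact
  have "bounded ((\<lambda>x. exp (F x)) ` {0..1})"
    by (intro compact_imp_bounded compact_continuous_image Ec) auto
  then obtain K where K: "K > 0" "\<And>x. 0 \<le> x \<Longrightarrow> x \<le> 1 \<Longrightarrow> norm (exp (F x)) \<le> K"
    unfolding bounded_pos by auto
  fix e :: real assume "e > 0"
  \<comment> \<open>The bound 1 admits the Taylor remainder; the other one makes it at most half of the error.\<close>
  let ?e = "min 1 (e / (2 * K * exp 1))"
  have e': "?e > 0" using \<open>e > 0\<close> K by auto
  obtain d1 where d1: "d1 > 0" "\<forall>s\<in>{0..1}. \<forall>t\<in>{0..1}. \<bar>s - t\<bar> < d1 \<longrightarrow> norm (F s - F t) \<le> ?e"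
    using continuous_oscillation[OF Fc e'] by blast
  obtain d2 where d2: "d2 > 0" "\<forall>s\<in>{0..1}. \<forall>t\<in>{0..1}. \<bar>s - t\<bar> < d2 \<longrightarrow> norm (exp (F s) - exp (F t)) \<le> e/2"
    using continuous_oscillation[OF Ec half_gt_zero[OF \<open>e > 0\<close>]] by blast
  have "norm (exp (F b) - exp (F a) - integral {a..b} (\<lambda>x. f x * exp (F x))) \<le> e * integral {a..b} (\<lambda>t. norm (f t))"
    if ab: "0 \<le> a" "a \<le> b" "b \<le> 1" "b - a < min d1 d2" for a b
  proof -
    have i: "f integrable_on {a..b}" "(\<lambda>x. f x * exp (F x)) integrable_on {a..b}" "(\<lambda>x. norm (f x)) integrable_on {a..b}"
      using ab by (auto intro!: L1_integrable[OF fi] L1_integrable[OF fE] L1_norm_integrable[OF fi])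
    let ?h = "F b - F a" and ?I = "integral {a..b} (\<lambda>t. norm (f t))"
    have h: "?h = integral {a..b} f" using ab by (intro primitive_diff[OF F])
    have hI: "norm ?h \<le> ?I" unfolding h
      by (rule hk_integral_norm_bound_integral) (use i in auto)
    have he: "norm ?h \<le> ?e" using ab d1 by (intro d1(2)[rule_format]) auto
    have eb: "exp (F b) = exp (F a) * exp ?h" by (simp add: exp_add[symmetric])
    have 1: "norm (exp (F a) * (exp ?h - 1 - ?h)) \<le> e / 2 * ?I"
    proof -
      have "norm (exp (F a) * (exp ?h - 1 - ?h)) \<le> K * (exp 1 * norm ?h ^ 2)"
        unfolding norm_mult using K ab he by (intro mult_mono norm_exp_remainder K) auto
      also have "\<dots> = (K * exp 1 * norm ?h) * norm ?h" by (simp add: power2_eq_square)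
      also have "\<dots> \<le> (K * exp 1 * (e / (2 * K * exp 1))) * ?I"
        using K he hI \<open>e > 0\<close> by (intro mult_mono) auto
      also have "\<dots> = e / 2 * ?I" using K by simp
      finally show ?thesis .
    qed
    have "integral {a..b} f * exp (F a) - integral {a..b} (\<lambda>x. f x * exp (F x))
        = integral {a..b} (\<lambda>x. f x * exp (F a) - f x * exp (F x))"
      using i by (simp add: hk_integral_diff integrable_on_mult_left)
    also have "norm \<dots> \<le> integral {a..b} (\<lambda>x. e / 2 * norm (f x))"
    proof (rule hk_integral_norm_bound_integral)
      fix x assume x: "x \<in> {a..b}"
      have "norm (f x * exp (F a) - f x * exp (F x)) = norm (f x) * norm (exp (F a) - exp (F x))"
        by (metis norm_mult right_diff_distrib)
      also have "\<dots> \<le> norm (f x) * (e / 2)"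
        using ab x by (intro mult_left_mono d2(2)[rule_format]) auto
      finally show "norm (f x * exp (F a) - f x * exp (F x)) \<le> e / 2 * norm (f x)" by (simp add: mult.commute)
    qed (use i in \<open>auto intro!: integrable_diff integrable_on_mult_left integrable_on_mult_right integrable_on_divide\<close>)
    finally have 2: "norm (integral {a..b} f * exp (F a) - integral {a..b} (\<lambda>x. f x * exp (F x))) \<le> e / 2 * ?I"
      by simp
    have "exp (F b) - exp (F a) - integral {a..b} (\<lambda>x. f x * exp (F x))
      = exp (F a) * (exp ?h - 1 - ?h) + (integral {a..b} f * exp (F a) - integral {a..b} (\<lambda>x. f x * exp (F x)))"
      unfolding eb h[symmetric] by (simp add: algebra_simps)
    then show ?thesis using 1 2 by (smt (verit) norm_triangle_ineq field_sum_of_halves mult.commute distrib_left)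
  qed
  then show "\<exists>d>0. \<forall>a b. 0 \<le> a \<longrightarrow> a \<le> b \<longrightarrow> b \<le> 1 \<longrightarrow> b - a < d \<longrightarrow>
      norm (exp (F b) - exp (F a) - integral {a..b} (\<lambda>x. f x * exp (F x))) \<le> e * integral {a..b} (\<lambda>t. norm (f t))"
    using d1 d2 by (intro exI[of _ "min d1 d2"]) auto
qed

section \<open>The Riemann-Lebesgue lemma\<close>

lemma L1_truncation:
  fixes f :: "real \<Rightarrow> real"
  assumes f: "f absolutely_integrable_on {0..1}"
  shows "(\<lambda>n. integral {0..1} (\<lambda>x. \<bar>f x - max (- real n) (min (f x) (real n))\<bar>)) \<longlonglongrightarrow> 0"
proof -
  let ?c = "\<lambda>n x. max (- real n) (min (f x) (real n))"
  have c: "?c n absolutely_integrable_on {0..1}" for n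
    by (intro absolutely_integrable_max_1 absolutely_integrable_min_1 f) (auto intro!: absolutely_integrable_continuous_real)
  have "(\<lambda>n. integral {0..1} (\<lambda>x. \<bar>f x - ?c n x\<bar>)) \<longlonglongrightarrow> integral {0..1} (\<lambda>x::real. 0::real)"
  proof (rule dominated_convergence(2)[where h = "\<lambda>x. \<bar>f x\<bar>"])
    show "(\<lambda>x. \<bar>f x - ?c n x\<bar>) integrable_on {0..1}" for n
      using L1_norm_integrable[OF set_integral_diff(1)[OF f c], of 0 1 n] by simp
    show "(\<lambda>x. \<bar>f x\<bar>) integrable_on {0..1}"
      using L1_norm_integrable[OF f, of 0 1] by simp
    show "norm \<bar>f x - ?c n x\<bar> \<le> \<bar>f x\<bar>" for n x by (auto simp: max_def min_def)
    fix x
    obtain N where N: "\<bar>f x\<bar> \<le> real N" using real_arch_simple by blast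
    have "\<forall>\<^sub>F n in sequentially. \<bar>f x - ?c n x\<bar> = 0"
      using eventually_ge_at_top[of N]
    proof eventually_elim
      case (elim n)
      then have "real N \<le> real n" by simp
      then show ?case using N by (auto simp: max_def min_def)
    qed
    then show "(\<lambda>n. \<bar>f x - ?c n x\<bar>) \<longlonglongrightarrow> 0" by (rule tendsto_eventually)
  qed
  then show ?thesis by simp
qed

text \<open>
  A measurable function is almost everywhere a limit of continuous functions; clamped to the range of a
  bounded \<open>f\<close>, these converge in the mean by dominated convergence.
\<close>

lemma L1_bounded_continuous_approximation:
  fixes f :: "real \<Rightarrow> real"
  assumes f: "f absolutely_integrable_on {0..1}" and bd: "\<And>x. \<bar>f x\<bar> \<le> K" and "e > 0"
  shows "\<exists>g. continuous_on UNIV g \<and> integral {0..1} (\<lambda>x. \<bar>f x - g x\<bar>) < e"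
proof -
  let ?f = "\<lambda>x. if x \<in> {0..1} then f x else 0"
  have "?f \<in> borel_measurable lebesgue"
    by (rule borel_measurable_if_I[OF absolutely_integrable_imp_borel_measurable[OF f]]) auto
  then have "?f measurable_on {0..1}"
    by (intro lebesgue_measurable_imp_measurable_on) auto
  then obtain N g where N: "negligible N" and g: "\<And>n. continuous_on UNIV (g n)"
    and lim: "\<And>x. x \<notin> N \<Longrightarrow> (\<lambda>n. g n x) \<longlonglongrightarrow> (if x \<in> {0..1} then ?f x else 0)"
    unfolding measurable_on_def by blast
  define c where "c = (\<lambda>n x. max (- K) (min (g n x) K))"
  have cc: "continuous_on UNIV (c n)" for n
    unfolding c_def by (intro continuous_intros g)
  have ci: "c n absolutely_integrable_on {0..1}" for n
    by (intro absolutely_integrable_continuous_real continuous_on_subset[OF cc]) auto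
  have K: "K \<ge> 0" using bd[of 0] by linarith
  have di: "(\<lambda>x. \<bar>f x - c n x\<bar>) integrable_on {0..1}" for n
    using L1_norm_integrable[OF set_integral_diff(1)[OF f ci], of 0 1 n] by simp
  have neg: "negligible ({0..1} - ({0..1} - N) \<union> ({0..1} - N - {0..1}))"
    by (rule negligible_subset[OF N]) auto
  have "(\<lambda>n. integral ({0..1} - N) (\<lambda>x. \<bar>f x - c n x\<bar>)) \<longlonglongrightarrow> integral ({0..1} - N) (\<lambda>x::real. 0::real)"
  proof (rule dominated_convergence(2)[where h = "\<lambda>x. 2 * K"])
    show "(\<lambda>x. \<bar>f x - c n x\<bar>) integrable_on {0..1} - N" for n
      using di integrable_spike_set_eq[OF neg] by blast
    have "(\<lambda>x::real. 2 * K) integrable_on {0..1}" by auto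
    then show "(\<lambda>x. 2 * K) integrable_on {0..1} - N"
      using integrable_spike_set_eq[OF neg] by blast
    show "norm \<bar>f x - c n x\<bar> \<le> 2 * K" for n x
      using bd[of x] K by (auto simp: c_def max_def min_def)
    fix x assume "x \<in> {0..1} - N"
    then have "(\<lambda>n. g n x) \<longlonglongrightarrow> f x" using lim[of x] by auto
    then have "(\<lambda>n. c n x) \<longlonglongrightarrow> max (- K) (min (f x) K)"
      unfolding c_def by (intro tendsto_intros)
    also have "max (- K) (min (f x) K) = f x" using bd[of x] K by (auto simp: max_def min_def)
    finally show "(\<lambda>n. \<bar>f x - c n x\<bar>) \<longlonglongrightarrow> 0"
      by (auto intro!: tendsto_eq_intros)
  qed
  then have "(\<lambda>n. integral ({0..1} - N) (\<lambda>x. \<bar>f x - c n x\<bar>)) \<longlonglongrightarrow> 0" by simp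
  then have "\<forall>\<^sub>F n in sequentially. integral ({0..1} - N) (\<lambda>x. \<bar>f x - c n x\<bar>) < e"
    using \<open>e > 0\<close> by (rule order_tendstoD)
  then obtain n where "integral ({0..1} - N) (\<lambda>x. \<bar>f x - c n x\<bar>) < e"
    using eventually_sequentially by auto
  moreover have "integral ({0..1} - N) (\<lambda>x. \<bar>f x - c n x\<bar>) = integral {0..1} (\<lambda>x. \<bar>f x - c n x\<bar>)"
    by (rule integral_spike_set; rule negligible_subset[OF N]) auto
  ultimately show ?thesis using cc by auto
qed

lemma L1_polynomial_approximation:
  fixes f :: "real \<Rightarrow> real"
  assumes f: "f absolutely_integrable_on {0..1}" and "e > 0"
  shows "\<exists>p. real_polynomial_function p \<and> integral {0..1} (\<lambda>x. \<bar>f x - p x\<bar>) < e"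
proof -
  have "\<forall>\<^sub>F n in sequentially. integral {0..1} (\<lambda>x. \<bar>f x - max (- real n) (min (f x) (real n))\<bar>) < e / 3"
    using L1_truncation[OF f] by (rule order_tendstoD) (use \<open>e > 0\<close> in auto)
  then obtain n where n: "integral {0..1} (\<lambda>x. \<bar>f x - max (- real n) (min (f x) (real n))\<bar>) < e / 3"
    using eventually_sequentially by auto
  define h where "h = (\<lambda>x. max (- real n) (min (f x) (real n)))"
  have h: "h absolutely_integrable_on {0..1}" unfolding h_def
    by (intro absolutely_integrable_max_1 absolutely_integrable_min_1 f) (auto intro!: absolutely_integrable_continuous_real)
  have "\<bar>h x\<bar> \<le> real n" for x by (auto simp: h_def max_def min_def)
  from L1_bounded_continuous_approximation[OF h this, of "e / 3"] \<open>e > 0\<close>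
  obtain g where g: "continuous_on UNIV g" and g3: "integral {0..1} (\<lambda>x. \<bar>h x - g x\<bar>) < e / 3" by auto
  have gc: "continuous_on {0..1} g" using g continuous_on_subset by blast
  obtain p where p: "real_polynomial_function p" and p3: "\<And>x. x \<in> {0..1} \<Longrightarrow> \<bar>g x - p x\<bar> < e / 3"
    using Stone_Weierstrass_real_polynomial_function[of "{0..1}" g "e / 3"] gc \<open>e > 0\<close>
    by (metis compact_Icc divide_pos_pos zero_less_numeral)
  have pc: "continuous_on {0..1} p"
    using p by (simp add: continuous_on_polymonial_function real_polynomial_function_eq)
  have gi: "g absolutely_integrable_on {0..1}" and pi: "p absolutely_integrable_on {0..1}"
    by (intro absolutely_integrable_continuous_real gc pc)+
  have i: "(\<lambda>x. \<bar>f x - h x\<bar>) integrable_on {0..1}" "(\<lambda>x. \<bar>h x - g x\<bar>) integrable_on {0..1}"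
      "(\<lambda>x. \<bar>f x - p x\<bar>) integrable_on {0..1}"
    using L1_norm_integrable[OF set_integral_diff(1)[OF f h], of 0 1]
      L1_norm_integrable[OF set_integral_diff(1)[OF h gi], of 0 1]
      L1_norm_integrable[OF set_integral_diff(1)[OF f pi], of 0 1] by auto
  have "integral {0..1} (\<lambda>x. \<bar>f x - p x\<bar>) \<le> integral {0..1} (\<lambda>x. \<bar>f x - h x\<bar> + \<bar>h x - g x\<bar> + e / 3)"
  proof (rule integral_le)
    show "(\<lambda>x. \<bar>f x - h x\<bar> + \<bar>h x - g x\<bar> + e / 3) integrable_on {0..1}"
      by (intro integrable_add i) auto
    show "\<bar>f x - p x\<bar> \<le> \<bar>f x - h x\<bar> + \<bar>h x - g x\<bar> + e / 3" if "x \<in> {0..1}" for x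
      using p3[OF that] by linarith
  qed (use i in auto)
  also have "\<dots> = integral {0..1} (\<lambda>x. \<bar>f x - h x\<bar>) + integral {0..1} (\<lambda>x. \<bar>h x - g x\<bar>) + e / 3"
    using hk_integral_add[OF integrable_add[OF i(1,2)] integrable_const_ivl[of "e / 3"]]
      hk_integral_add[OF i(1,2)] by simp
  also have "\<dots> < e" using n g3 by (simp add: h_def)
  finally show ?thesis using p by auto
qed

lemma primitive_cis:
  assumes "primitive_of (\<lambda>x. of_real (F x)) (\<lambda>x. of_real (f x))"
  shows "primitive_of (\<lambda>x. cis (F x)) (\<lambda>x. \<i> * of_real (f x) * cis (F x))"
  using primitive_exp[OF primitive_cmult[OF assms, of \<i>]] by (simp add: cis_conv_exp)

lemma primitive_cis_linear: "primitive_of (\<lambda>x. cis (c * x)) (\<lambda>x. \<i> * of_real c * cis (c * x))"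
  using primitive_linear[of "of_real c"] by (intro primitive_cis) simp

lemma primitive_C1:
  fixes p p' :: "real \<Rightarrow> complex"
  assumes "\<And>x. 0 \<le> x \<Longrightarrow> x \<le> 1 \<Longrightarrow> (p has_vector_derivative p' x) (at x within {0..1})" "continuous_on {0..1} p'"
  shows "primitive_of p p'"
  unfolding primitive_of_def
proof (intro conjI ballI)
  show "p' absolutely_integrable_on {0..1}" by (intro absolutely_integrable_continuous_real assms)
  fix x :: real assume x: "x \<in> {0..1}"
  show "integral {0..x} p' = p x - p 0"
    by (intro integral_unique fundamental_theorem_of_calculus)
      (use x in \<open>auto intro!: has_vector_derivative_within_subset[OF assms(1)]\<close>)
qed

text \<open>
  Uniform in the upper limit \<open>x\<close> and in real frequencies \<open>k\<close>. For a polynomial, integration by parts gives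
  a bound \<open>O(1/k)\<close>, and polynomials are dense.
\<close>

lemma riemann_lebesgue:
  fixes f :: "real \<Rightarrow> real"
  assumes f: "f absolutely_integrable_on {0..1}" and "e > 0"
  shows "\<exists>K>0. \<forall>k\<ge>K. \<forall>x\<in>{0..1}. norm (integral {0..x} (\<lambda>t. of_real (f t) * cis (- (2 * k * t)))) \<le> e"
proof -
  obtain p where p: "real_polynomial_function p" and fp: "integral {0..1} (\<lambda>x. \<bar>f x - p x\<bar>) < e / 2"
    using L1_polynomial_approximation[OF f, of "e / 2"] \<open>e > 0\<close> by auto
  obtain p' where p': "real_polynomial_function p'" and dp: "\<And>x. (p has_real_derivative p' x) (at x)"
    using has_real_derivative_polynomial_function[OF p] by blast
  have pc: "continuous_on {0..1} p" and pc': "continuous_on {0..1} p'"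
    using p p' by (simp_all add: continuous_on_polymonial_function real_polynomial_function_eq)
  have pi: "p absolutely_integrable_on {0..1}" and pi': "p' absolutely_integrable_on {0..1}"
    by (intro absolutely_integrable_continuous_real pc pc')+
  have P: "primitive_of (\<lambda>x. of_real (p x)) (\<lambda>x. of_real (p' x))"
  proof (rule primitive_C1)
    show "((\<lambda>x. complex_of_real (p x)) has_vector_derivative of_real (p' x)) (at x within {0..1})" for x
      by (rule has_vector_derivative_of_real) (use dp in \<open>auto intro: DERIV_subset simp: has_real_derivative_iff_has_vector_derivative[symmetric]\<close>)
    show "continuous_on {0..1} (\<lambda>x. complex_of_real (p' x))" by (intro continuous_intros pc')
  qed
  have "bounded (p ` {0..1})" by (intro compact_imp_bounded compact_continuous_image pc) auto
  then obtain B where B: "B > 0" "\<And>x. 0 \<le> x \<Longrightarrow> x \<le> 1 \<Longrightarrow> \<bar>p x\<bar> \<le> B" unfolding bounded_pos by auto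
  define B' where "B' = integral {0..1} (\<lambda>t. norm (complex_of_real (p' t)))"
  have B': "B' \<ge> 0" unfolding B'_def by (intro hk_integral_nonneg L1_norm_integrable L1_of_real pi') auto
  define K where "K = (2 * B + B') / e + 1"
  have K: "K > 0" using B B' \<open>e > 0\<close> by (auto simp: K_def intro!: add_nonneg_pos)
  have "norm (integral {0..x} (\<lambda>t. of_real (f t) * cis (- (2 * k * t)))) \<le> e" if k: "k \<ge> K" and x: "0 \<le> x" "x \<le> 1" for k x
  proof -
    have k0: "k > 0" using K k by linarith
    let ?E = "\<lambda>t. cis (- (2 * k) * t)"
    have Ec: "continuous_on {0..1} ?E" using primitive_continuous[OF primitive_cis_linear] .
    have i1: "(\<lambda>t. of_real (p t) * ?E t) absolutely_integrable_on {0..1}"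
      "(\<lambda>t. of_real (p' t) * ?E t) absolutely_integrable_on {0..1}"
      "(\<lambda>t. of_real (f t - p t) * ?E t) absolutely_integrable_on {0..1}"
      by (intro L1_mult_of_real_continuous pi pi' Ec set_integral_diff f)+
    note ii = i1[THEN L1_integrable, OF order_refl x(2)]
    have "of_real (p x) * ?E x - of_real (p 0) * ?E 0
       = integral {0..x} (\<lambda>t. of_real (p' t) * ?E t + \<i> * of_real (- (2 * k)) * ?E t * of_real (p t))"
      using primitive_ofD(2)[OF primitive_mult[OF P primitive_cis_linear[of "- (2 * k)"]] x] by simp
    also have "\<dots> = integral {0..x} (\<lambda>t. of_real (p' t) * ?E t + \<i> * of_real (- (2 * k)) * (of_real (p t) * ?E t))"
      by (simp add: mult_ac)
    also have "\<dots> = integral {0..x} (\<lambda>t. of_real (p' t) * ?E t) + \<i> * of_real (- (2 * k)) * integral {0..x} (\<lambda>t. of_real (p t) * ?E t)"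
      by (subst hk_integral_add) (use ii in \<open>auto intro!: integrable_on_mult_right integrable_neg\<close>)
    finally have eq: "\<i> * of_real (2 * k) * integral {0..x} (\<lambda>t. of_real (p t) * ?E t)
        = integral {0..x} (\<lambda>t. of_real (p' t) * ?E t) - of_real (p x) * ?E x + of_real (p 0) * ?E 0"
      by (simp add: algebra_simps)
    have "2 * k * norm (integral {0..x} (\<lambda>t. of_real (p t) * ?E t))
        = norm (integral {0..x} (\<lambda>t. of_real (p' t) * ?E t) - of_real (p x) * ?E x + of_real (p 0) * ?E 0)"
      unfolding eq[symmetric] using k0 by (simp add: norm_mult)
    also have "\<dots> \<le> norm (integral {0..x} (\<lambda>t. of_real (p' t) * ?E t)) + norm (of_real (p x) * ?E x) + norm (of_real (p 0) * ?E 0)"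
      by (rule norm_triangle_le, rule add_right_mono, rule norm_triangle_ineq4)
    also have "\<dots> \<le> 1 * B' + B + B"
    proof (intro add_mono)
      show "norm (integral {0..x} (\<lambda>t. of_real (p' t) * ?E t)) \<le> 1 * B'"
        unfolding B'_def
        by (rule norm_integral_le_L1[OF L1_of_real[OF pi'] i1(2)]) (use x in \<open>auto simp: norm_mult\<close>)
    qed (use x B(2)[of x] B(2)[of 0] in \<open>auto simp: norm_mult\<close>)
    finally have "2 * k * norm (integral {0..x} (\<lambda>t. of_real (p t) * ?E t)) \<le> 2 * B + B'" by simp
    also have "\<dots> \<le> e * k"
      using k \<open>e > 0\<close> unfolding K_def by (simp add: field_simps)
    finally have 1: "norm (integral {0..x} (\<lambda>t. of_real (p t) * ?E t)) \<le> e / 2" using k0 by (simp add: field_simps)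
    have 2: "norm (integral {0..x} (\<lambda>t. of_real (f t - p t) * ?E t)) \<le> 1 * integral {0..1} (\<lambda>t. norm (f t - p t))"
      by (rule norm_integral_le_L1[OF set_integral_diff(1)[OF f pi] i1(3)])
        (use x in \<open>auto simp: norm_mult simp del: of_real_diff\<close>)
    have "integral {0..x} (\<lambda>t. of_real (f t) * ?E t)
        = integral {0..x} (\<lambda>t. of_real (f t - p t) * ?E t + of_real (p t) * ?E t)"
      by (simp add: algebra_simps)
    also have "\<dots> = integral {0..x} (\<lambda>t. of_real (f t - p t) * ?E t) + integral {0..x} (\<lambda>t. of_real (p t) * ?E t)"
      by (rule hk_integral_add) (use ii in auto)
    finally show ?thesis using 1 2 fp norm_triangle_ineq[of "integral {0..x} (\<lambda>t. of_real (f t - p t) * ?E t)" "integral {0..x} (\<lambda>t. of_real (p t) * ?E t)"]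
      by simp
  qed
  then show ?thesis using K by (intro exI[of _ K]) auto
qed

text \<open>
  If all integrals of \<open>h\<close> over intervals vanish, the sums in Henstock's lemma become the Riemann sums of
  \<open>|h|\<close>, so \<open>|h|\<close> has integral 0.
\<close>

lemma AE_zero_if_integrals_zero:
  fixes h :: "real \<Rightarrow> real"
  assumes h: "h absolutely_integrable_on {0..1}" and z: "\<And>x. 0 \<le> x \<Longrightarrow> x \<le> 1 \<Longrightarrow> integral {0..x} h = 0"
  shows "AE x in lebesgue. x \<in> {0..1} \<longrightarrow> h x = 0"
proof -
  have zab: "integral {a..b} h = 0" if "0 \<le> a" "a \<le> b" "b \<le> 1" for a b
  proof -
    have "integral {0..a} h + integral {a..b} h = integral {0..b} h"
      by (rule hk_integral_combine) (use that in \<open>auto intro!: L1_integrable h\<close>)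
    then show ?thesis using z that by auto
  qed
  \<comment> \<open>Henstock: the sum of |content h - integral| over a fine division is small, and the integrals are 0.\<close>
  have "((\<lambda>x. \<bar>h x\<bar>) has_integral 0) {0..1}"
    unfolding has_integral_real
  proof (intro allI impI)
    fix e :: real assume "e > 0"
    have "h integrable_on cbox 0 1" using L1_integrable[OF h, of 0 1] by simp
    then obtain \<gamma> where \<gamma>: "gauge \<gamma>"
      and less: "\<And>p. p tagged_partial_division_of (cbox 0 1) \<Longrightarrow> \<gamma> fine p \<Longrightarrow>
             sum (\<lambda>(x,k). norm (measure lborel k *\<^sub>R h x - integral k h)) p < e"
      by (rule Henstock_lemma[OF _ \<open>e > 0\<close>]) blast
    show "\<exists>\<gamma>. gauge \<gamma> \<and> (\<forall>\<D>. \<D> tagged_division_of {0..1} \<and> \<gamma> fine \<D> \<longrightarrow>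
        norm ((\<Sum>(x, k)\<in>\<D>. measure lborel k *\<^sub>R \<bar>h x\<bar>) - 0) < e)"
    proof (rule exI[of _ \<gamma>], intro conjI allI impI \<gamma>, elim conjE)
      fix \<D> assume D: "\<D> tagged_division_of {0..1::real}" and fine: "\<gamma> fine \<D>"
      have "(\<Sum>(x, k)\<in>\<D>. norm (measure lborel k *\<^sub>R h x - integral k h)) = (\<Sum>(x, k)\<in>\<D>. measure lborel k *\<^sub>R \<bar>h x\<bar>)"
      proof (rule sum.cong[OF refl], clarify)
        fix x k assume xk: "(x, k) \<in> \<D>"
        then obtain a b where k: "k = {a..b}" using tagged_division_ofD(4)[OF D xk] by auto
        have "k \<subseteq> {0..1}" "x \<in> k" using tagged_division_ofD(2,3)[OF D xk] by auto
        then have "integral k h = 0" unfolding k by (intro zab) auto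
        then show "norm (measure lborel k *\<^sub>R h x - integral k h) = measure lborel k *\<^sub>R \<bar>h x\<bar>" by (simp add: abs_mult)
      qed
      moreover have "(\<Sum>(x, k)\<in>\<D>. norm (measure lborel k *\<^sub>R h x - integral k h)) < e"
        using D fine by (intro less) (auto simp: tagged_division_of_def)
      moreover have "(\<Sum>(x, k)\<in>\<D>. measure lborel k *\<^sub>R \<bar>h x\<bar>) \<ge> 0"
        by (intro sum_nonneg) (auto split: prod.splits)
      ultimately show "norm ((\<Sum>(x, k)\<in>\<D>. measure lborel k *\<^sub>R \<bar>h x\<bar>) - 0) < e" by simp
    qed
  qed
  then have "integral {0..1} (\<lambda>x. \<bar>h x\<bar>) = 0" by (rule integral_unique)
  moreover have hn: "(\<lambda>x. \<bar>h x\<bar>) absolutely_integrable_on {0..1}"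
    using absolutely_integrable_norm[OF h] by (simp add: o_def)
  ultimately have "(LINT x:{0..1}|lebesgue. \<bar>h x\<bar>) = 0"
    by (simp add: set_lebesgue_integral_eq_integral(2))
  then have "AE x in lebesgue. indicat_real {0..1} x *\<^sub>R \<bar>h x\<bar> = 0"
    unfolding set_lebesgue_integral_def
    by (subst (asm) integral_nonneg_eq_0_iff_AE) (use hn in \<open>auto simp: set_integrable_def\<close>)
  then show ?thesis by eventually_elim (auto simp: indicator_def split: if_splits)
qed

section \<open>Uniqueness of Fourier coefficients\<close>

inductive trig_polynomial :: "(real \<Rightarrow> complex) \<Rightarrow> bool" where
  trig_monomial: "trig_polynomial (\<lambda>t. c * cis (2 * pi * of_int m * t))"
| trig_add: "trig_polynomial u \<Longrightarrow> trig_polynomial v \<Longrightarrow> trig_polynomial (\<lambda>t. u t + v t)"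

lemma trig_polynomial_mult:
  assumes "trig_polynomial u" "trig_polynomial v"
  shows "trig_polynomial (\<lambda>t. u t * v t)"
  using assms
proof (induction u rule: trig_polynomial.induct)
  case (trig_monomial c m)
  from this show ?case
  proof (induction v rule: trig_polynomial.induct)
    case (trig_monomial d n)
    have "trig_polynomial (\<lambda>t. (c * d) * cis (2 * pi * of_int (m + n) * t))"
      by (rule trig_polynomial.trig_monomial)
    then show ?case by (simp add: cis_mult[symmetric] algebra_simps)
  next
    case (trig_add u v)
    then show ?case using trig_polynomial.trig_add[OF trig_add.IH] by (simp add: algebra_simps)
  qed
next
  case (trig_add u w)
  then show ?case using trig_polynomial.trig_add[of "\<lambda>t. u t * v t" "\<lambda>t. w t * v t"] by (simp add: algebra_simps)
qed

lemma trig_polynomial_const: "trig_polynomial (\<lambda>t. c)"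
  using trig_monomial[of c 0] by simp

text \<open>
  A real polynomial in the two coordinates of the plane becomes a trigonometric polynomial on the unit
  circle, which is the form in which the Stone-Weierstrass theorem delivers approximations of periodic
  functions.
\<close>

lemma trig_polynomial_on_circle:
  assumes "real_polynomial_function g"
  shows "trig_polynomial (\<lambda>t. of_real (g (cis (2 * pi * t))))"
  using assms
proof (induction g rule: real_polynomial_function.induct)
  case (linear f)
  have lin: "f z = Re z * f 1 + Im z * f \<i>" for z
  proof -
    have "z = Re z *\<^sub>R 1 + Im z *\<^sub>R \<i>" by (simp add: complex_eq_iff)
    then have "f z = f (Re z *\<^sub>R 1 + Im z *\<^sub>R \<i>)" by (rule arg_cong)
    then show ?thesis using linear by (simp add: linear_simps)
  qed
  have re: "of_real (Re z) = (z + cnj z) / 2" and im: "of_real (Im z) = - (\<i> / 2) * (z - cnj z)" for z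
    by (simp_all add: complex_eq_iff)
  have *: "of_real (f (cis (2 * pi * t)))
      = (of_real (f 1) / 2 - (\<i> / 2) * of_real (f \<i>)) * cis (2 * pi * of_int 1 * t)
        + (of_real (f 1) / 2 + (\<i> / 2) * of_real (f \<i>)) * cis (2 * pi * of_int (-1) * t)" for t
    unfolding lin[of "cis (2 * pi * t)"] of_real_add of_real_mult re im
    by (simp add: cis_cnj field_simps)
  show ?case unfolding * by (intro trig_polynomial.intros)
next
  case (mult f g)
  then show ?case by (simp add: trig_polynomial_mult)
next
  case (add f g)
  then show ?case by (simp add: trig_add)
qed (simp add: trig_polynomial_const)

lemma trig_polynomial_continuous: "trig_polynomial u \<Longrightarrow> continuous_on S u"
  by (induction u rule: trig_polynomial.induct) (auto simp: cis_conv_exp intro!: continuous_intros)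

lemma integral_trig_polynomial_eq_0:
  fixes H :: "real \<Rightarrow> complex"
  assumes H: "continuous_on {0..1} H"
    and zero: "\<And>m::int. integral {0..1} (\<lambda>t. H t * cis (2 * pi * of_int m * t)) = 0"
    and u: "trig_polynomial u"
  shows "integral {0..1} (\<lambda>t. H t * u t) = 0"
  using u
proof (induction u rule: trig_polynomial.induct)
  case (trig_monomial c m)
  have "(\<lambda>t. H t * (c * cis (2 * pi * of_int m * t))) = (\<lambda>t. c * (H t * cis (2 * pi * of_int m * t)))"
    by (simp add: mult_ac)
  then show ?case using zero[of m] by simp
next
  case (trig_add u v)
  have "(\<lambda>t. H t * u t) integrable_on {0..1}" "(\<lambda>t. H t * v t) integrable_on {0..1}"
    by (intro integrable_continuous_real continuous_intros H trig_polynomial_continuous trig_add.hyps)+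
  then show ?case using trig_add by (simp add: distrib_left hk_integral_add)
qed

text \<open>
  Preimages of closed sets under the lifted function are images of compact subsets of the unit interval,
  so gluing the two endpoints keeps continuity.
\<close>

lemma continuous_on_circle_lift:
  fixes H :: "real \<Rightarrow> real"
  assumes H: "continuous_on {0..1} H" and per: "H 0 = H 1"
  shows "\<exists>F. continuous_on (sphere 0 1) F \<and> (\<forall>t\<in>{0..1}. F (cis (2 * pi * t)) = H t)"
proof -
  define F where "F = (\<lambda>z. H (Arg2pi z / (2 * pi)))"
  have F: "F (cis (2 * pi * t)) = H t" if "t \<in> {0..1}" for t
  proof (cases "t = 1")
    case True
    then show ?thesis using per by (simp add: F_def Arg2pi_of_real[of 1, simplified])
  next
    case False
    then have "Arg2pi (cis (2 * pi * t)) = 2 * pi * t"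
      using that by (intro Arg2pi_unique[of 1]) (auto simp: cis_conv_exp)
    then show ?thesis by (simp add: F_def)
  qed
  have onto: "\<exists>t\<in>{0..1}. z = cis (2 * pi * t)" if "norm z = 1" for z
  proof (intro bexI[of _ "Arg2pi z / (2 * pi)"])
    show "z = cis (2 * pi * (Arg2pi z / (2 * pi)))"
      using Arg2pi_eq[of z] that by (simp add: cis_conv_exp)
    show "Arg2pi z / (2 * pi) \<in> {0..1}"
      using Arg2pi_ge_0[of z] Arg2pi_lt_2pi[of z] by (auto simp: field_simps)
  qed
  have "continuous_on (sphere 0 1) F"
  proof (subst continuous_on_closed_vimage)
    show "\<forall>B. closed B \<longrightarrow> closed (F -` B \<inter> sphere 0 1)"
    proof (intro allI impI)
      fix B :: "real set" assume B: "closed B"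
      have "F -` B \<inter> sphere 0 1 = (\<lambda>t. cis (2 * pi * t)) ` (H -` B \<inter> {0..1})"
      proof (intro equalityI subsetI)
        fix z assume z: "z \<in> F -` B \<inter> sphere 0 1"
        then obtain t where "t \<in> {0..1}" "z = cis (2 * pi * t)" using onto[of z] by auto
        then show "z \<in> (\<lambda>t. cis (2 * pi * t)) ` (H -` B \<inter> {0..1})" using z F[of t] by auto
      next
        fix z assume "z \<in> (\<lambda>t. cis (2 * pi * t)) ` (H -` B \<inter> {0..1})"
        then obtain t where "t \<in> {0..1}" "H t \<in> B" "z = cis (2 * pi * t)" by auto
        then show "z \<in> F -` B \<inter> sphere 0 1" using F[of t] by auto
      qed
      moreover have "closed (H -` B \<inter> {0..1})"
        using H B continuous_on_closed_vimage[of "{0..1}" H] by auto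
      then have "compact ({0..1} \<inter> (H -` B \<inter> {0..1}))" by (intro compact_Int_closed) auto
      then have "compact (H -` B \<inter> {0..1})" by (simp add: Int_ac)
      ultimately show "closed (F -` B \<inter> sphere 0 1)"
        by (simp add: compact_imp_closed compact_continuous_image cis_conv_exp continuous_intros)
    qed
  qed auto
  then show ?thesis using F by blast
qed

text \<open>
  \<open>H\<close> is orthogonal to all trigonometric polynomials and is a uniform limit of such, hence orthogonal to
  itself.
\<close>

lemma continuous_fourier_uniqueness:
  fixes H :: "real \<Rightarrow> real"
  assumes H: "continuous_on {0..1} H" and per: "H 0 = H 1"
    and zero: "\<And>m::int. integral {0..1} (\<lambda>t. of_real (H t) * cis (2 * pi * of_int m * t)) = 0"
    and x: "0 \<le> x" "x \<le> 1"
  shows "H x = 0"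
proof -
  obtain F where Fc: "continuous_on (sphere (0::complex) 1) F" and F: "\<And>t. 0 \<le> t \<Longrightarrow> t \<le> 1 \<Longrightarrow> F (cis (2 * pi * t)) = H t"
    using continuous_on_circle_lift[OF H per] by auto
  define J where "J = integral {0..1} (\<lambda>t. \<bar>H t\<bar>)"
  have Hi: "(\<lambda>t. \<bar>H t\<bar>) integrable_on {0..1}" "(\<lambda>t. (H t)\<^sup>2) integrable_on {0..1}"
    by (intro integrable_continuous_real continuous_intros H)+
  have J: "J \<ge> 0" unfolding J_def by (intro hk_integral_nonneg Hi) auto
  have cH: "continuous_on {0..1} (\<lambda>t. complex_of_real (H t))" by (intro continuous_intros H)
  have small: "integral {0..1} (\<lambda>t. (H t)\<^sup>2) \<le> e * J" if "e > 0" for e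
  proof -
    obtain g where g: "real_polynomial_function g" and gF: "\<And>z. z \<in> sphere 0 1 \<Longrightarrow> \<bar>F z - g z\<bar> < e"
      using Stone_Weierstrass_real_polynomial_function[OF compact_sphere Fc \<open>e > 0\<close>] by blast
    let ?g = "\<lambda>t. g (cis (2 * pi * t))"
    have gc: "continuous_on {0..1} ?g"
    proof (rule continuous_on_compose2[where t = UNIV and g = g])
      show "continuous_on UNIV g"
        using g by (simp add: continuous_on_polymonial_function real_polynomial_function_eq)
      show "continuous_on {0..1} (\<lambda>t. cis (2 * pi * t))" by (simp add: cis_conv_exp continuous_intros)
    qed auto
    have "integral {0..1} (\<lambda>t. of_real (H t) * of_real (?g t)) = (0 :: complex)"
      by (rule integral_trig_polynomial_eq_0[OF cH zero trig_polynomial_on_circle[OF g]])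
    then have "complex_of_real (integral {0..1} (\<lambda>t. H t * ?g t)) = 0"
      using integral_linear[OF integrable_continuous_real[OF continuous_on_mult[OF H gc]] bounded_linear_of_real[where 'a=complex]]
      by (simp add: o_def)
    then have g0: "integral {0..1} (\<lambda>t. H t * ?g t) = 0" by simp
    have "integral {0..1} (\<lambda>t. (H t)\<^sup>2) = integral {0..1} (\<lambda>t. (H t)\<^sup>2 - H t * ?g t)"
      by (subst hk_integral_diff)
        (auto intro!: Hi integrable_continuous_real continuous_intros H gc simp: g0)
    also have "\<dots> \<le> integral {0..1} (\<lambda>t. e * \<bar>H t\<bar>)"
    proof (rule integral_le)
      show "(\<lambda>t. (H t)\<^sup>2 - H t * ?g t) integrable_on {0..1}"
        by (intro integrable_continuous_real continuous_intros H gc)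
      show "(\<lambda>t. e * \<bar>H t\<bar>) integrable_on {0..1}" by (intro integrable_on_mult_right Hi)
      fix t :: real assume t: "t \<in> {0..1}"
      have "(H t)\<^sup>2 - H t * ?g t = H t * (H t - ?g t)" by (simp add: power2_eq_square algebra_simps)
      also have "\<dots> \<le> \<bar>H t\<bar> * \<bar>H t - ?g t\<bar>" by (metis abs_ge_self abs_mult)
      also have "\<dots> \<le> \<bar>H t\<bar> * e"
        using gF[of "cis (2 * pi * t)"] F[of t] t by (intro mult_left_mono) auto
      finally show "(H t)\<^sup>2 - H t * ?g t \<le> e * \<bar>H t\<bar>" by (simp add: mult.commute)
    qed
    finally show ?thesis by (simp add: J_def)
  qed
  have "integral {0..1} (\<lambda>t. (H t)\<^sup>2) \<le> 0"
  proof (rule field_le_epsilon)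
    fix e :: real assume "e > 0"
    have "integral {0..1} (\<lambda>t. (H t)\<^sup>2) \<le> e / (J + 1) * J" using J \<open>e > 0\<close> by (intro small) auto
    also have "\<dots> \<le> e" using J \<open>e > 0\<close> by (simp add: field_simps)
    finally show "integral {0..1} (\<lambda>t. (H t)\<^sup>2) \<le> 0 + e" by simp
  qed
  moreover have "integral {0..1} (\<lambda>t. (H t)\<^sup>2) \<ge> 0"
    by (intro hk_integral_nonneg Hi) auto
  ultimately have "integral {0..1} (\<lambda>t. (H t)\<^sup>2) = 0" by simp
  then have "\<forall>x\<in>{0..1}. (H x)\<^sup>2 = 0"
    by (subst (asm) integral_eq_0_iff) (auto intro!: continuous_intros H)
  then show ?thesis using x by auto
qed

lemma integral_cis_period:
  assumes "m \<noteq> (0::int)"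
  shows "integral {0..1} (\<lambda>t. cis (2 * pi * of_int m * t)) = 0"
proof -
  have "integral {0..1} (\<lambda>t. \<i> * of_real (2 * pi * of_int m) * cis (2 * pi * of_int m * t)) = 0"
    using primitive_ofD(2)[OF primitive_cis_linear[of "2 * pi * of_int m"], of 1]
    by (simp add: cis_multiple_2pi)
  then show ?thesis using assms by simp
qed

text \<open>
  The primitive \<open>H\<close> of \<open>h\<close> is continuous and, the mean of \<open>h\<close> being 0, periodic. Integration by parts
  kills its Fourier coefficients except the mean, so \<open>H\<close> is constant. Nonnegative frequencies suffice
  because \<open>h\<close> is real.
\<close>

lemma L1_fourier_uniqueness:
  fixes h :: "real \<Rightarrow> real"
  assumes h: "h absolutely_integrable_on {0..1}"
    and zero: "\<And>n::nat. integral {0..1} (\<lambda>t. of_real (h t) * cis (- (2 * pi * n * t))) = 0"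
  shows "AE x in lebesgue. x \<in> {0..1} \<longrightarrow> h x = 0"
proof (rule AE_zero_if_integrals_zero[OF h])
  let ?e = "\<lambda>m::int. \<lambda>t. cis (2 * pi * of_int m * t)"
  have ec: "continuous_on S (?e m)" for m S by (simp add: cis_conv_exp continuous_intros)
  have hz: "integral {0..1} (\<lambda>t. of_real (h t) * ?e m t) = 0" for m :: int
  proof (cases "m \<le> 0")
    case True
    then show ?thesis using zero[of "nat (- m)"] by simp
  next
    case False
    have "integral {0..1} (\<lambda>t. of_real (h t) * ?e m t) = integral {0..1} (\<lambda>t. cnj (of_real (h t) * cis (- (2 * pi * nat m * t))))"
      using False by (simp add: cis_cnj)
    also have "\<dots> = 0" unfolding hk_integral_cnj[symmetric] zero by simp
    finally show ?thesis .
  qed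
  define H where "H = (\<lambda>x. integral {0..x} h)"
  have H: "primitive_of (\<lambda>x. of_real (H x)) (\<lambda>x. of_real (h x))"
    unfolding H_def by (rule primitive_of_real[OF h])
  have H0: "H 0 = 0" by (simp add: H_def)
  have H1: "H 1 = 0"
    using hz[of 0] primitive_ofD(2)[OF H, of 1] H0 by simp
  have Hc: "continuous_on {0..1} H"
    unfolding H_def by (rule indefinite_integral_continuous_1, rule L1_integrable[OF h]) auto
  have Hz: "integral {0..1} (\<lambda>t. of_real (H t) * ?e m t) = 0" if "m \<noteq> 0" for m
  proof -
    let ?c = "\<i> * of_real (2 * pi * of_int m)"
    have i: "(\<lambda>t. of_real (h t) * ?e m t) integrable_on {0..1}"
      by (rule L1_integrable[OF L1_mult_of_real_continuous[OF h ec]]) auto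
    have j: "(\<lambda>t. ?c * (of_real (H t) * ?e m t)) integrable_on {0..1}"
      by (intro integrable_continuous_real continuous_intros Hc ec)
    have "integral {0..1} (\<lambda>t. of_real (h t) * ?e m t + ?c * (of_real (H t) * ?e m t)) = 0"
      using primitive_ofD(2)[OF primitive_mult[OF H primitive_cis_linear[of "2 * pi * of_int m"]], of 1] H0 H1
      by (simp add: mult_ac)
    then have "integral {0..1} (\<lambda>t. ?c * (of_real (H t) * ?e m t)) = 0"
      by (subst (asm) hk_integral_add[OF i j]) (simp add: hz)
    then show ?thesis using that by simp
  qed
  define c where "c = integral {0..1} H"
  have "H x - c = 0" if "0 \<le> x" "x \<le> 1" for x
  proof (rule continuous_fourier_uniqueness[where H = "\<lambda>x. H x - c", OF _ _ _ that])
    show "continuous_on {0..1} (\<lambda>x. H x - c)" by (intro continuous_intros Hc)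
    show "H 0 - c = H 1 - c" using H0 H1 by simp
    fix m :: int
    have "integral {0..1} (\<lambda>t. of_real (H t - c) * ?e m t) = integral {0..1} (\<lambda>t. of_real (H t) * ?e m t - of_real c * ?e m t)"
      by (simp add: algebra_simps)
    also have "\<dots> = integral {0..1} (\<lambda>t. of_real (H t) * ?e m t) - of_real c * integral {0..1} (?e m)"
      by (subst hk_integral_diff)
        (auto intro!: integrable_continuous_real continuous_intros Hc ec)
    also have "\<dots> = 0"
    proof (cases "m = 0")
      case True
      have "integral {0..1} (\<lambda>t. complex_of_real (H t)) = of_real c"
        using integral_linear[OF integrable_continuous_real[OF Hc] bounded_linear_of_real[where 'a=complex]]
        by (simp add: c_def o_def)
      then show ?thesis using True by simp
    qed (simp add: Hz integral_cis_period)
    finally show "integral {0..1} (\<lambda>t. of_real (H t - c) * ?e m t) = 0" .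
  qed
  then have "H x = H 0" if "0 \<le> x" "x \<le> 1" for x
    using that eq_iff_diff_eq_0[of "H x" c] eq_iff_diff_eq_0[of "H 0" c] by auto
  then show "integral {0..x} h = 0" if "0 \<le> x" "x \<le> 1" for x
    using H0 that unfolding H_def by auto
qed

section \<open>The conjugate-linear system\<close>

text \<open>
  The equation \<open>u' = \<gamma> cnj u\<close> is only real-linear. Writing its solutions as \<open>a c + b cnj c\<close> with a complex
  initial value \<open>c\<close> decouples the two appearances of \<open>c\<close> and gives this system.
\<close>

definition volterra_pair :: "(real \<Rightarrow> complex) \<Rightarrow> (real \<Rightarrow> complex) \<Rightarrow> (real \<Rightarrow> complex) \<Rightarrow> bool" where
  "volterra_pair \<gamma> a b \<longleftrightarrow> a 0 = 1 \<and> b 0 = 0 \<and>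
     primitive_of a (\<lambda>t. \<gamma> t * cnj (b t)) \<and> primitive_of b (\<lambda>t. \<gamma> t * cnj (a t))"

lemma L1_mult_cnj:
  fixes \<gamma> u :: "real \<Rightarrow> complex"
  assumes "\<gamma> absolutely_integrable_on {0..1}" "continuous_on {0..1} u"
  shows "(\<lambda>t. \<gamma> t * cnj (u t)) absolutely_integrable_on {0..1}"
  by (intro L1_mult_continuous assms continuous_intros)

lemma norm_integral_mult_cnj_le:
  fixes \<gamma> u :: "real \<Rightarrow> complex"
  assumes g: "\<gamma> absolutely_integrable_on {0..1}" and u: "continuous_on {0..1} u"
    and le: "\<And>t. 0 \<le> t \<Longrightarrow> t \<le> 1 \<Longrightarrow> norm (u t) \<le> M" and x: "x \<le> 1"
  shows "norm (integral {0..x} (\<lambda>t. \<gamma> t * cnj (u t))) \<le> M * integral {0..1} (\<lambda>t. norm (\<gamma> t))"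
proof (rule norm_integral_le_L1[OF g L1_mult_cnj[OF g u]])
  show "norm (\<gamma> t * cnj (u t)) \<le> M * norm (\<gamma> t)" if "0 \<le> t" "t \<le> 1" for t
    using mult_left_mono[OF le[OF that], of "norm (\<gamma> t)"] by (simp add: norm_mult mult.commute)
  show "0 \<le> M" using le[of 0] norm_ge_zero[of "u 0"] by linarith
qed (use x in auto)

text \<open>
  Inserting the equation for \<open>b\<close> into the one for \<open>a\<close> leaves a fixed point equation for \<open>a\<close> alone, with
  contraction constant \<open>1/4\<close> when \<open>\<gamma>\<close> has norm at most \<open>1/2\<close>.
\<close>

lemma volterra_pair_exists:
  fixes \<gamma> :: "real \<Rightarrow> complex"
  assumes g: "\<gamma> absolutely_integrable_on {0..1}" and N: "integral {0..1} (\<lambda>t. norm (\<gamma> t)) \<le> 1/2"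
  shows "\<exists>a b. volterra_pair \<gamma> a b"
proof -
  define N where "N = integral {0..1} (\<lambda>t. norm (\<gamma> t))"
  have N0: "N \<ge> 0" unfolding N_def
    by (intro hk_integral_nonneg L1_norm_integrable g) auto
  define T where "T = (\<lambda>u x. integral {0..x} (\<lambda>t. \<gamma> t * cnj (u t)))"
  have T_eq: "T u x = integral {0..x} (\<lambda>t. \<gamma> t * cnj (u t))" for u x by (simp add: T_def)
  have Tc: "continuous_on {0..1} (T u)" if "continuous_on {0..1} u" for u
    unfolding T_def by (rule indefinite_integral_continuous_1, rule L1_integrable[OF L1_mult_cnj[OF g that]]) auto
  have Tle: "norm (T u x) \<le> M * N"
    if "continuous_on {0..1} u" "\<And>t. 0 \<le> t \<Longrightarrow> t \<le> 1 \<Longrightarrow> norm (u t) \<le> M" "x \<le> 1" for u x M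
    unfolding T_def N_def by (rule norm_integral_mult_cnj_le[OF g that])
  have Tdiff: "T u x - T v x = T (\<lambda>t. u t - v t) x"
    if "continuous_on {0..1} u" "continuous_on {0..1} v" "x \<le> 1" for u v x
    unfolding T_def
    by (subst hk_integral_diff[symmetric])
      (use that in \<open>auto intro!: L1_integrable[OF L1_mult_cnj[OF g]] simp: algebra_simps\<close>)
  \<comment> \<open>Clamping the argument lets bounded continuous functions on the whole line stand in for functions on the interval.\<close>
  define c where "c = (\<lambda>x::real. max 0 (min x 1))"
  have c: "0 \<le> c x" "c x \<le> 1" for x by (auto simp: c_def)
  have cc: "continuous_on UNIV c" unfolding c_def by (intro continuous_intros)
  have cont: "continuous_on {0..1} (apply_bcontfun v)" for v :: "real \<Rightarrow>\<^sub>C complex"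
    by (intro continuous_on_apply_bcontfun)
  define \<Phi> where "\<Phi> = (\<lambda>v :: real \<Rightarrow>\<^sub>C complex. Bcontfun (\<lambda>x. 1 + T (T v) (c x)))"
  have in_b: "(\<lambda>x. 1 + T (T v) (c x)) \<in> bcontfun" for v :: "real \<Rightarrow>\<^sub>C complex"
  proof -
    have k: "continuous_on {0..1} (T (T v))" by (intro Tc cont)
    then have "bounded (T (T v) ` {0..1})" by (intro compact_imp_bounded compact_continuous_image) auto
    then obtain B where "\<forall>z\<in>T (T v) ` {0..1}. norm z \<le> B" unfolding bounded_iff by blast
    then have "norm (T (T v) x) \<le> B" if "0 \<le> x" "x \<le> 1" for x using that by auto
    then have "norm (1 + T (T v) (c x)) \<le> 1 + B" for x
      using c[of x] norm_triangle_ineq[of 1 "T (T v) (c x)"] by fastforce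
    moreover have "continuous_on UNIV (\<lambda>x. 1 + T (T v) (c x))"
      by (intro continuous_intros continuous_on_compose2[OF k cc]) (use c in auto)
    ultimately show ?thesis by (intro bcontfun_normI)
  qed
  have \<Phi>: "apply_bcontfun (\<Phi> v) x = 1 + T (T v) (c x)" for v x
    unfolding \<Phi>_def by (simp add: Bcontfun_inverse[OF in_b])
  have "\<exists>!v. \<Phi> v = v"
  proof (rule banach_fix_type)
    show "\<forall>v w. dist (\<Phi> v) (\<Phi> w) \<le> (1/4) * dist v w"
    proof (intro allI dist_bound)
      fix v w x
      have "dist (\<Phi> v x) (\<Phi> w x) = norm (T (\<lambda>t. T (\<lambda>t. v t - w t) t) (c x))"
      proof -
        have "T (T v) (c x) - T (T w) (c x) = T (\<lambda>t. T v t - T w t) (c x)"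
          by (intro Tdiff Tc cont c)
        also have "\<dots> = T (\<lambda>t. T (\<lambda>t. v t - w t) t) (c x)"
          unfolding T_eq[of "\<lambda>t. T v t - T w t"] T_eq[of "\<lambda>t. T (\<lambda>t. v t - w t) t"]
          by (rule integral_cong) (use c[of x] in \<open>auto simp: Tdiff cont\<close>)
        finally show ?thesis by (simp add: \<Phi> dist_norm)
      qed
      also have "\<dots> \<le> ((dist v w) * N) * N"
        by (intro Tle Tc continuous_intros cont c) (auto simp: dist_norm[symmetric] dist_bounded)
      also have "\<dots> \<le> (dist v w * (1/2)) * (1/2)"
        using N N0 unfolding N_def[symmetric] by (intro mult_mono) auto
      finally show "dist (\<Phi> v x) (\<Phi> w x) \<le> (1/4) * dist v w" by simp
    qed
  qed auto
  then obtain v where v: "\<Phi> v = v" by blast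
  have vT: "v x = 1 + T (T v) x" if "0 \<le> x" "x \<le> 1" for x
    using \<Phi>[of v x] v that by (simp add: c_def)
  have 1: "primitive_of (T v) (\<lambda>t. \<gamma> t * cnj (v t))"
    using primitive_integral[OF L1_mult_cnj[OF g cont], of 0 v] by (simp add: T_def)
  have "primitive_of (\<lambda>x. 1 + integral {0..x} (\<lambda>t. \<gamma> t * cnj (T v t))) (\<lambda>t. \<gamma> t * cnj (T v t))"
    by (intro primitive_integral L1_mult_cnj g Tc cont)
  then have 2: "primitive_of v (\<lambda>t. \<gamma> t * cnj (T v t))"
    by (rule primitive_cong) (use vT in \<open>auto simp: T_def\<close>)
  have "volterra_pair \<gamma> v (T v)"
    unfolding volterra_pair_def using 1 2 vT[of 0] by (simp add: T_def)
  then show ?thesis by blast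
qed

text \<open>
  A solution with initial value 0 is bounded by half of its own maximum.
\<close>

lemma volterra_zero:
  assumes g: "\<gamma> absolutely_integrable_on {0..1}" and N: "integral {0..1} (\<lambda>t. norm (\<gamma> t)) \<le> 1/2"
    and u: "primitive_of u (\<lambda>t. \<gamma> t * cnj (u t))" and u0: "u 0 = 0" and x: "0 \<le> x" "x \<le> 1"
  shows "u x = 0"
proof -
  have uc: "continuous_on {0..1} u" by (rule primitive_continuous[OF u])
  then have "continuous_on {0..1} (\<lambda>x. norm (u x))" by (intro continuous_intros)
  then obtain z where z: "z \<in> {0..1}" "\<And>y. y \<in> {0..1} \<Longrightarrow> norm (u y) \<le> norm (u z)"
    using continuous_attains_sup[of "{0..1}" "\<lambda>x. norm (u x)"] by auto
  have "norm (u z) = norm (integral {0..z} (\<lambda>t. \<gamma> t * cnj (u t)))"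
    using primitive_ofD(2)[OF u, of z] z(1) u0 by simp
  also have "\<dots> \<le> norm (u z) * integral {0..1} (\<lambda>t. norm (\<gamma> t))"
    by (rule norm_integral_mult_cnj_le[OF g uc]) (use z in auto)
  also have "\<dots> \<le> norm (u z) * (1/2)" by (intro mult_left_mono N) auto
  finally have "norm (u z) \<le> 0" by simp
  then show ?thesis using z(2)[of x] x by auto
qed

context
  fixes \<gamma> a b N
  assumes g: "\<gamma> absolutely_integrable_on {0..1}" and N_def: "N = integral {0..1} (\<lambda>t. norm (\<gamma> t))"
    and N: "N \<le> 1/2" and ab: "volterra_pair \<gamma> a b"
begin

lemma volterra_pairD:
  shows "a 0 = 1" "b 0 = 0" "primitive_of a (\<lambda>t. \<gamma> t * cnj (b t))" "primitive_of b (\<lambda>t. \<gamma> t * cnj (a t))"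
    "continuous_on {0..1} a" "continuous_on {0..1} b"
  using ab primitive_continuous by (auto simp: volterra_pair_def)

lemma volterra_pair_integral:
  assumes "0 \<le> x" "x \<le> 1"
  shows "a x = 1 + integral {0..x} (\<lambda>t. \<gamma> t * cnj (b t))" "b x = integral {0..x} (\<lambda>t. \<gamma> t * cnj (a t))"
  using primitive_ofD(2)[OF volterra_pairD(3) assms] primitive_ofD(2)[OF volterra_pairD(4) assms] volterra_pairD(1,2)
  by auto

lemma volterra_norm_nonneg: "N \<ge> 0"
  unfolding N_def by (intro hk_integral_nonneg L1_norm_integrable g) auto

lemma volterra_pair_bounds:
  assumes x: "0 \<le> x" "x \<le> 1"
  shows "norm (a x) \<le> 2" "norm (b x) \<le> 2 * N"
proof -
  have "continuous_on {0..1} (\<lambda>x. norm (a x))" by (intro continuous_intros volterra_pairD)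
  then obtain z where z: "z \<in> {0..1}" "\<And>y. y \<in> {0..1} \<Longrightarrow> norm (a y) \<le> norm (a z)"
    using continuous_attains_sup[of "{0..1}" "\<lambda>x. norm (a x)"] by auto
  have b: "norm (b y) \<le> norm (a z) * N" if "0 \<le> y" "y \<le> 1" for y
    unfolding volterra_pair_integral(2)[OF that] N_def
    by (rule norm_integral_mult_cnj_le[OF g volterra_pairD(5)]) (use z that in auto)
  have "norm (a z) \<le> norm (1::complex) + norm (integral {0..z} (\<lambda>t. \<gamma> t * cnj (b t)))"
    using volterra_pair_integral(1)[of z] z(1) norm_triangle_ineq[of 1 "integral {0..z} (\<lambda>t. \<gamma> t * cnj (b t))"] by simp
  also have "norm (integral {0..z} (\<lambda>t. \<gamma> t * cnj (b t))) \<le> (norm (a z) * N) * N"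
    unfolding N_def by (rule norm_integral_mult_cnj_le[OF g volterra_pairD(6)]) (use z b in \<open>auto simp: N_def\<close>)
  also have "\<dots> \<le> (norm (a z) * (1/2)) * (1/2)"
    using N volterra_norm_nonneg by (intro mult_mono) auto
  finally have az: "norm (a z) \<le> 2" by simp
  then show "norm (a x) \<le> 2" using z(2)[of x] x by auto
  show "norm (b x) \<le> 2 * N" using b[OF x] az volterra_norm_nonneg by (meson mult_right_mono order_trans)
qed

text \<open>
  The derivative of \<open>|a|\<^sup>2 - |b|\<^sup>2\<close> cancels: this is the conservation of the Wronskian.
\<close>

lemma volterra_pair_conserved:
  assumes x: "0 \<le> x" "x \<le> 1"
  shows "(norm (a x))\<^sup>2 - (norm (b x))\<^sup>2 = 1"
proof -
  note a = volterra_pairD(3) and b = volterra_pairD(4)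
  have "primitive_of (\<lambda>x. a x * cnj (a x) + (-1) * (b x * cnj (b x))) (\<lambda>t. 0)"
    by (rule primitive_cong[OF primitive_add[OF primitive_mult[OF a primitive_cnj[OF a]]
          primitive_cmult[OF primitive_mult[OF b primitive_cnj[OF b]], of "-1"]]])
       (auto simp: algebra_simps)
  from primitive_ofD(2)[OF this x] have "a x * cnj (a x) - b x * cnj (b x) = 1"
    by (simp add: volterra_pairD)
  then have "complex_of_real ((norm (a x))\<^sup>2 - (norm (b x))\<^sup>2) = of_real 1"
    by (simp only: of_real_diff complex_norm_square of_real_1)
  then show ?thesis by (simp only: of_real_eq_iff)
qed

lemma volterra_pair_fundamental:
  assumes u: "primitive_of u (\<lambda>t. \<gamma> t * cnj (u t))" and x: "0 \<le> x" "x \<le> 1"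
  shows "u x = a x * u 0 + b x * cnj (u 0)"
proof -
  note a = volterra_pairD(3) and b = volterra_pairD(4)
  let ?w = "\<lambda>x. u x + (- u 0 * a x + - cnj (u 0) * b x)"
  have "primitive_of ?w (\<lambda>t. \<gamma> t * cnj (u t) + (- u 0 * (\<gamma> t * cnj (b t)) + - cnj (u 0) * (\<gamma> t * cnj (a t))))"
    by (intro primitive_add primitive_cmult u a b)
  then have "primitive_of ?w (\<lambda>t. \<gamma> t * cnj (?w t))"
    by (rule primitive_cong) (auto simp: algebra_simps)
  from volterra_zero[OF g _ this _ x] have "?w x = 0"
    using N by (simp add: volterra_pairD N_def)
  then show ?thesis by (simp add: algebra_simps)
qed

lemma volterra_pair_solution:
  "primitive_of (\<lambda>x. a x * c + b x * cnj c) (\<lambda>t. \<gamma> t * cnj (a t * c + b t * cnj c))"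
  by (rule primitive_cong[OF primitive_add[OF primitive_cmult[OF volterra_pairD(3), of c]
        primitive_cmult[OF volterra_pairD(4), of "cnj c"]]]) (auto simp: algebra_simps)

text \<open>
  Everything beyond the leading terms carries the factor \<open>\<eta>\<close>, which measures the oscillation of \<open>\<gamma>\<close> and
  can be much smaller than its norm \<open>N\<close>. In \<open>b\<close> it is produced by integrating \<open>\<gamma> cnj a\<close> by parts; each later
  substitution into the system costs a factor \<open>N\<close>.
\<close>

lemma volterra_pair_expansion:
  assumes \<eta>: "\<And>x. 0 \<le> x \<Longrightarrow> x \<le> 1 \<Longrightarrow> norm (integral {0..x} \<gamma>) \<le> \<eta>" and x: "0 \<le> x" "x \<le> 1"
  shows "norm (b x) \<le> 3 * \<eta>" "norm (a x - 1) \<le> 3 * \<eta> * N" "norm (b x - integral {0..x} \<gamma>) \<le> 3 * \<eta> * N * N"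
    "norm (a x - 1 - integral {0..x} (\<lambda>t. \<gamma> t * cnj (integral {0..t} \<gamma>))) \<le> 3 * \<eta> * N * N * N"
proof -
  define \<Gamma> where "\<Gamma> = (\<lambda>x. integral {0..x} \<gamma>)"
  have \<Gamma>: "primitive_of \<Gamma> \<gamma>" using primitive_integral[OF g, of 0] by (simp add: \<Gamma>_def)
  have \<eta>': "norm (\<Gamma> x) \<le> \<eta>" if "0 \<le> x" "x \<le> 1" for x using \<eta>[OF that] by (simp add: \<Gamma>_def)
  have \<eta>0: "\<eta> \<ge> 0" using \<eta>'[of 0] norm_ge_zero[of "\<Gamma> 0"] by linarith
  note \<Gamma>c = primitive_continuous[OF \<Gamma>]
  note [continuous_intros] = volterra_pairD(5,6) \<Gamma>c
  have b: "norm (b x) \<le> 3 * \<eta>" if x: "0 \<le> x" "x \<le> 1" for x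
  proof -
    have l1: "(\<lambda>t. \<gamma> t * cnj (a t)) absolutely_integrable_on {0..1}"
      by (intro L1_mult_cnj g volterra_pairD)
    have l2: "(\<lambda>t. cnj (\<gamma> t * cnj (b t)) * \<Gamma> t) absolutely_integrable_on {0..1}"
      by (intro L1_mult_continuous L1_cnj L1_mult_cnj g volterra_pairD \<Gamma>c)
    have "integral {0..x} (\<lambda>t. \<gamma> t * cnj (a t) + cnj (\<gamma> t * cnj (b t)) * \<Gamma> t) = \<Gamma> x * cnj (a x)"
      using primitive_ofD(2)[OF primitive_mult[OF \<Gamma> primitive_cnj[OF volterra_pairD(3)]] x]
      by (simp add: \<Gamma>_def)
    then have "integral {0..x} (\<lambda>t. \<gamma> t * cnj (a t)) + integral {0..x} (\<lambda>t. cnj (\<gamma> t * cnj (b t)) * \<Gamma> t) = \<Gamma> x * cnj (a x)"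
      using hk_integral_add[OF L1_integrable[OF l1 order_refl x(2)] L1_integrable[OF l2 order_refl x(2)]]
      by (simp only:)
    then have "b x = \<Gamma> x * cnj (a x) - integral {0..x} (\<lambda>t. cnj (\<gamma> t * cnj (b t)) * \<Gamma> t)"
      using volterra_pair_integral(2)[OF x] by (simp add: algebra_simps)
    also have "norm \<dots> \<le> norm (\<Gamma> x * cnj (a x)) + norm (integral {0..x} (\<lambda>t. cnj (\<gamma> t * cnj (b t)) * \<Gamma> t))"
      by (rule norm_triangle_ineq4)
    also have "norm (\<Gamma> x * cnj (a x)) \<le> \<eta> * 2"
      using \<eta>'[OF x] volterra_pair_bounds(1)[OF x] \<eta>0 by (simp add: norm_mult mult_mono)
    also have "norm (integral {0..x} (\<lambda>t. cnj (\<gamma> t * cnj (b t)) * \<Gamma> t)) \<le> \<eta> * N"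
      unfolding N_def
    proof (rule norm_integral_le_L1[OF g l2])
      fix t :: real assume t: "0 \<le> t" "t \<le> 1"
      have "norm (b t) \<le> 2 * (1/2)" using volterra_pair_bounds(2)[OF t] N by linarith
      then have "norm (\<gamma> t) * (norm (b t) * norm (\<Gamma> t)) \<le> norm (\<gamma> t) * (1 * \<eta>)"
        using \<eta>'[OF t] \<eta>0 by (intro mult_left_mono mult_mono) auto
      then show "norm (cnj (\<gamma> t * cnj (b t)) * \<Gamma> t) \<le> \<eta> * norm (\<gamma> t)" by (simp add: norm_mult mult_ac)
    qed (use x \<eta>0 in auto)
    also have "\<eta> * N \<le> \<eta> * 1" using N \<eta>0 by (intro mult_left_mono) auto
    finally show ?thesis by simp
  qed
  have a: "norm (a x - 1) \<le> 3 * \<eta> * N" if x: "0 \<le> x" "x \<le> 1" for x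
    using norm_integral_mult_cnj_le[OF g volterra_pairD(6) b x(2)] volterra_pair_integral(1)[OF x] by (simp add: N_def)
  have b2: "norm (b x - \<Gamma> x) \<le> 3 * \<eta> * N * N" if x: "0 \<le> x" "x \<le> 1" for x
  proof -
    have "integral {0..x} (\<lambda>t. \<gamma> t * cnj (a t) - \<gamma> t) = b x - \<Gamma> x"
      unfolding volterra_pair_integral(2)[OF x] \<Gamma>_def
      by (rule hk_integral_diff) (use x in \<open>auto intro!: L1_integrable L1_mult_cnj g volterra_pairD\<close>)
    then have "b x - \<Gamma> x = integral {0..x} (\<lambda>t. \<gamma> t * cnj (a t - 1))" by (simp add: algebra_simps)
    also have "norm \<dots> \<le> (3 * \<eta> * N) * N"
      unfolding N_def by (rule norm_integral_mult_cnj_le[OF g _ a[unfolded N_def] x(2)]) (intro continuous_intros)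
    finally show ?thesis .
  qed
  have "integral {0..x} (\<lambda>t. \<gamma> t * cnj (b t) - \<gamma> t * cnj (\<Gamma> t)) = a x - 1 - integral {0..x} (\<lambda>t. \<gamma> t * cnj (\<Gamma> t))"
    unfolding volterra_pair_integral(1)[OF x]
    by (subst hk_integral_diff) (use x in \<open>auto intro!: L1_integrable L1_mult_cnj g volterra_pairD \<Gamma>c\<close>)
  then have "a x - 1 - integral {0..x} (\<lambda>t. \<gamma> t * cnj (\<Gamma> t)) = integral {0..x} (\<lambda>t. \<gamma> t * cnj (b t - \<Gamma> t))"
    by (simp add: algebra_simps)
  also have "norm \<dots> \<le> (3 * \<eta> * N * N) * N"
    unfolding N_def by (rule norm_integral_mult_cnj_le[OF g _ b2[unfolded N_def] x(2)]) (intro continuous_intros)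
  finally show "norm (a x - 1 - integral {0..x} (\<lambda>t. \<gamma> t * cnj (integral {0..t} \<gamma>))) \<le> 3 * \<eta> * N * N * N"
    by (simp add: \<Gamma>_def)
  show "norm (b x) \<le> 3 * \<eta>" "norm (a x - 1) \<le> 3 * \<eta> * N" "norm (b x - integral {0..x} \<gamma>) \<le> 3 * \<eta> * N * N"
    using b[OF x] a[OF x] b2[OF x] by (auto simp: \<Gamma>_def)
qed

end

text \<open>
  Subtracting the two systems bounds either difference by the distance of the coefficients plus half of
  the other difference.
\<close>

lemma volterra_pair_lipschitz:
  assumes g: "\<gamma> absolutely_integrable_on {0..1}" and N: "integral {0..1} (\<lambda>t. norm (\<gamma> t)) \<le> 1/2"
    and g': "\<gamma>' absolutely_integrable_on {0..1}" and N': "integral {0..1} (\<lambda>t. norm (\<gamma>' t)) \<le> 1/2"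
    and ab: "volterra_pair \<gamma> a b" and ab': "volterra_pair \<gamma>' a' b'" and x: "0 \<le> x" "x \<le> 1"
  shows "norm (a x - a' x) + norm (b x - b' x) \<le> 8 * integral {0..1} (\<lambda>t. norm (\<gamma> t - \<gamma>' t))"
proof -
  define E where "E = integral {0..1} (\<lambda>t. norm (\<gamma> t - \<gamma>' t))"
  note D = volterra_pairD[OF g refl N ab] and D' = volterra_pairD[OF g' refl N' ab']
  note I = volterra_pair_integral[OF g refl N ab] and I' = volterra_pair_integral[OF g' refl N' ab']
  note B = volterra_pair_bounds[OF g refl N ab]
  have B2: "norm (b x) \<le> 2" if "0 \<le> x" "x \<le> 1" for x using B(2)[OF that] N by linarith
  have d: "(\<lambda>t. \<gamma> t - \<gamma>' t) absolutely_integrable_on {0..1}" by (intro set_integral_diff g g')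
  have key: "norm (integral {0..x} (\<lambda>t. \<gamma> t * cnj (u t)) - integral {0..x} (\<lambda>t. \<gamma>' t * cnj (v t))) \<le> 2 * E + M * (1/2)"
    if u: "continuous_on {0..1} u" and v: "continuous_on {0..1} v" and u2: "\<And>t. 0 \<le> t \<Longrightarrow> t \<le> 1 \<Longrightarrow> norm (u t) \<le> 2"
      and M: "\<And>t. 0 \<le> t \<Longrightarrow> t \<le> 1 \<Longrightarrow> norm (u t - v t) \<le> M" and x: "0 \<le> x" "x \<le> 1" for u v M x
  proof -
    have uv: "continuous_on {0..1} (\<lambda>t. u t - v t)" by (intro continuous_intros u v)
    have i: "(\<lambda>t. \<gamma> t * cnj (u t)) integrable_on {0..x}" "(\<lambda>t. \<gamma>' t * cnj (v t)) integrable_on {0..x}"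
       "(\<lambda>t. (\<gamma> t - \<gamma>' t) * cnj (u t)) integrable_on {0..x}" "(\<lambda>t. \<gamma>' t * cnj (u t - v t)) integrable_on {0..x}"
      using x L1_integrable[OF L1_mult_cnj[OF g u]] L1_integrable[OF L1_mult_cnj[OF g' v]]
        L1_integrable[OF L1_mult_cnj[OF d u]] L1_integrable[OF L1_mult_cnj[OF g' uv]] by simp_all
    have "integral {0..x} (\<lambda>t. \<gamma> t * cnj (u t)) - integral {0..x} (\<lambda>t. \<gamma>' t * cnj (v t))
       = integral {0..x} (\<lambda>t. (\<gamma> t - \<gamma>' t) * cnj (u t)) + integral {0..x} (\<lambda>t. \<gamma>' t * cnj (u t - v t))"
      unfolding hk_integral_diff[OF i(1,2), symmetric]
        hk_integral_add[OF i(3,4), symmetric] by (simp add: algebra_simps)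
    also have "norm \<dots> \<le> norm (integral {0..x} (\<lambda>t. (\<gamma> t - \<gamma>' t) * cnj (u t))) + norm (integral {0..x} (\<lambda>t. \<gamma>' t * cnj (u t - v t)))"
      by (rule norm_triangle_ineq)
    also have "\<dots> \<le> 2 * E + M * integral {0..1} (\<lambda>t. norm (\<gamma>' t))"
      unfolding E_def
      by (intro add_mono norm_integral_mult_cnj_le[OF d u u2 x(2)] norm_integral_mult_cnj_le[OF g' uv M x(2)])
    also have "\<dots> \<le> 2 * E + M * (1/2)"
      using order_trans[OF norm_ge_zero M[of 0]] by (intro add_left_mono mult_left_mono N') auto
    finally show ?thesis .
  qed
  have "continuous_on {0..1} (\<lambda>x. norm (a x - a' x))" by (intro continuous_intros D D')
  then obtain y where y: "y \<in> {0..1}" "\<And>t. t \<in> {0..1} \<Longrightarrow> norm (a t - a' t) \<le> norm (a y - a' y)"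
    using continuous_attains_sup[of "{0..1}" "\<lambda>x. norm (a x - a' x)"] by auto
  have "continuous_on {0..1} (\<lambda>x. norm (b x - b' x))" by (intro continuous_intros D D')
  then obtain z where z: "z \<in> {0..1}" "\<And>t. t \<in> {0..1} \<Longrightarrow> norm (b t - b' t) \<le> norm (b z - b' z)"
    using continuous_attains_sup[of "{0..1}" "\<lambda>x. norm (b x - b' x)"] by auto
  have "norm (a y - a' y) \<le> 2 * E + norm (b z - b' z) * (1/2)"
    using key[OF D(6) D'(6) B2, of "norm (b z - b' z)" y] z y I(1)[of y] I'(1)[of y] by auto
  moreover have "norm (b z - b' z) \<le> 2 * E + norm (a y - a' y) * (1/2)"
    using key[OF D(5) D'(5) B(1), of "norm (a y - a' y)" z] z y I(2)[of z] I'(2)[of z] by auto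
  ultimately have "norm (a y - a' y) + norm (b z - b' z) \<le> 8 * E" by linarith
  then show ?thesis using y(2)[of x] z(2)[of x] x unfolding E_def by auto
qed

section \<open>Hill's equation and the monodromy\<close>

lemma AE_integral_cong:
  fixes f g :: "real \<Rightarrow> 'a::euclidean_space"
  assumes ae: "AE x in lebesgue. x \<in> {0..1} \<longrightarrow> f x = g x" and x: "x \<le> 1"
  shows "integral {0..x} f = integral {0..x} g"
proof -
  obtain N where N: "N \<in> null_sets lebesgue" "{x \<in> space lebesgue. \<not> (x \<in> {0..1} \<longrightarrow> f x = g x)} \<subseteq> N"
    using ae unfolding eventually_ae_filter by blast
  show ?thesis
  proof (rule integral_spike)
    show "negligible N" using N by (simp add: negligible_iff_null_sets)
    show "g y = f y" if "y \<in> {0..x} - N" for y using N(2) that x by auto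
  qed
qed

lemma primitive_AE:
  assumes F: "primitive_of F f" and g: "g absolutely_integrable_on {0..1}"
    and ae: "AE x in lebesgue. x \<in> {0..1} \<longrightarrow> f x = g x"
  shows "primitive_of F g"
  using F g AE_integral_cong[OF ae] by (auto simp: primitive_of_def)

text \<open>
  The condition says that a real-linear map of the plane fixes a vector. If the moduli agree, \<open>- b / (a - 1)\<close>
  is unimodular and its square root serves as \<open>c\<close>.
\<close>

lemma singular_iff:
  fixes a b :: complex
  shows "(\<exists>c. c \<noteq> 0 \<and> a * c + b * cnj c = c) \<longleftrightarrow> norm (a - 1) = norm b"
proof
  assume "\<exists>c. c \<noteq> 0 \<and> a * c + b * cnj c = c"
  then obtain c where c: "c \<noteq> 0" "a * c + b * cnj c = c" by blast
  then have "(a - 1) * c = - (b * cnj c)" by (simp add: algebra_simps eq_neg_iff_add_eq_0)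
  then have "norm ((a - 1) * c) = norm (b * cnj c)" by simp
  then show "norm (a - 1) = norm b" using c(1) by (simp add: norm_mult)
next
  assume eq: "norm (a - 1) = norm b"
  show "\<exists>c. c \<noteq> 0 \<and> a * c + b * cnj c = c"
  proof (cases "a = 1")
    case True
    then show ?thesis using eq by (intro exI[of _ 1]) auto
  next
    case False
    define w where "w = - b / (a - 1)"
    have w: "norm w = 1" using False by (simp add: w_def norm_divide eq[symmetric])
    define c where "c = csqrt w"
    have c2: "c * c = w" by (simp add: c_def power2_eq_square[symmetric])
    have nc: "norm c = 1" using w by (simp add: c_def norm_csqrt)
    then have cc: "c * cnj c = 1" by (simp add: complex_norm_square[symmetric])
    have "a * c + b * cnj c - c = (a - 1) * c + b * cnj c" by (simp add: algebra_simps)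
    also have "\<dots> = (a - 1) * (c * (c * cnj c)) + b * cnj c" using cc by simp
    also have "\<dots> = ((a - 1) * w + b) * cnj c" unfolding c2[symmetric] by (simp add: algebra_simps)
    also have "\<dots> = 0" using False by (simp add: w_def)
    finally show ?thesis using nc by (intro exI[of _ c]) auto
  qed
qed

lemma unimodular_singular_iff:
  fixes a b :: complex
  assumes "(norm a)\<^sup>2 - (norm b)\<^sup>2 = 1"
  shows "(\<exists>c. c \<noteq> 0 \<and> a * c + b * cnj c = c) \<longleftrightarrow> Re a = 1"
proof -
  have "norm (a - 1) = norm b \<longleftrightarrow> (norm (a - 1))\<^sup>2 = (norm b)\<^sup>2" by simp
  also have "(norm (a - 1))\<^sup>2 = (norm a)\<^sup>2 - 2 * Re a + 1"
    unfolding cmod_power2 by (simp add: power2_eq_square algebra_simps)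
  finally show ?thesis unfolding singular_iff using assms by auto
qed

text \<open>
  Multiplying the fixed point equations of \<open>c\<close> and \<open>c0\<close> crosswise shows that \<open>c cnj c0\<close> is real.
\<close>

lemma singular_line:
  fixes a b :: complex
  assumes "a \<noteq> 1"
  shows "\<exists>c0. \<forall>c. a * c + b * cnj c = c \<longrightarrow> (\<exists>r. c = of_real r * c0)"
proof (cases "\<exists>c. c \<noteq> 0 \<and> a * c + b * cnj c = c")
  case True
  then obtain c0 where c0: "c0 \<noteq> 0" "a * c0 + b * cnj c0 = c0" by blast
  have "\<exists>r. c = of_real r * c0" if c: "a * c + b * cnj c = c" for c
  proof -
    have 1: "(a - 1) * c = - (b * cnj c)" using c by (simp add: algebra_simps eq_neg_iff_add_eq_0)
    have 2: "(a - 1) * c0 = - (b * cnj c0)" using c0(2) by (simp add: algebra_simps eq_neg_iff_add_eq_0)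
    have "(a - 1) * (c * cnj c0) = - (b * cnj c) * cnj c0" unfolding 1[symmetric] by simp
    also have "\<dots> = - (b * cnj c0) * cnj c" by simp
    also have "\<dots> = (a - 1) * (c0 * cnj c)" unfolding 2[symmetric] by simp
    finally have "c * cnj c0 = cnj (c * cnj c0)" using assms by (simp add: mult.commute)
    then have im: "Im (c * cnj c0) = 0" by (metis Im_complex_of_real Reals_cases Reals_cnj_iff)
    have "c = of_real (Re (c * cnj c0) / (norm c0)\<^sup>2) * c0"
    proof -
      have "of_real (Re (c * cnj c0)) = c * cnj c0" using im by (simp add: complex_eq_iff)
      then have "of_real (Re (c * cnj c0) / (norm c0)\<^sup>2) * c0 = c * cnj c0 / of_real ((norm c0)\<^sup>2) * c0" by simp
      also have "\<dots> = c" using c0(1) unfolding complex_norm_square by (simp add: field_simps)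
      finally show ?thesis by simp
    qed
    then show ?thesis by blast
  qed
  then show ?thesis by blast
next
  case False
  then show ?thesis by (intro exI[of _ 0]) auto
qed

locale L1_potential =
  fixes q :: "real \<Rightarrow> real"
  assumes q_L1: "q absolutely_integrable_on {0..1}"
begin

definition q1 :: "real \<Rightarrow> real" where "q1 x = integral {0..x} q"

definition mass :: real where "mass = integral {0..1} (\<lambda>x. \<bar>q x\<bar>)"

text \<open>
  The phase \<open>theta\<close> contains the first-order effect of the potential, so that the remaining coefficient
  \<open>gam\<close> purely oscillates.
\<close>

definition theta :: "real \<Rightarrow> real \<Rightarrow> real" where "theta k x = k * x - q1 x / (2 * k)"

definition gam :: "real \<Rightarrow> real \<Rightarrow> complex" where
  "gam k x = of_real (q x) * (\<i> / of_real (2 * k) * cis (- (2 * theta k x)))"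

text \<open>
  Meaningful for \<open>k \<ge> 1 + mass\<close>, where \<open>gam k\<close> is small enough for the existence theorem.
\<close>

definition sol :: "real \<Rightarrow> (real \<Rightarrow> complex) \<times> (real \<Rightarrow> complex)" where
  "sol k = (SOME p. volterra_pair (gam k) (fst p) (snd p))"

definition "alpha k = fst (sol k)"
definition "beta k = snd (sol k)"

text \<open>
  Monodromy: with \<open>z = y' + i k y\<close>, a solution with \<open>z 0 = c\<close> has \<open>z 1 = A k * c + B k * cnj c\<close>.
\<close>

definition "A k = cis (theta k 1) * alpha k 1"
definition "B k = cis (theta k 1) * beta k 1"

lemma mass_nonneg: "mass \<ge> 0"
  unfolding mass_def using L1_norm_integrable[OF q_L1, of 0 1]
  by (intro hk_integral_nonneg) auto

lemma q1_primitive: "primitive_of (\<lambda>x. of_real (q1 x)) (\<lambda>x. of_real (q x))"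
  unfolding q1_def by (rule primitive_of_real[OF q_L1])

lemma q1_continuous [continuous_intros]: "continuous_on {0..1} q1"
  unfolding q1_def by (rule indefinite_integral_continuous_1, rule L1_integrable[OF q_L1]) auto

lemma q1_0 [simp]: "q1 0 = 0" by (simp add: q1_def)

lemma q1_le: "0 \<le> x \<Longrightarrow> x \<le> 1 \<Longrightarrow> \<bar>q1 x\<bar> \<le> mass"
  using norm_integral_le_L1[OF q_L1 q_L1, of 1 0 x] by (simp add: q1_def mass_def)

lemma theta_primitive: "primitive_of (\<lambda>x. of_real (theta k x)) (\<lambda>x. of_real (k - q x / (2 * k)))"
  by (rule primitive_cong[OF primitive_add[OF primitive_linear[of "of_real k"]
        primitive_cmult[OF q1_primitive, of "- 1 / of_real (2 * k)"]]]) (auto simp: theta_def)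

lemma theta_0 [simp]: "theta k 0 = 0" by (simp add: theta_def)

lemma theta_continuous: "continuous_on {0..1} (theta k)"
  unfolding theta_def by (cases "k = 0") (auto intro!: continuous_intros)

lemma cis_continuous:
  assumes "continuous_on S f" shows "continuous_on S (\<lambda>x. cis (f x))"
  unfolding cis_conv_exp by (intro continuous_intros assms)

lemma gam_L1: "gam k absolutely_integrable_on {0..1}"
  unfolding gam_def by (intro L1_mult_of_real_continuous q_L1 continuous_intros cis_continuous theta_continuous)

lemma norm_gam: "k > 0 \<Longrightarrow> norm (gam k x) = \<bar>q x\<bar> / (2 * k)"
  by (simp add: gam_def norm_mult norm_divide)

lemma integral_norm_gam: "k > 0 \<Longrightarrow> integral {0..1} (\<lambda>t. norm (gam k t)) = mass / (2 * k)"
  by (simp add: norm_gam mass_def)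

lemma gam_small:
  assumes "k \<ge> 1 + mass"
  shows "k > 0" "integral {0..1} (\<lambda>t. norm (gam k t)) \<le> 1/2"
proof -
  show "k > 0" using assms mass_nonneg by linarith
  then show "integral {0..1} (\<lambda>t. norm (gam k t)) \<le> 1/2"
    using assms by (simp add: integral_norm_gam field_simps)
qed

lemma alpha_beta: "k \<ge> 1 + mass \<Longrightarrow> volterra_pair (gam k) (alpha k) (beta k)"
proof -
  assume "k \<ge> 1 + mass"
  then obtain a b where "volterra_pair (gam k) a b"
    using volterra_pair_exists[OF gam_L1 gam_small(2)] by blast
  then show ?thesis
    unfolding alpha_def beta_def sol_def
    using someI[of "\<lambda>p. volterra_pair (gam k) (fst p) (snd p)" "(a, b)"] by simp
qed

lemmas alpha_beta_D = volterra_pairD[OF gam_L1 refl gam_small(2) alpha_beta]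

lemma A_B_conserved: "k \<ge> 1 + mass \<Longrightarrow> (norm (A k))\<^sup>2 - (norm (B k))\<^sup>2 = 1"
  using volterra_pair_conserved[OF gam_L1 refl gam_small(2) alpha_beta, where x = 1] by (simp add: A_def B_def norm_mult)

text \<open>
  Since \<open>y'' = (q - k\<^sup>2) y\<close>, \<open>z = y' + i k y\<close> satisfies \<open>z' = i k z + q y\<close>, and \<open>y\<close> is the imaginary part
  of \<open>z\<close> divided by \<open>k\<close>. The derivative of the phase cancels \<open>i k z\<close> and the multiple of \<open>z\<close> in \<open>q y\<close>;
  what is left is the multiple of \<open>cnj z\<close>.
\<close>

lemma hill_solution_imp_primitive:
  assumes k: "k > 0" and h: "hill_solution q (k\<^sup>2) y y'"
  shows "primitive_of (\<lambda>x. cis (- theta k x) * (of_real (y' x) + \<i> * of_real k * of_real (y x)))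
           (\<lambda>x. gam k x * cnj (cis (- theta k x) * (of_real (y' x) + \<i> * of_real k * of_real (y x))))"
proof -
  obtain y'' where y'': "y'' absolutely_integrable_on {0..1}" "\<And>x. x \<in> {0..1} \<Longrightarrow> y' x = y' 0 + integral {0..x} y''"
      "AE x in lebesgue. x \<in> {0..1} \<longrightarrow> - y'' x + q x * y x = k\<^sup>2 * y x"
    and dy: "\<And>x. x \<in> {0..1} \<Longrightarrow> (y has_real_derivative y' x) (at x within {0..1})"
    using h unfolding hill_solution_def by blast
  have "primitive_of (\<lambda>x. of_real (y' 0) + of_real (integral {0..x} y'')) (\<lambda>x. 0 + of_real (y'' x))"
    by (intro primitive_add primitive_const primitive_of_real y'')
  then have P1: "primitive_of (\<lambda>x. of_real (y' x)) (\<lambda>x. of_real (y'' x))"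
  proof (rule primitive_cong)
    show "complex_of_real (y' 0) + of_real (integral {0..x} y'') = of_real (y' x)" if "0 \<le> x" "x \<le> 1" for x
      unfolding of_real_add[symmetric] by (rule arg_cong[OF y''(2)[symmetric]]) (use that in auto)
  qed auto
  have P2: "primitive_of (\<lambda>x. of_real (y x)) (\<lambda>x. of_real (y' x))"
  proof (rule primitive_C1)
    show "((\<lambda>x. complex_of_real (y x)) has_vector_derivative of_real (y' x)) (at x within {0..1})" if "0 \<le> x" "x \<le> 1" for x
      by (rule has_vector_derivative_of_real)
        (use dy[of x] that in \<open>simp add: has_real_derivative_iff_has_vector_derivative\<close>)
  qed (rule primitive_continuous[OF P1])
  have yc: "continuous_on {0..1} (\<lambda>x. complex_of_real (y x))" by (rule primitive_continuous[OF P2])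
  let ?z = "\<lambda>x. complex_of_real (y' x) + \<i> * of_real k * of_real (y x)"
  let ?z' = "\<lambda>x. of_real (q x) * of_real (y x) + \<i> * of_real k * ?z x"
  have z1: "primitive_of ?z (\<lambda>x. of_real (y'' x) + \<i> * of_real k * of_real (y' x))"
    by (intro primitive_add primitive_cmult P1 P2)
  have z: "primitive_of ?z ?z'"
  proof (rule primitive_AE[OF z1])
    show "?z' absolutely_integrable_on {0..1}"
      by (intro set_integral_add L1_mult_of_real_continuous q_L1 yc absolutely_integrable_continuous_real
           continuous_intros primitive_continuous[OF P1])
    show "AE x in lebesgue. x \<in> {0..1} \<longrightarrow> of_real (y'' x) + \<i> * of_real k * of_real (y' x) = ?z' x"
      using y''(3)
    proof eventually_elim
      case (elim x)
      show ?case
      proof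
        assume "x \<in> {0..1}"
        then have eq: "y'' x = q x * y x - k\<^sup>2 * y x" using elim by simp
        show "of_real (y'' x) + \<i> * of_real k * of_real (y' x) = ?z' x"
          unfolding eq by (simp add: algebra_simps power2_eq_square)
      qed
    qed
  qed
  have "primitive_of (\<lambda>x. of_real (- theta k x)) (\<lambda>x. of_real (- (k - q x / (2 * k))))"
    using primitive_cmult[OF theta_primitive, of "-1" k] by simp
  note c = primitive_cis[OF this]
  show ?thesis
  proof (rule primitive_cong[OF primitive_mult[OF c z]])
    fix x
    define e where "e = cis (- theta k x)"
    have e2: "cis (- (2 * theta k x)) = e * e" by (simp add: e_def cis_mult)
    have e1: "cnj e * e = 1" by (simp add: e_def cis_cnj cis_mult)
    have kk: "complex_of_real k \<noteq> 0" using k by simp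
    have "gam k x * cnj (e * ?z x) = of_real (q x) * (\<i> / of_real (2 * k)) * e * (cnj e * e) * cnj (?z x)"
      unfolding gam_def e2 complex_cnj_mult by (simp only: mult_ac)
    also have "\<dots> = of_real (q x) * (\<i> / of_real (2 * k)) * e * (of_real (y' x) - \<i> * of_real k * of_real (y x))"
      unfolding e1 by simp
    also have "\<dots> = \<i> * of_real (- (k - q x / (2 * k))) * e * ?z x + ?z' x * e"
      using kk by (simp add: field_simps power2_eq_square)
    finally show "\<i> * of_real (- (k - q x / (2 * k))) * cis (- theta k x) * ?z x + ?z' x * cis (- theta k x)
        = gam k x * cnj (cis (- theta k x) * ?z x)" unfolding e_def by simp
  qed auto
qed

lemma primitive_Re_Im:
  assumes "primitive_of F f" "0 \<le> x" "x \<le> 1"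
  shows "integral {0..x} (\<lambda>t. Re (f t)) = Re (F x) - Re (F 0)" "integral {0..x} (\<lambda>t. Im (f t)) = Im (F x) - Im (F 0)"
  using integral_linear[OF L1_integrable[OF primitive_ofD(1)[OF assms(1)] order_refl assms(3)] bounded_linear_Re]
    integral_linear[OF L1_integrable[OF primitive_ofD(1)[OF assms(1)] order_refl assms(3)] bounded_linear_Im]
    primitive_ofD(2)[OF assms] by (auto simp: o_def)

lemma primitive_imp_hill_solution:
  assumes k: "k > 0" and u: "primitive_of u (\<lambda>x. gam k x * cnj (u x))"
    and y: "\<And>x. x \<in> {0..1} \<Longrightarrow> y x = Im (cis (theta k x) * u x) / k"
  shows "hill_solution q (k\<^sup>2) y (\<lambda>x. Re (cis (theta k x) * u x))"
proof -
  define z where "z = (\<lambda>x. cis (theta k x) * u x)"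
  let ?z = z
  let ?z' = "\<lambda>x. of_real (q x) * of_real (Im (z x) / k) + \<i> * of_real k * z x"
  have kk: "complex_of_real k \<noteq> 0" using k by simp
  have y: "y x = Im (z x) / k" if "x \<in> {0..1}" for x using y[OF that] by (simp add: z_def)
  have z: "primitive_of ?z ?z'"
  proof (rule primitive_cong[OF primitive_mult[OF primitive_cis[OF theta_primitive] u]])
    fix x
    define e where "e = cis (theta k x)"
    have e2: "cis (- (2 * theta k x)) = cnj e * cnj e" by (simp add: e_def cis_cnj cis_mult)
    have e1: "e * cnj e = 1" by (simp add: e_def cis_cnj cis_mult)
    have im: "of_real (Im w) = \<i> / 2 * (cnj w - w)" for w by (simp add: complex_eq_iff)
    have "gam k x * cnj (u x) * e = of_real (q x) * (\<i> / of_real (2 * k)) * (e * cnj e) * cnj (e * u x)"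
      unfolding gam_def e2 complex_cnj_mult by (simp only: mult_ac)
    then show "\<i> * of_real (k - q x / (2 * k)) * cis (theta k x) * u x + gam k x * cnj (u x) * cis (theta k x) = ?z' x"
      unfolding z_def e_def[symmetric] e1 of_real_divide im using kk by (simp add: field_simps)
  qed (simp add: z_def)
  have zc: "continuous_on {0..1} ?z" by (rule primitive_continuous[OF z])
  have der: "(y has_real_derivative Re (?z x)) (at x within {0..1})" if x: "x \<in> {0..1}" for x
  proof -
    have "((\<lambda>x. integral {0..x} (\<lambda>t. Re (?z t))) has_vector_derivative Re (?z x)) (at x within {0..1})"
      by (intro integral_has_vector_derivative continuous_intros zc x)
    then have "((\<lambda>x. y 0 + integral {0..x} (\<lambda>t. Re (?z t))) has_real_derivative Re (?z x)) (at x within {0..1})"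
      unfolding has_real_derivative_iff_has_vector_derivative[symmetric] by (auto intro!: derivative_eq_intros)
    moreover have "y 0 + integral {0..x} (\<lambda>t. Re (?z t)) = y x" if "x \<in> {0..1}" for x
    proof -
      have "Im (?z' t) = k * Re (?z t)" for t by simp
      then have "integral {0..x} (\<lambda>t. k * Re (?z t)) = Im (?z x) - Im (?z 0)"
        using primitive_Re_Im(2)[OF z, of x] that by simp
      then have "k * (y 0 + integral {0..x} (\<lambda>t. Re (z t))) = k * y x"
        using y[of x] y[of 0] that k by (simp add: field_simps)
      then show ?thesis using k by simp
    qed
    ultimately show ?thesis
      by (rule has_field_derivative_transform_within[OF _ zero_less_one x]) auto
  qed
  have yL: "(\<lambda>x. (q x - k\<^sup>2) * (Im (?z x) / k)) absolutely_integrable_on {0..1}"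
  proof -
    have "(\<lambda>x. (Im (?z x) / k) * (q x - k\<^sup>2)) absolutely_integrable_on {0..1}"
    proof (rule absolutely_integrable_bounded_measurable_product_real)
      have c: "continuous_on {0..1} (\<lambda>x. Im (?z x) / k)" using k by (intro continuous_intros zc) auto
      then show "(\<lambda>x. Im (?z x) / k) \<in> borel_measurable (lebesgue_on {0..1})"
        by (intro continuous_imp_measurable_on_sets_lebesgue) auto
      show "bounded ((\<lambda>x. Im (?z x) / k) ` {0..1})"
        by (intro compact_imp_bounded compact_continuous_image c) auto
      show "(\<lambda>x. q x - k\<^sup>2) absolutely_integrable_on {0..1}"
        by (intro set_integral_diff q_L1) (auto intro!: absolutely_integrable_continuous_real)
    qed auto
    then show ?thesis by (simp add: mult.commute)
  qed
  show ?thesis unfolding hill_solution_def fun_cong[OF z_def, symmetric]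
  proof (intro conjI ballI der exI[of _ "\<lambda>x. (q x - k\<^sup>2) * (Im (?z x) / k)"] yL)
    fix x :: real assume x: "x \<in> {0..1}"
    have "Re (?z' t) = (q t - k\<^sup>2) * (Im (?z t) / k)" for t
      using k by (simp add: field_simps power2_eq_square)
    then show "Re (?z x) = Re (?z 0) + integral {0..x} (\<lambda>x. (q x - k\<^sup>2) * (Im (?z x) / k))"
      using primitive_Re_Im(1)[OF z, of x] x by simp
  next
    show "AE x in lebesgue. x \<in> {0..1} \<longrightarrow> - ((q x - k\<^sup>2) * (Im (?z x) / k)) + q x * y x = k\<^sup>2 * y x"
      using y by (intro AE_I2) (auto simp: algebra_simps)
  qed
qed

text \<open>
  The solution with \<open>y' 0 + i k y 0 = c\<close>, extended by 0 as in the definition of the eigenspace.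
\<close>

definition eigenfun :: "real \<Rightarrow> complex \<Rightarrow> real \<Rightarrow> real" where
  "eigenfun k c x = (if x \<in> {0..1} then Im (cis (theta k x) * (alpha k x * c + beta k x * cnj c)) / k else 0)"

lemma eigenfun_hill_solution:
  assumes k: "k \<ge> 1 + mass"
  shows "hill_solution q (k\<^sup>2) (eigenfun k c) (\<lambda>x. Re (cis (theta k x) * (alpha k x * c + beta k x * cnj c)))"
proof (rule primitive_imp_hill_solution)
  show "k > 0" by (rule gam_small[OF k])
  show "primitive_of (\<lambda>x. alpha k x * c + beta k x * cnj c) (\<lambda>x. gam k x * cnj (alpha k x * c + beta k x * cnj c))"
    by (rule volterra_pair_solution[OF gam_L1 refl gam_small(2)[OF k] alpha_beta[OF k]])
qed (simp add: eigenfun_def)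

lemma eigenfun_start:
  assumes k: "k \<ge> 1 + mass"
  shows "cis (theta k 0) * (alpha k 0 * c + beta k 0 * cnj c) = c"
  by (simp add: alpha_beta_D[OF k k])

text \<open>
  Real and imaginary parts of the boundary condition for \<open>z = y' + i k y\<close> are the two conditions on \<open>y'\<close>
  and \<open>y\<close>.
\<close>

lemma eigenspace_eq:
  assumes k: "k \<ge> 1 + mass"
  shows "eigenspace q s (k\<^sup>2) = eigenfun k ` {c. of_real s * A k * c + of_real s * B k * cnj c = c}"
proof (intro equalityI subsetI)
  note k0 = gam_small(1)[OF k]
  fix y assume "y \<in> eigenspace q s (k\<^sup>2)"
  then obtain y' where out: "\<And>x. x \<notin> {0..1} \<Longrightarrow> y x = 0" and h: "hill_solution q (k\<^sup>2) y y'"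
    and bc: "y 0 = s * y 1" "y' 0 = s * y' 1" unfolding eigenspace_def by blast
  define u where "u = (\<lambda>x. cis (- theta k x) * (of_real (y' x) + \<i> * of_real k * of_real (y x)))"
  define c where "c = u 0"
  have u: "primitive_of u (\<lambda>x. gam k x * cnj (u x))"
    unfolding u_def by (rule hill_solution_imp_primitive[OF k0 h])
  have ux: "u x = alpha k x * c + beta k x * cnj c" if "x \<in> {0..1}" for x
    unfolding c_def by (rule volterra_pair_fundamental[OF gam_L1 refl gam_small(2)[OF k] alpha_beta[OF k] u]) (use that in auto)
  have zx: "cis (theta k x) * u x = of_real (y' x) + \<i> * of_real k * of_real (y x)" for x
    by (simp add: u_def mult.assoc[symmetric] cis_mult)
  have "y = eigenfun k c"
  proof
    show "y x = eigenfun k c x" for x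
    proof (cases "x \<in> {0..1}")
      case True
      have "Im (cis (theta k x) * (alpha k x * c + beta k x * cnj c)) = k * y x"
        unfolding ux[OF True, symmetric] zx by simp
      then show ?thesis using True k0 by (simp add: eigenfun_def)
    next
      case False
      then show ?thesis unfolding eigenfun_def using out[OF False] by (simp only: if_False)
    qed
  qed
  moreover have "of_real s * A k * c + of_real s * B k * cnj c = c"
  proof -
    have "of_real s * A k * c + of_real s * B k * cnj c = of_real s * (cis (theta k 1) * u 1)"
      unfolding A_def B_def using ux[of 1] by (simp add: algebra_simps)
    also have "\<dots> = of_real (y' 0) + \<i> * of_real k * of_real (y 0)"
      unfolding zx bc by (simp add: algebra_simps)
    also have "\<dots> = c" by (simp add: c_def u_def)
    finally show ?thesis .
  qed
  ultimately show "y \<in> eigenfun k ` {c. of_real s * A k * c + of_real s * B k * cnj c = c}" by blast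
next
  note k0 = gam_small(1)[OF k]
  fix y assume "y \<in> eigenfun k ` {c. of_real s * A k * c + of_real s * B k * cnj c = c}"
  then obtain c where y: "y = eigenfun k c" and c: "of_real s * A k * c + of_real s * B k * cnj c = c" by blast
  define z where "z = (\<lambda>x. cis (theta k x) * (alpha k x * c + beta k x * cnj c))"
  have z0: "z 0 = c" unfolding z_def by (rule eigenfun_start[OF k])
  have "z 0 = of_real s * z 1"
    unfolding z0 using c by (simp add: z_def A_def B_def algebra_simps)
  then have "Re (z 0) = s * Re (z 1)" "Im (z 0) = s * Im (z 1)" by simp_all
  moreover have "hill_solution q (k\<^sup>2) (eigenfun k c) (\<lambda>x. Re (z x))"
    unfolding z_def by (rule eigenfun_hill_solution[OF k])
  moreover have "eigenfun k c 0 = Im (z 0) / k" "eigenfun k c 1 = Im (z 1) / k"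
    unfolding eigenfun_def z_def by simp_all
  moreover have "eigenfun k c x = 0" if "x \<notin> {0..1}" for x
    unfolding eigenfun_def using that by (simp only: if_False)
  ultimately show "y \<in> eigenspace q s (k\<^sup>2)"
    unfolding eigenspace_def y by (intro CollectI conjI exI[of _ "\<lambda>x. Re (z x)"]) auto
qed

lemma eigenfun_eq_0:
  assumes k: "k \<ge> 1 + mass" and z: "eigenfun k c = (\<lambda>x. 0)"
  shows "c = 0"
proof -
  define z where "z = (\<lambda>x. cis (theta k x) * (alpha k x * c + beta k x * cnj c))"
  have z0: "z 0 = c" unfolding z_def by (rule eigenfun_start[OF k])
  have "hill_solution q (k\<^sup>2) (eigenfun k c) (\<lambda>x. Re (z x))"
    unfolding z_def by (rule eigenfun_hill_solution[OF k])
  then have "((\<lambda>x. 0) has_vector_derivative Re (z 0)) (at 0 within {0..1})"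
    unfolding hill_solution_def z has_real_derivative_iff_has_vector_derivative by auto
  then have "Re (z 0) = 0"
    by (rule vector_derivative_unique_within[rotated]) (auto simp: trivial_limit_within islimpt_Icc)
  moreover have "Im (z 0) = 0"
    using fun_cong[OF z, of 0] gam_small(1)[OF k] unfolding eigenfun_def z_def[symmetric, THEN fun_cong]
    by (simp add: z_def)
  ultimately show ?thesis using z0 by (simp add: complex_eq_iff)
qed

lemma eigenfun_linear:
  "eigenfun k (of_real r * c) = fun_scale r (eigenfun k c)"
  "eigenfun k (c + d) = eigenfun k c + eigenfun k d"
  by (auto simp: fun_eq_iff fun_scale_def eigenfun_def add_divide_distrib[symmetric] algebra_simps)

text \<open>
  The dimension of a space without a finite basis is 0 by convention, so positivity also needs that the
  eigenspace is spanned by the two solutions with \<open>c = 1\<close> and \<open>c = i\<close>.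
\<close>

lemma multiplicity_pos:
  assumes k: "k \<ge> 1 + mass" and c: "c \<noteq> 0" "of_real s * A k * c + of_real s * B k * cnj c = c"
  shows "multiplicity_of q s (k\<^sup>2) \<noteq> 0"
proof
  assume zero: "multiplicity_of q s (k\<^sup>2) = 0"
  obtain V where V: "V \<subseteq> eigenspace q s (k\<^sup>2)" "real_fun.independent V" "eigenspace q s (k\<^sup>2) \<subseteq> real_fun.span V"
      "card V = real_fun.dim (eigenspace q s (k\<^sup>2))"
    using real_fun.basis_exists by blast
  let ?W = "{eigenfun k 1, eigenfun k \<i>}"
  have "eigenfun k d \<in> real_fun.span ?W" for d
  proof -
    have "d = of_real (Re d) * 1 + of_real (Im d) * \<i>" by (simp add: complex_eq_iff)
    then have "eigenfun k d = fun_scale (Re d) (eigenfun k 1) + fun_scale (Im d) (eigenfun k \<i>)"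
      by (metis eigenfun_linear)
    moreover have "fun_scale (Re d) (eigenfun k 1) + fun_scale (Im d) (eigenfun k \<i>) \<in> real_fun.span ?W"
      by (rule real_fun.span_add; rule real_fun.span_scale, rule real_fun.span_base) auto
    ultimately show ?thesis by simp
  qed
  then have "V \<subseteq> real_fun.span ?W" using V(1) unfolding eigenspace_eq[OF k] by auto
  then have "finite V" using real_fun.independent_span_bound[OF _ V(2), of ?W] by auto
  then have "V = {}" using V(4) zero by (simp add: multiplicity_of_def)
  then have "eigenspace q s (k\<^sup>2) \<subseteq> {0}" using V(3) by simp
  moreover have "eigenfun k c \<in> eigenspace q s (k\<^sup>2)" unfolding eigenspace_eq[OF k] using c by blast
  ultimately have "eigenfun k c = (\<lambda>x. 0)" by (auto simp: zero_fun_def)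
  then show False using eigenfun_eq_0[OF k] c by blast
qed

lemma multiplicity_pos_iff:
  assumes k: "k \<ge> 1 + mass" and s: "\<bar>s\<bar> = 1"
  shows "multiplicity_of q s (k\<^sup>2) \<noteq> 0 \<longleftrightarrow> s * Re (A k) = 1"
proof -
  have "(norm (of_real s * A k))\<^sup>2 - (norm (of_real s * B k))\<^sup>2 = 1"
    using A_B_conserved[OF k] s by (simp add: norm_mult)
  from unimodular_singular_iff[OF this]
  have iff: "(\<exists>c. c \<noteq> 0 \<and> of_real s * A k * c + of_real s * B k * cnj c = c) \<longleftrightarrow> s * Re (A k) = 1" by simp
  show ?thesis
  proof
    assume m: "multiplicity_of q s (k\<^sup>2) \<noteq> 0"
    show "s * Re (A k) = 1"
    proof (rule ccontr)
      assume "s * Re (A k) \<noteq> 1"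
      then have "{c. of_real s * A k * c + of_real s * B k * cnj c = c} \<subseteq> {0}" using iff by blast
      then have "eigenspace q s (k\<^sup>2) \<subseteq> {eigenfun k 0}" unfolding eigenspace_eq[OF k] by blast
      moreover have "eigenfun k 0 = 0" by (simp add: eigenfun_def fun_eq_iff)
      ultimately have "eigenspace q s (k\<^sup>2) \<subseteq> real_fun.span {}" by simp
      from real_fun.dim_le_card[OF this] show False using m by (simp add: multiplicity_of_def)
    qed
  next
    assume "s * Re (A k) = 1"
    then show "multiplicity_of q s (k\<^sup>2) \<noteq> 0" using iff multiplicity_pos[OF k] by blast
  qed
qed

lemma multiplicity_le_1:
  assumes k: "k \<ge> 1 + mass" and s: "of_real s * A k \<noteq> 1"
  shows "multiplicity_of q s (k\<^sup>2) \<le> 1"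
proof -
  obtain c0 where c0: "\<And>c. of_real s * A k * c + of_real s * B k * cnj c = c \<Longrightarrow> \<exists>r. c = of_real r * c0"
    using singular_line[OF s, of "of_real s * B k"] by blast
  have "eigenspace q s (k\<^sup>2) \<subseteq> real_fun.span {eigenfun k c0}"
    unfolding eigenspace_eq[OF k]
  proof clarify
    fix c assume "of_real s * A k * c + of_real s * B k * cnj c = c"
    then obtain r where c: "c = of_real r * c0" using c0 by blast
    show "eigenfun k c \<in> real_fun.span {eigenfun k c0}"
      unfolding c eigenfun_linear by (rule real_fun.span_scale, rule real_fun.span_base) auto
  qed
  from real_fun.dim_le_card[OF this] show ?thesis by (simp add: multiplicity_of_def)
qed

end

section \<open>Dependence on the spectral parameter\<close>

lemma norm_cis_diff_le: "norm (cis a - cis b) \<le> \<bar>a - b\<bar>"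
proof -
  have "(norm (cis a - cis b))\<^sup>2 = 2 - 2 * cos (a - b)"
    by (simp add: cmod_power2 power2_diff cos_diff algebra_simps)
  also have "\<dots> = (2 * sin ((a - b) / 2))\<^sup>2"
  proof -
    define h where "h = (a - b) / 2"
    have h: "a - b = 2 * h" by (simp add: h_def)
    show ?thesis unfolding h_def[symmetric] unfolding h cos_double_sin by (simp add: power2_eq_square)
  qed
  also have "\<dots> \<le> (a - b)\<^sup>2"
    using abs_sin_x_le_abs_x[of "(a - b) / 2"] by (intro abs_le_square_iff[THEN iffD1]) auto
  finally have "(norm (cis a - cis b))\<^sup>2 \<le> \<bar>a - b\<bar>\<^sup>2" by simp
  then show ?thesis by (rule power2_le_imp_le) auto
qed

context L1_potential
begin

lemma theta_lipschitz:
  assumes k: "1 \<le> k" "k \<le> k'" and x: "0 \<le> x" "x \<le> 1"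
  shows "\<bar>theta k x - theta k' x\<bar> \<le> (1 + mass) * (k' - k)"
proof -
  have "theta k x - theta k' x = - (k' - k) * x - q1 x * ((k' - k) / (2 * k * k'))"
    using k by (simp add: theta_def field_simps)
  then have "\<bar>theta k x - theta k' x\<bar> \<le> (k' - k) * x + \<bar>q1 x\<bar> * ((k' - k) / (2 * k * k'))"
    using k x by (smt (verit) abs_mult abs_of_nonneg divide_nonneg_nonneg mult_nonneg_nonneg minus_mult_minus mult_minus_left)
  also have "\<dots> \<le> (k' - k) * 1 + mass * ((k' - k) / 1)"
  proof (intro add_mono mult_mono divide_left_mono)
    have "1 * 1 \<le> k * k'" using k by (intro mult_mono) auto
    then show "1 \<le> 2 * k * k'" by simp
    then show "0 < 2 * k * k' * 1" by simp
  qed (use k x q1_le mass_nonneg in auto)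
  finally show ?thesis by (simp add: algebra_simps)
qed

lemma gam_lipschitz:
  assumes k: "1 \<le> k" "k \<le> k'" and x: "0 \<le> x" "x \<le> 1"
  shows "norm (gam k x - gam k' x) \<le> \<bar>q x\<bar> * ((2 + mass) * (k' - k) / k)"
proof -
  let ?e = "\<lambda>k. cis (- (2 * theta k x))"
  have "gam k x - gam k' x = of_real (q x) * \<i> * (of_real (1 / (2 * k) - 1 / (2 * k')) * ?e k + of_real (1 / (2 * k')) * (?e k - ?e k'))"
    by (simp add: gam_def algebra_simps)
  then have eq: "norm (gam k x - gam k' x)
      = \<bar>q x\<bar> * norm (of_real (1 / (2 * k) - 1 / (2 * k')) * ?e k + of_real (1 / (2 * k')) * (?e k - ?e k'))"
    by (simp add: norm_mult)
  have "norm (of_real (1 / (2 * k) - 1 / (2 * k')) * ?e k + of_real (1 / (2 * k')) * (?e k - ?e k'))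
      \<le> \<bar>1 / (2 * k) - 1 / (2 * k')\<bar> + 1 / (2 * k') * norm (?e k - ?e k')"
    using k by (intro order_trans[OF norm_triangle_ineq]) (simp add: norm_mult del: of_real_diff of_real_divide)
  also have "\<dots> \<le> (k' - k) / k + 1 / (2 * k') * (2 * ((1 + mass) * (k' - k)))"
  proof (intro add_mono mult_left_mono)
  show "norm (?e k - ?e k') \<le> 2 * ((1 + mass) * (k' - k))"
    using norm_cis_diff_le[of "- (2 * theta k x)" "- (2 * theta k' x)"] theta_lipschitz[OF assms] by linarith
  show "\<bar>1 / (2 * k) - 1 / (2 * k')\<bar> \<le> (k' - k) / k"
  proof -
    have "\<bar>1 / (2 * k) - 1 / (2 * k')\<bar> = (k' - k) / (k * (2 * k'))" using k by (simp add: field_simps abs_if)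
    also have "\<dots> \<le> (k' - k) / (k * 1)" using k by (intro divide_left_mono mult_left_mono mult_pos_pos) auto
    finally show ?thesis by simp
  qed
  qed (use k in auto)
  also have "1 / (2 * k') * (2 * ((1 + mass) * (k' - k))) = (1 + mass) * (k' - k) / k'" using k by simp
  also have "\<dots> \<le> (1 + mass) * (k' - k) / k"
    using k mass_nonneg by (intro divide_left_mono mult_nonneg_nonneg mult_pos_pos) auto
  finally have "norm (gam k x - gam k' x) \<le> \<bar>q x\<bar> * ((k' - k) / k + (1 + mass) * (k' - k) / k)"
    unfolding eq by (simp add: mult_left_mono)
  also have "(k' - k) / k + (1 + mass) * (k' - k) / k = (2 + mass) * (k' - k) / k"
    using k by (simp add: field_simps)
  finally show ?thesis .
qed

lemma alpha_beta_lipschitz: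
  assumes k: "1 + mass \<le> k" "k \<le> k'"
  shows "norm (alpha k 1 - alpha k' 1) + norm (beta k 1 - beta k' 1) \<le> 8 * mass * (2 + mass) / k * (k' - k)"
proof -
  have k1: "1 \<le> k" using k mass_nonneg by linarith
  have "norm (alpha k 1 - alpha k' 1) + norm (beta k 1 - beta k' 1) \<le> 8 * integral {0..1} (\<lambda>t. norm (gam k t - gam k' t))"
    using k by (intro volterra_pair_lipschitz gam_L1 gam_small alpha_beta) auto
  also have "integral {0..1} (\<lambda>t. norm (gam k t - gam k' t)) \<le> integral {0..1} (\<lambda>x. \<bar>q x\<bar> * ((2 + mass) * (k' - k) / k))"
  proof (rule integral_le)
    show "(\<lambda>t. norm (gam k t - gam k' t)) integrable_on {0..1}"
      by (intro L1_norm_integrable set_integral_diff gam_L1) auto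
    show "(\<lambda>x. \<bar>q x\<bar> * ((2 + mass) * (k' - k) / k)) integrable_on {0..1}"
      using L1_norm_integrable[OF q_L1, of 0 1] by (intro integrable_on_mult_left) simp
  qed (use gam_lipschitz k1 k in auto)
  also have "\<dots> = mass * ((2 + mass) * (k' - k) / k)" unfolding mass_def by simp
  finally show ?thesis by (simp add: mult_ac)
qed

lemma alpha_near_1: "1 + mass \<le> k \<Longrightarrow> norm (alpha k 1 - 1) \<le> mass / k"
  and beta_small: "1 + mass \<le> k \<Longrightarrow> norm (beta k 1) \<le> mass / k"
proof -
  assume k: "1 + mass \<le> k"
  note g = gam_small[OF k]
  have N: "mass / (2 * k) \<le> 1/2" using g by (simp add: integral_norm_gam)
  have N0: "0 \<le> mass / (2 * k)" using mass_nonneg g by simp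
  show "norm (beta k 1) \<le> mass / k"
    using volterra_pair_bounds(2)[OF gam_L1 refl g(2) alpha_beta[OF k], of 1] g(1) by (simp add: integral_norm_gam)
  have "norm (alpha k 1 - 1) \<le> 3 * (mass / (2 * k)) * (mass / (2 * k))"
  proof -
    have "norm (integral {0..x} (gam k)) \<le> mass / (2 * k)" if "0 \<le> x" "x \<le> 1" for x
      using norm_integral_le_L1[OF gam_L1[of k] gam_L1[of k], where M = 1 and a = 0 and b = x] that g(1) by (simp add: integral_norm_gam)
    from volterra_pair_expansion(2)[OF gam_L1 refl g(2) alpha_beta[OF k] this, of 1]
    show ?thesis using g(1) by (simp add: integral_norm_gam)
  qed
  also have "\<dots> \<le> 3 * (mass / (2 * k)) * (1/2)"
    using N N0 by (intro mult_left_mono) auto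
  also have "\<dots> \<le> mass / k" using N0 by (simp add: field_simps)
  finally show "norm (alpha k 1 - 1) \<le> mass / k" .
qed

text \<open>
  A common constant for all bounds \<open>O(1/k)\<close> on \<open>A k - cis k\<close> and \<open>B k\<close>.
\<close>

definition lip_const :: real where "lip_const = 1 + 8 * mass * (2 + mass) + mass * (1 + mass) + 2 * mass"

lemma lip_const_ge: "lip_const \<ge> 1" "lip_const \<ge> 2 * mass" "lip_const > 0"
proof -
  have "0 \<le> 8 * mass * (2 + mass)" "0 \<le> mass * (1 + mass)" using mass_nonneg by auto
  then show "lip_const \<ge> 1" "lip_const \<ge> 2 * mass" using mass_nonneg by (auto simp: lip_const_def)
  then show "lip_const > 0" by linarith
qed

lemma A_near_cis: "1 + mass \<le> k \<Longrightarrow> norm (A k - cis k) \<le> lip_const / k"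
proof -
  assume k: "1 + mass \<le> k"
  then have k0: "k > 0" using mass_nonneg by linarith
  have "A k - cis k = cis (theta k 1) * (alpha k 1 - 1) + (cis (theta k 1) - cis k)"
    by (simp add: A_def algebra_simps)
  also have "norm \<dots> \<le> norm (alpha k 1 - 1) + norm (cis (theta k 1) - cis k)"
    by (rule order_trans[OF norm_triangle_ineq]) (simp add: norm_mult)
  also have "\<dots> \<le> mass / k + mass / (2 * k)"
  proof (intro add_mono alpha_near_1 k)
    have "norm (cis (theta k 1) - cis k) \<le> \<bar>theta k 1 - k\<bar>" by (rule norm_cis_diff_le)
    also have "\<dots> = \<bar>q1 1\<bar> / (2 * k)" using k0 by (simp add: theta_def)
    also have "\<dots> \<le> mass / (2 * k)" using q1_le[of 1] k0 by (intro divide_right_mono) auto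
    finally show "norm (cis (theta k 1) - cis k) \<le> mass / (2 * k)" .
  qed
  also have "\<dots> \<le> 2 * mass / k" using k0 mass_nonneg by (simp add: field_simps)
  also have "\<dots> \<le> lip_const / k" using k0 lip_const_ge by (intro divide_right_mono) auto
  finally show ?thesis .
qed

lemma B_small: "1 + mass \<le> k \<Longrightarrow> norm (B k) \<le> lip_const / k"
proof -
  assume k: "1 + mass \<le> k"
  then have "norm (B k) \<le> mass / k" using beta_small by (simp add: B_def norm_mult)
  also have "\<dots> \<le> lip_const / k" using k lip_const_ge mass_nonneg by (intro divide_right_mono) auto
  finally show ?thesis .
qed

text \<open>
  Both the amplitude \<open>alpha k 1\<close> and the correction \<open>- q1 1 / (2 k)\<close> of the phase vary by \<open>O(1/k)\<close> times
  the increment of \<open>k\<close>.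
\<close>

lemma A_lipschitz:
  assumes k: "1 + mass \<le> k" "k \<le> k'"
  shows "norm ((A k - cis k) - (A k' - cis k')) \<le> lip_const / k * (k' - k)"
proof -
  have k1: "1 \<le> k" using k mass_nonneg by linarith
  have kk: "1 * k \<le> k' * k" using k k1 by (intro mult_right_mono) auto
  let ?d = "k' - k"
  have d: "?d \<ge> 0" using k by simp
  define r where "r = (\<lambda>k. - q1 1 / (2 * k))"
  have th: "theta k 1 = k + r k" for k by (simp add: theta_def r_def)
  have e: "norm (cis (r k') - 1) \<le> mass / k"
  proof -
    have "norm (cis (r k') - cis 0) \<le> \<bar>r k' - 0\<bar>" by (rule norm_cis_diff_le)
    also have "\<dots> \<le> mass / (2 * k')" using q1_le[of 1] k1 k by (auto simp: r_def intro!: divide_right_mono)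
    also have "\<dots> \<le> mass / k" using mass_nonneg k1 k by (intro divide_left_mono mult_pos_pos) auto
    finally show ?thesis by simp
  qed
  have rr: "norm (cis (r k) - cis (r k')) \<le> mass / k * ?d"
  proof -
    have "norm (cis (r k) - cis (r k')) \<le> \<bar>r k - r k'\<bar>" by (rule norm_cis_diff_le)
    also have "r k - r k' = - q1 1 * (?d / (2 * k * k'))" using k1 k by (simp add: r_def field_simps)
    also have "\<bar>- q1 1 * (?d / (2 * k * k'))\<bar> = \<bar>q1 1\<bar> * (?d / (2 * k * k'))"
      using d k1 k by (simp add: abs_mult)
    also have "\<dots> \<le> mass * (?d / k)"
      using q1_le[of 1] d k1 k kk mass_nonneg by (intro mult_mono divide_left_mono mult_pos_pos) auto
    finally show ?thesis by simp
  qed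
  have "(A k - cis k) - (A k' - cis k')
     = cis (theta k 1) * (alpha k 1 - alpha k' 1) + (cis (theta k 1) - cis (theta k' 1)) * (alpha k' 1 - 1)
       + (cis k * (cis (r k) - cis (r k')) + (cis k - cis k') * (cis (r k') - 1))"
    unfolding A_def th by (simp add: algebra_simps cis_mult)
  also have "norm \<dots> \<le> norm (cis (theta k 1) * (alpha k 1 - alpha k' 1)) + norm ((cis (theta k 1) - cis (theta k' 1)) * (alpha k' 1 - 1))
       + (norm (cis k * (cis (r k) - cis (r k'))) + norm ((cis k - cis k') * (cis (r k') - 1)))"
    by (intro norm_triangle_le add_mono norm_triangle_ineq order_refl)
  also have "\<dots> \<le> 8 * mass * (2 + mass) / k * ?d + (1 + mass) * ?d * (mass / k) + (mass / k * ?d + ?d * (mass / k))"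
  proof (intro add_mono)
    show "norm (cis (theta k 1) * (alpha k 1 - alpha k' 1)) \<le> 8 * mass * (2 + mass) / k * ?d"
      unfolding norm_mult norm_cis mult_1 by (rule order_trans[OF _ alpha_beta_lipschitz[OF k]]) simp
    have "norm (cis (theta k 1) - cis (theta k' 1)) \<le> (1 + mass) * ?d"
      using norm_cis_diff_le[of "theta k 1" "theta k' 1"] theta_lipschitz[of k k' 1] k1 k by simp
    moreover have "norm (alpha k' 1 - 1) \<le> mass / k"
    proof -
      have "norm (alpha k' 1 - 1) \<le> mass / k'" using k by (intro alpha_near_1) auto
      also have "\<dots> \<le> mass / k" using mass_nonneg k1 k by (intro divide_left_mono mult_pos_pos) auto
      finally show ?thesis .
    qed
    ultimately show "norm ((cis (theta k 1) - cis (theta k' 1)) * (alpha k' 1 - 1)) \<le> (1 + mass) * ?d * (mass / k)"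
      unfolding norm_mult using mass_nonneg d by (intro mult_mono) auto
    show "norm (cis k * (cis (r k) - cis (r k'))) \<le> mass / k * ?d" using rr by (simp add: norm_mult)
    have "norm (cis k - cis k') \<le> ?d" using norm_cis_diff_le[of k k'] k by simp
    then show "norm ((cis k - cis k') * (cis (r k') - 1)) \<le> ?d * (mass / k)"
      unfolding norm_mult using e d by (intro mult_mono) auto
  qed
  also have "\<dots> = (8 * mass * (2 + mass) + mass * (1 + mass) + 2 * mass) / k * ?d"
    using k1 by (simp add: field_simps)
  also have "\<dots> \<le> lip_const / k * ?d"
    using d k1 by (intro mult_right_mono divide_right_mono) (auto simp: lip_const_def)
  finally show ?thesis .
qed

lemma B_lipschitz:
  assumes k: "1 + mass \<le> k" "k \<le> k'"
  shows "norm (B k - B k') \<le> lip_const / k * (k' - k)"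
proof -
  have k1: "1 \<le> k" using k mass_nonneg by linarith
  let ?d = "k' - k"
  have d: "?d \<ge> 0" using k by simp
  have "B k - B k' = cis (theta k 1) * (beta k 1 - beta k' 1) + (cis (theta k 1) - cis (theta k' 1)) * beta k' 1"
    by (simp add: B_def algebra_simps)
  also have "norm \<dots> \<le> norm (cis (theta k 1) * (beta k 1 - beta k' 1)) + norm ((cis (theta k 1) - cis (theta k' 1)) * beta k' 1)"
    by (rule norm_triangle_ineq)
  also have "\<dots> \<le> 8 * mass * (2 + mass) / k * ?d + (1 + mass) * ?d * (mass / k)"
  proof (intro add_mono)
    show "norm (cis (theta k 1) * (beta k 1 - beta k' 1)) \<le> 8 * mass * (2 + mass) / k * ?d"
      unfolding norm_mult norm_cis mult_1 by (rule order_trans[OF _ alpha_beta_lipschitz[OF k]]) simp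
    have "norm (cis (theta k 1) - cis (theta k' 1)) \<le> (1 + mass) * ?d"
      using norm_cis_diff_le[of "theta k 1" "theta k' 1"] theta_lipschitz[of k k' 1] k1 k by simp
    moreover have "norm (beta k' 1) \<le> mass / k"
    proof -
      have "norm (beta k' 1) \<le> mass / k'" using k by (intro beta_small) auto
      also have "\<dots> \<le> mass / k" using mass_nonneg k1 k by (intro divide_left_mono mult_pos_pos) auto
      finally show ?thesis .
    qed
    ultimately show "norm ((cis (theta k 1) - cis (theta k' 1)) * beta k' 1) \<le> (1 + mass) * ?d * (mass / k)"
      unfolding norm_mult using mass_nonneg d by (intro mult_mono) auto
  qed
  also have "\<dots> = (8 * mass * (2 + mass) + mass * (1 + mass)) / k * ?d"
    using k1 by (simp add: field_simps)
  also have "\<dots> \<le> lip_const / k * ?d"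
    using d k1 mass_nonneg by (intro mult_right_mono divide_right_mono) (auto simp: lip_const_def)
  finally show ?thesis .
qed

end

lemma sin_diff_ge:
  assumes "-1 \<le> a" "a \<le> b" "b \<le> (1::real)"
  shows "sin b - sin a \<ge> (b - a) / 2"
proof (cases "a = b")
  case False
  then have "a < b" using assms by simp
  then obtain c where c: "a < c" "c < b" "sin b - sin a = (b - a) * cos c"
    using MVT2[of a b sin cos] by (auto intro: DERIV_sin)
  have "cos (pi / 3) \<le> cos \<bar>c\<bar>"
    using c assms pi_gt3 by (intro cos_monotone_0_pi_le) auto
  then have "cos c \<ge> 1/2" by (simp add: cos_60)
  then have "(b - a) * (1/2) \<le> (b - a) * cos c" using assms by (intro mult_left_mono) auto
  then show ?thesis using c(3) by simp
qed auto

lemma cos_1_le: "cos (1::real) \<le> 7/8"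
proof -
  have "sin (1/2) \<ge> (1/4 :: real)" using sin_diff_ge[of 0 "1/2"] by simp
  then have "(1/4)\<^sup>2 \<le> (sin (1/2::real))\<^sup>2" by (intro power_mono) auto
  then show ?thesis using cos_double_sin[of "1/2 :: real"] by (simp add: power2_eq_square)
qed

lemma cis_minus_nat_pi: "cis (k - real n * pi) = of_real ((-1) ^ n) * cis k"
proof -
  have "cis (real n * pi) = (-1) ^ n" using Complex.DeMoivre[of pi n, symmetric] unfolding cis_pi .
  then have "cis (k - real n * pi) = cis k / (-1) ^ n" using cis_divide[of k "real n * pi"] by simp
  then show ?thesis by (cases "even n") auto
qed

context L1_potential
begin

text \<open>
  \<open>(-1)\<^sup>r cos k\<close> is close to 1, so the nearest multiple of \<open>\<pi>\<close> of the right parity is within distance 1.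
\<close>

lemma eigenvalue_location:
  assumes k: "1 + mass \<le> k" "8 * lip_const < k" and e: "(-1) ^ r * Re (A k) = 1" and r: "r \<le> 1"
  shows "\<exists>n::nat. even n = even r \<and> \<bar>k - real n * pi\<bar> < 1"
proof -
  have k0: "k > 0" using k mass_nonneg by linarith
  have kpi: "k > 8" using k lip_const_ge by linarith
  \<comment> \<open>k = (r + 2 t) pi, so rounding t yields the nearest n of the parity of r.\<close>
  define t where "t = (k / pi - real r) / 2"
  have "k / pi > 1" using kpi pi_less_4 by (simp add: field_simps)
  moreover have "real r \<le> 1" using r by simp
  ultimately have "0 \<le> k / pi - real r" by linarith
  then have t: "t \<ge> 0" unfolding t_def by (rule divide_nonneg_pos) simp
  define m where "m = nat (round t)"
  have rm: "real m = of_int (round t)" using t by (simp add: m_def round_def)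
  have "\<bar>of_int (round t) - t\<bar> \<le> 1/2" by (rule of_int_round_abs_le)
  then have tm: "\<bar>real m - t\<bar> \<le> 1/2" using rm by simp
  define n where "n = r + 2 * m"
  have "k - real n * pi = 2 * pi * (t - real m)"
    by (simp add: n_def t_def field_simps)
  then have "\<bar>k - real n * pi\<bar> = 2 * pi * \<bar>real m - t\<bar>" by (simp add: abs_mult abs_minus_commute)
  also have "\<dots> \<le> 2 * pi * (1/2)" using tm by (intro mult_left_mono) auto
  finally have le: "\<bar>k - real n * pi\<bar> \<le> pi" by simp
  have sgn: "(-1::real) ^ n = (-1) ^ r" by (simp add: n_def power_add)
  have "lip_const / k < 1/8" using k k0 by (simp add: field_simps)
  moreover have "\<bar>Re (A k - cis k)\<bar> \<le> lip_const / k"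
    using A_near_cis[OF k(1)] abs_Re_le_cmod order_trans by blast
  moreover have "\<bar>(-1) ^ r * Re (A k - cis k)\<bar> = \<bar>Re (A k - cis k)\<bar>" by (simp add: abs_mult)
  moreover have "(-1) ^ r * cos k = 1 - (-1) ^ r * Re (A k - cis k)" using e by (simp add: algebra_simps)
  ultimately have "(-1) ^ r * cos k > 7/8" by linarith
  moreover have "cos (k - real n * pi) = (-1) ^ n * cos k"
    using arg_cong[OF cis_minus_nat_pi[of k n], of Re] by (simp del: of_real_power)
  ultimately have c: "cos \<bar>k - real n * pi\<bar> > 7/8" by (simp add: sgn)
  have "\<bar>k - real n * pi\<bar> < 1"
  proof (rule ccontr)
    assume "\<not> \<bar>k - real n * pi\<bar> < 1"
    then have "cos \<bar>k - real n * pi\<bar> \<le> cos 1" using le by (intro cos_monotone_0_pi_le) auto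
    then show False using c cos_1_le by linarith
  qed
  moreover have "even n = even r" by (simp add: n_def)
  ultimately show ?thesis by blast
qed

text \<open>
  \<open>km\<close> and \<open>kp\<close> are the square roots of the two ends of the instability interval near \<open>(n \<pi>)\<^sup>2\<close>.
\<close>

definition is_edge_pair :: "nat \<Rightarrow> real \<Rightarrow> real \<Rightarrow> bool" where
  "is_edge_pair n km kp \<longleftrightarrow> real n * pi - 1 \<le> km \<and> km \<le> kp \<and> kp \<le> real n * pi + 1 \<and>
     (\<forall>k. \<bar>k - real n * pi\<bar> \<le> 1 \<longrightarrow> ((-1) ^ n * Re (A k) = 1 \<longleftrightarrow> k = km \<or> k = kp)) \<and>
     norm (B km) + norm (B kp) \<le> 2 * (kp - km) \<and>
     (km < kp \<longrightarrow> of_real ((-1) ^ n) * A km \<noteq> 1 \<and> of_real ((-1) ^ n) * A kp \<noteq> 1)"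

text \<open>
  As \<open>|A|\<^sup>2 = 1 + |B|\<^sup>2\<close>, the eigenvalue condition \<open>s Re A = 1\<close> amounts to \<open>s Im A = \<plusminus> |B|\<close> near \<open>n \<pi>\<close>. There
  \<open>s Im A\<close> is \<open>sin (k - n \<pi>)\<close> up to a small Lipschitz error, so each sign has exactly one solution.
\<close>

lemma edge_pair_exists:
  assumes n: "real n * pi - 1 \<ge> 1 + mass" "real n * pi - 1 \<ge> 8 * lip_const"
  shows "\<exists>km kp. is_edge_pair n km kp"
proof -
  define s where "s = (-1::real) ^ n"
  have s: "\<bar>s\<bar> = 1" "s * s = 1" by (simp_all add: s_def power_mult_distrib[symmetric])
  let ?lo = "real n * pi - 1" and ?hi = "real n * pi + 1"
  have lip: "lip_const / k \<le> 1/8" if "k \<ge> ?lo" for k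
    using that n lip_const_ge by (simp add: field_simps)
  define \<rho> where "\<rho> = (\<lambda>k. A k - cis k)"
  have cis: "of_real s * cis k = cis (k - real n * pi)" for k by (simp add: cis_minus_nat_pi s_def)
  have sA: "of_real s * A k = cis (k - real n * pi) + of_real s * \<rho> k" for k
    unfolding cis[symmetric] by (simp add: \<rho>_def algebra_simps)
  have ImA: "s * Im (A k) = sin (k - real n * pi) + s * Im (\<rho> k)" for k
    using arg_cong[OF sA[of k], of Im] by simp
  have ReA: "s * Re (A k) = cos (k - real n * pi) + s * Re (\<rho> k)" for k
    using arg_cong[OF sA[of k], of Re] by simp
  have dr: "norm (\<rho> k - \<rho> k') \<le> (k' - k) / 8" and dB: "norm (B k - B k') \<le> (k' - k) / 8"
    if "?lo \<le> k" "k \<le> k'" for k k'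
  proof -
    have "norm (\<rho> k - \<rho> k') \<le> lip_const / k * (k' - k)" "norm (B k - B k') \<le> lip_const / k * (k' - k)"
      unfolding \<rho>_def using that n by (intro A_lipschitz B_lipschitz; linarith)+
    moreover have "lip_const / k * (k' - k) \<le> 1/8 * (k' - k)" using lip[OF that(1)] that by (intro mult_right_mono) auto
    ultimately show "norm (\<rho> k - \<rho> k') \<le> (k' - k) / 8" "norm (B k - B k') \<le> (k' - k) / 8" by linarith+
  qed
  have br: "norm (\<rho> k) \<le> 1/8" and bB: "norm (B k) \<le> 1/8" if "?lo \<le> k" for k
  proof -
    have "norm (\<rho> k) \<le> lip_const / k" "norm (B k) \<le> lip_const / k"
      unfolding \<rho>_def using that n by (intro A_near_cis B_small; linarith)+
    then show "norm (\<rho> k) \<le> 1/8" "norm (B k) \<le> 1/8" using lip[OF that] by linarith+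
  qed
  have sIm: "\<bar>s * Im z\<bar> \<le> norm z" and sRe: "\<bar>s * Re z\<bar> \<le> norm z" for z
    using abs_Im_le_cmod[of z] abs_Re_le_cmod[of z] s(1) by (simp_all add: abs_mult)
  have mono: "(s * Im (A k') + \<sigma> * norm (B k')) - (s * Im (A k) + \<sigma> * norm (B k)) \<ge> (k' - k) / 4"
    if "?lo \<le> k" "k \<le> k'" "k' \<le> ?hi" "\<bar>\<sigma>\<bar> = 1" for k k' \<sigma>
  proof -
    have "sin (k' - real n * pi) - sin (k - real n * pi) \<ge> (k' - k) / 2"
      using sin_diff_ge[of "k - real n * pi" "k' - real n * pi"] that by simp
    moreover have "\<bar>s * Im (\<rho> k) - s * Im (\<rho> k')\<bar> \<le> (k' - k) / 8"
      using sIm[of "\<rho> k - \<rho> k'"] dr[OF that(1,2)] by (simp add: algebra_simps)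
    moreover have "\<bar>\<sigma> * norm (B k) - \<sigma> * norm (B k')\<bar> \<le> (k' - k) / 8"
    proof -
      have "\<bar>\<sigma> * norm (B k) - \<sigma> * norm (B k')\<bar> = \<bar>norm (B k) - norm (B k')\<bar>"
        using that(4) by (metis abs_mult mult_1 right_diff_distrib)
      then show ?thesis using norm_triangle_ineq3[of "B k" "B k'"] dB[OF that(1,2)] by linarith
    qed
    ultimately show ?thesis unfolding ImA by linarith
  qed
  have contr: "continuous_on {?lo..?hi} \<rho>" and contB: "continuous_on {?lo..?hi} B"
  proof -
    have "norm (\<rho> k - \<rho> k') \<le> 1 * \<bar>k - k'\<bar> \<and> norm (B k - B k') \<le> 1 * \<bar>k - k'\<bar>" if "k \<in> {?lo..?hi}" "k' \<in> {?lo..?hi}" for k k'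
      using dr[of k k'] dr[of k' k] dB[of k k'] dB[of k' k] that
      by (cases "k \<le> k'") (auto simp: norm_minus_commute)
    then have "1-lipschitz_on {?lo..?hi} \<rho>" "1-lipschitz_on {?lo..?hi} B"
      by (auto intro!: lipschitz_onI simp: dist_norm)
    then show "continuous_on {?lo..?hi} \<rho>" "continuous_on {?lo..?hi} B"
      by (auto intro: lipschitz_on_continuous_on)
  qed
  have zero: "\<exists>k. ?lo \<le> k \<and> k \<le> ?hi \<and> s * Im (A k) + \<sigma> * norm (B k) = 0" if \<sigma>: "\<bar>\<sigma>\<bar> = 1" for \<sigma>
  proof (rule IVT')
    have b: "\<bar>s * Im (\<rho> k) + \<sigma> * norm (B k)\<bar> \<le> 1/4" if "?lo \<le> k" for k
    proof -
      have "\<bar>\<sigma> * norm (B k)\<bar> \<le> 1/8" using bB[OF that] \<sigma> by (simp add: abs_mult)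
      then show ?thesis using sIm[of "\<rho> k"] br[OF that] by linarith
    qed
    have s1: "sin (1::real) \<ge> 1/2" using sin_diff_ge[of 0 1] by simp
    show "s * Im (A ?lo) + \<sigma> * norm (B ?lo) \<le> 0"
    proof -
      have "sin (?lo - real n * pi) = - sin 1" by simp
      then show ?thesis using b[OF order_refl] s1 unfolding ImA by linarith
    qed
    show "0 \<le> s * Im (A ?hi) + \<sigma> * norm (B ?hi)"
    proof -
      have "sin (?hi - real n * pi) = sin 1" by simp
      moreover have "?lo \<le> ?hi" by simp
      ultimately show ?thesis using b[of ?hi] s1 unfolding ImA by linarith
    qed
    show "continuous_on {?lo..?hi} (\<lambda>k. s * Im (A k) + \<sigma> * norm (B k))"
      unfolding ImA by (intro continuous_intros contr contB)
  qed simp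
  \<comment> \<open>The sign + gives the lower edge: there s Im A = - |B|, which is at most 0.\<close>
  obtain km where km: "?lo \<le> km" "km \<le> ?hi" "s * Im (A km) + 1 * norm (B km) = 0" using zero[of 1] by auto
  obtain kp where kp: "?lo \<le> kp" "kp \<le> ?hi" "s * Im (A kp) + (-1) * norm (B kp) = 0" using zero[of "-1"] by auto
  have uniq: "k = k'" if "?lo \<le> k" "k \<le> ?hi" "?lo \<le> k'" "k' \<le> ?hi" "\<bar>\<sigma>\<bar> = 1"
     "s * Im (A k) + \<sigma> * norm (B k) = 0" "s * Im (A k') + \<sigma> * norm (B k') = 0" for k k' \<sigma>
    using mono[of k k' \<sigma>] mono[of k' k \<sigma>] that by (cases "k \<le> k'") auto
  have kk: "km \<le> kp"
  proof (rule ccontr)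
    assume "\<not> km \<le> kp"
    then show False using mono[of kp km 1] km kp norm_ge_zero[of "B kp"] by simp
  qed
  have cons: "(s * Re (A k))\<^sup>2 + (s * Im (A k))\<^sup>2 = 1 + (norm (B k))\<^sup>2" if "?lo \<le> k" for k
  proof -
    have "(s * Re (A k))\<^sup>2 + (s * Im (A k))\<^sup>2 = (s * s) * (norm (A k))\<^sup>2"
      unfolding cmod_power2 by (simp add: power2_eq_square algebra_simps)
    also have "\<dots> = 1 + (norm (B k))\<^sup>2" using A_B_conserved[of k] that n s(2) by simp
    finally show ?thesis .
  qed
  have "(-1) ^ n * Re (A k) = 1 \<longleftrightarrow> k = km \<or> k = kp" if "\<bar>k - real n * pi\<bar> \<le> 1" for k
  proof
    have k: "?lo \<le> k" "k \<le> ?hi" using that by linarith+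
    assume "(-1) ^ n * Re (A k) = 1"
    then have "(s * Im (A k))\<^sup>2 = (norm (B k))\<^sup>2" using cons[OF k(1)] by (simp add: s_def)
    then have "s * Im (A k) = norm (B k) \<or> s * Im (A k) = - norm (B k)" by (simp add: power2_eq_iff)
    then show "k = km \<or> k = kp"
      using uniq[OF k km(1,2), of 1] uniq[OF k kp(1,2), of "-1"] km(3) kp(3) by auto
  next
    have k: "?lo \<le> k" "k \<le> ?hi" using that by linarith+
    assume "k = km \<or> k = kp"
    then have "s * Im (A k) = norm (B k) \<or> s * Im (A k) = - norm (B k)" using km kp by auto
    then have "(s * Im (A k))\<^sup>2 = (norm (B k))\<^sup>2" by auto
    then have "(s * Re (A k))\<^sup>2 = 1" using cons[OF k(1)] by simp
    moreover have "s * Re (A k) > 0"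
    proof -
      have "cos (pi / 3) \<le> cos \<bar>k - real n * pi\<bar>"
        using that pi_gt3 by (intro cos_monotone_0_pi_le) auto
      then have "cos (k - real n * pi) \<ge> 1/2" by (simp add: cos_60)
      then show ?thesis unfolding ReA using sRe[of "\<rho> k"] br[OF k(1)] by linarith
    qed
    ultimately show "(-1) ^ n * Re (A k) = 1" by (auto simp: power2_eq_1_iff s_def)
  qed
  moreover have "norm (B km) + norm (B kp) \<le> 2 * (kp - km)"
  proof -
    have "norm (B km) + norm (B kp) = s * Im (A kp) - s * Im (A km)" using km kp by simp
    also have "\<dots> = sin (kp - real n * pi) - sin (km - real n * pi) + s * Im (\<rho> kp - \<rho> km)"
      unfolding ImA by (simp add: algebra_simps)
    also have "\<dots> \<le> (kp - km) + (kp - km) / 8"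
    proof (intro add_mono)
      have "\<bar>sin (kp - real n * pi) - sin (km - real n * pi)\<bar> \<le> norm (cis (kp - real n * pi) - cis (km - real n * pi))"
        using abs_Im_le_cmod[of "cis (kp - real n * pi) - cis (km - real n * pi)"] by simp
      also have "\<dots> \<le> kp - km" using norm_cis_diff_le[of "kp - real n * pi" "km - real n * pi"] kk by simp
      finally show "sin (kp - real n * pi) - sin (km - real n * pi) \<le> kp - km" by simp
      show "s * Im (\<rho> kp - \<rho> km) \<le> (kp - km) / 8"
        using sIm[of "\<rho> kp - \<rho> km"] dr[OF km(1) kk] by (simp add: norm_minus_commute)
    qed
    also have "\<dots> \<le> (kp - km) + (kp - km)" using kk by (intro add_left_mono) (simp add: field_simps)
    finally show ?thesis by simp
  qed
  moreover have "of_real ((-1) ^ n) * A km \<noteq> 1 \<and> of_real ((-1) ^ n) * A kp \<noteq> 1" if lt: "km < kp"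
  proof -
    have "of_real s * A k \<noteq> 1" if k: "k = km \<or> k = kp" for k
    proof
      assume a: "of_real s * A k = 1"
      have kb: "?lo \<le> k" "k \<le> ?hi" using k km kp by auto
      have re: "s * Re (A k) = 1" and im: "s * Im (A k) = 0" using arg_cong[OF a, of Re] arg_cong[OF a, of Im] by simp_all
      have "norm (B k) = 0" using cons[OF kb(1)] unfolding re im by simp
      then have "k = km" "k = kp"
        using uniq[OF kb km(1,2), of 1] uniq[OF kb kp(1,2), of "-1"] km(3) kp(3) im by auto
      then show False using lt by simp
    qed
    then show ?thesis by (auto simp: s_def)
  qed
  ultimately show ?thesis using km kp kk unfolding is_edge_pair_def by (intro exI[of _ km] exI[of _ kp]) simp
qed

end

section \<open>Gaps in the numbered sequence of eigenvalues\<close>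

text \<open>
  Only the parity of the indices matters. A pair of distinct ends occupies two consecutive indices \<open>i, i + 1\<close>.
  If \<open>i + 1\<close> has the parity at which gaps are known to be small, the gap of the pair is one of them. If \<open>i\<close>
  has it, the jump from index \<open>i - 1\<close> to \<open>i\<close> would be small although it leads to a different pair, which
  \<open>sep\<close> excludes. An index lost at the beginning of the sequence therefore does no harm; since every pair
  takes at least one index, the index of the \<open>n\<close>-th pair is at least of order \<open>n / 2\<close>.
\<close>

lemma paired_gaps_small:
  fixes a lo hi :: "nat \<Rightarrow> real" and r N :: nat and T :: real
  assumes mono: "mono a"
    and lohi: "\<And>n. n \<ge> N \<Longrightarrow> even n = even r \<Longrightarrow> lo n \<le> hi n"
    and lo_range: "\<And>n. n \<ge> N \<Longrightarrow> even n = even r \<Longrightarrow> lo n \<in> range a"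
    and hi_range: "\<And>n. n \<ge> N \<Longrightarrow> even n = even r \<Longrightarrow> hi n \<in> range a"
    and only: "\<And>i. a i \<ge> T \<Longrightarrow> \<exists>n\<ge>N. even n = even r \<and> (a i = lo n \<or> a i = hi n)"
    and sep: "\<And>n m. N \<le> n \<Longrightarrow> n < m \<Longrightarrow> even n = even r \<Longrightarrow> even m = even r \<Longrightarrow> hi n + 1 \<le> lo m"
    and simple: "\<And>n i j. n \<ge> N \<Longrightarrow> even n = even r \<Longrightarrow> lo n < hi n \<Longrightarrow> a i = lo n \<or> a i = hi n \<Longrightarrow> a i = a j \<Longrightarrow> i = j"
    and T: "\<And>n. n \<ge> N \<Longrightarrow> even n = even r \<Longrightarrow> T + 1 \<le> lo n"
    and gap: "\<And>e. e > 0 \<Longrightarrow> \<exists>J. \<forall>j\<ge>J. even j = even r \<longrightarrow> a j - a (j - 1) \<le> e / (real j)\<^sup>2"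
    and e: "e > 0"
  shows "\<exists>M. \<forall>n\<ge>M. even n = even r \<longrightarrow> hi n - lo n \<le> e / (real n)\<^sup>2"
proof -
  have index: "n \<le> 2 * i + N + 1" if "n \<ge> N" "even n = even r" "a i = lo n \<or> a i = hi n" for n i
    using that
  proof (induction n arbitrary: i rule: less_induct)
    case (less n)
    show ?case
    proof (cases "n < N + 2")
      case False
      then have n2: "n - 2 \<ge> N" "n - 2 < n" "even (n - 2) = even r" using less.prems by auto
      obtain i' where i': "a i' = hi (n - 2)" using hi_range[OF n2(1,3)] by auto
      have "hi (n - 2) + 1 \<le> lo n" by (rule sep) (use n2 less.prems in auto)
      then have "a i' < a i" using i' less.prems lohi[of n] by auto
      then have "i' < i" using mono by (meson monoD not_less leD)
      moreover have "n - 2 \<le> 2 * i' + N + 1" by (rule less.IH[OF n2(2,1,3)]) (use i' in auto)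
      ultimately show ?thesis by linarith
    qed auto
  qed
  have same: "a m = lo n \<or> a m = hi n"
    if n: "n \<ge> N" "even n = even r" and m: "lo n - 1 < a m" "a m \<le> hi n" for n m
  proof -
    have "a m \<ge> T" using T[OF n] m by linarith
    then obtain n' where n': "n' \<ge> N" "even n' = even r" "a m = lo n' \<or> a m = hi n'" using only by blast
    have "n' = n"
    proof (rule ccontr)
      assume "n' \<noteq> n"
      then consider "n' < n" | "n < n'" by linarith
      then show False
      proof cases
        case 1
        then have "hi n' + 1 \<le> lo n" using n n' by (intro sep) auto
        then show False using n' lohi[of n'] m by auto
      next
        case 2
        then have "hi n + 1 \<le> lo n'" using n n' by (intro sep) auto
        then show False using n' lohi[of n'] m by auto
      qed
    qed
    then show ?thesis using n' by simp
  qed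
  \<comment> \<open>The index j is only known to be at least n / 4, hence the factor 1 / 16.\<close>
  obtain J where J: "\<And>j. j \<ge> J \<Longrightarrow> even j = even r \<Longrightarrow> a j - a (j - 1) \<le> (e / 16) / (real j)\<^sup>2"
    using gap[of "e / 16"] e by auto
  obtain J1 where J1: "\<And>j. j \<ge> J1 \<Longrightarrow> even j = even r \<Longrightarrow> a j - a (j - 1) \<le> (1 / 2) / (real j)\<^sup>2"
    using gap[of "1 / 2"] by auto
  have main: "hi n - lo n \<le> e / (real n)\<^sup>2" if n: "n \<ge> 2 * J + 2 * J1 + 2 * N + 10" "even n = even r" for n
  proof (cases "lo n < hi n")
    case False
    then show ?thesis using e by (auto intro: order_trans[of _ 0])
  next
    case True
    have nN: "n \<ge> N" using n by simp
    obtain i j where i: "a i = lo n" and j: "a j = hi n"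
      using lo_range[OF nN n(2)] hi_range[OF nN n(2)] by auto
    have "a i < a j" using i j True by simp
    then have ij: "i < j" using mono by (meson monoD not_less leD)
    have "j = i + 1"
    proof (rule ccontr)
      assume "j \<noteq> i + 1"
      then have lt: "i < i + 1" "i + 1 < j" using ij by auto
      have "a i \<le> a (i + 1)" "a (i + 1) \<le> a j" using mono lt by (auto intro: monoD)
      then have "a (i + 1) = lo n \<or> a (i + 1) = hi n" using i j by (intro same[OF nN n(2)]) auto
      then show False
        using simple[OF nN n(2) True, of "i + 1" i] simple[OF nN n(2) True, of "i + 1" j] i j lt by auto
    qed
    then have ji: "i = j - 1" "j \<ge> 1" by auto
    have iJ: "i \<ge> J1" "i \<ge> 1" "j \<ge> J" "j \<ge> J1" "4 * j \<ge> n"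
      using index[OF nN n(2), of i] index[OF nN n(2), of j] i j n by auto
    show ?thesis
    proof (cases "even j = even r")
      case True
      have "hi n - lo n \<le> (e / 16) / (real j)\<^sup>2" using J[OF iJ(3) True] i j ji by simp
      also have "\<dots> = e / (real (4 * j))\<^sup>2" by (simp add: power_mult_distrib)
      also have "\<dots> \<le> e / (real n)\<^sup>2"
      proof (intro divide_left_mono power_mono)
        have "real n > 0" using n by simp
        then show "0 < (real (4 * j))\<^sup>2 * (real n)\<^sup>2" using iJ ji by auto
        show "real n \<le> real (4 * j)" using iJ(5) of_nat_le_iff by blast
      qed (use e in auto)
      finally show ?thesis .
    next
      case False
      then have "even i = even r" using ji by auto
      then have "a i - a (i - 1) \<le> (1 / 2) / (real i)\<^sup>2" by (rule J1[OF iJ(1)])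
      also have "\<dots> \<le> (1 / 2) / 1" using iJ(2) by (intro divide_left_mono) auto
      finally have "a (i - 1) > lo n - 1" using i by simp
      moreover have "a (i - 1) \<le> a i" using mono by (auto intro: monoD)
      ultimately have le: "lo n - 1 < a (i - 1)" "a (i - 1) \<le> lo n" using i by auto
      then have "a (i - 1) = lo n \<or> a (i - 1) = hi n" using \<open>lo n < hi n\<close> by (intro same[OF nN n(2)]) auto
      then have "a (i - 1) = a i" using i le \<open>lo n < hi n\<close> by auto
      then have "i - 1 = i" using i by (intro simple[OF nN n(2) \<open>lo n < hi n\<close>]) auto
      then show ?thesis using iJ(2) by simp
    qed
  qed
  then show ?thesis by blast
qed

lemma eigenvalue_sequence_range:
  assumes "eigenvalue_sequence q s a"
  shows "t \<in> range a \<longleftrightarrow> multiplicity_of q s t \<noteq> 0"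
proof -
  have "finite {n. a n = t}" "card {n. a n = t} = multiplicity_of q s t"
    using assms by (auto simp: eigenvalue_sequence_def)
  then have "multiplicity_of q s t \<noteq> 0 \<longleftrightarrow> {n. a n = t} \<noteq> {}" by (metis card_0_eq)
  then show ?thesis by auto
qed

lemma eigenvalue_sequence_simple:
  assumes "eigenvalue_sequence q s a" "multiplicity_of q s (a i) \<le> 1" "a i = a j"
  shows "i = j"
proof -
  have "finite {n. a n = a i}" "card {n. a n = a i} \<le> 1"
    using assms by (auto simp: eigenvalue_sequence_def)
  then show ?thesis using assms(3) by (auto simp: card_le_Suc0_iff_eq)
qed

context L1_potential
begin

definition "edges n = (SOME p. is_edge_pair n (fst p) (snd p))"
definition "km n = fst (edges n)"
definition "kp n = snd (edges n)"

text \<open>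
  The window of radius 1 around \<open>n \<pi>\<close>, with some room to its left, lies in the range of all estimates.
\<close>

definition far :: "nat \<Rightarrow> bool" where
  "far n \<longleftrightarrow> real n * pi - 3 \<ge> 1 + mass \<and> real n * pi - 3 > 8 * lip_const"

lemma far_mono: "far n \<Longrightarrow> n \<le> m \<Longrightarrow> far m"
proof -
  assume "far n" "n \<le> m"
  then have "real n * pi \<le> real m * pi" by (intro mult_right_mono) auto
  then show ?thesis using \<open>far n\<close> unfolding far_def by linarith
qed

lemma far_exists: "\<exists>n. far n"
proof -
  obtain n :: nat where "real n \<ge> 4 + mass + 8 * lip_const" using real_arch_simple by blast
  moreover have "real n * pi \<ge> real n * 1" using pi_ge_two by (intro mult_left_mono) auto
  ultimately have "far n" unfolding far_def using lip_const_ge mass_nonneg by linarith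
  then show ?thesis by blast
qed

lemma edge_pair: "far n \<Longrightarrow> is_edge_pair n (km n) (kp n)"
proof -
  assume "far n"
  then obtain a b where "is_edge_pair n a b" using edge_pair_exists[of n] unfolding far_def by auto
  then show ?thesis unfolding km_def kp_def edges_def
    using someI[of "\<lambda>p. is_edge_pair n (fst p) (snd p)" "(a, b)"] by simp
qed

lemma edge_pairD:
  assumes "far n"
  shows "real n * pi - 1 \<le> km n" "km n \<le> kp n" "kp n \<le> real n * pi + 1"
    "\<bar>k - real n * pi\<bar> \<le> 1 \<Longrightarrow> (-1) ^ n * Re (A k) = 1 \<longleftrightarrow> k = km n \<or> k = kp n"
    "norm (B (km n)) + norm (B (kp n)) \<le> 2 * (kp n - km n)"
    "km n < kp n \<Longrightarrow> of_real ((-1) ^ n) * A (km n) \<noteq> 1" "km n < kp n \<Longrightarrow> of_real ((-1) ^ n) * A (kp n) \<noteq> 1"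
  using edge_pair[OF assms] unfolding is_edge_pair_def by blast+

lemma edge_large:
  assumes "far n"
  shows "km n \<ge> 1 + mass" "kp n \<ge> 1 + mass" "km n \<ge> 1" "kp n \<ge> 1"
  using edge_pairD(1,2)[OF assms] assms mass_nonneg unfolding far_def by linarith+

lemma edge_is_eigenvalue:
  assumes "far n" "eigenvalue_sequence q ((-1) ^ r) a" "even n = even r" "k = km n \<or> k = kp n"
  shows "k\<^sup>2 \<in> range a"
proof -
  have s: "(-1::real) ^ n = (-1) ^ r" using assms(3) by (simp add: minus_one_power_iff)
  have "\<bar>k - real n * pi\<bar> \<le> 1" using edge_pairD(1-3)[OF assms(1)] assms(4) by auto
  then have "(-1) ^ r * Re (A k) = 1" using edge_pairD(4)[OF assms(1), of k] assms(4) s by simp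
  moreover have "k \<ge> 1 + mass" using edge_large[OF assms(1)] assms(4) by auto
  ultimately show ?thesis
    unfolding eigenvalue_sequence_range[OF assms(2)] by (subst multiplicity_pos_iff) (auto simp: power_abs)
qed

lemma eigenvalue_is_edge:
  assumes N: "far N" and a: "eigenvalue_sequence q ((-1) ^ r) a" and r: "r \<le> 1"
    and t: "t \<in> range a" "t = k\<^sup>2" "k \<ge> real N * pi - 3/2"
  shows "\<exists>n\<ge>N. even n = even r \<and> (k = km n \<or> k = kp n)"
proof -
  have k: "k \<ge> 1 + mass" "8 * lip_const < k" using t(3) N unfolding far_def by linarith+
  have e: "(-1) ^ r * Re (A k) = 1"
    using t(1) multiplicity_pos_iff[OF k(1), of "(-1) ^ r"] unfolding t(2) eigenvalue_sequence_range[OF a]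
    by (simp add: power_abs)
  obtain n where n: "even n = even r" "\<bar>k - real n * pi\<bar> < 1"
    using eigenvalue_location[OF k e r] by blast
  have "n \<ge> N"
  proof (rule ccontr)
    assume "\<not> n \<ge> N"
    then have "real (n + 1) \<le> real N" by linarith
    then have "real (n + 1) * pi \<le> real N * pi" by (intro mult_right_mono) auto
    then have "real n * pi + pi \<le> real N * pi" by (simp add: algebra_simps)
    then show False using n(2) t(3) pi_gt3 by linarith
  qed
  moreover from this have "far n" using N far_mono by blast
  moreover have "(-1::real) ^ n = (-1) ^ r" using n(1) by (simp add: minus_one_power_iff)
  ultimately show ?thesis using edge_pairD(4)[of n k] n e by auto
qed

text \<open>
  Every large eigenvalue lies in a window around some \<open>n \<pi>\<close> of the right parity, and consecutive windows are
  far apart, so from some point on the sequence consists of the pairs of edges.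
\<close>

lemma edge_gap_small:
  assumes a: "eigenvalue_sequence q ((-1) ^ r) a" and r: "r \<le> 1"
    and gap: "\<And>e. e > 0 \<Longrightarrow> \<exists>J. \<forall>j\<ge>J. even j = even r \<longrightarrow> a j - a (j - 1) \<le> e / (real j)\<^sup>2"
    and e: "e > 0"
  shows "\<exists>M. \<forall>n\<ge>M. even n = even r \<longrightarrow> (kp n)\<^sup>2 - (km n)\<^sup>2 \<le> e / (real n)\<^sup>2"
proof -
  obtain N where N: "far N" using far_exists by blast
  have far: "far n" if "n \<ge> N" for n using far_mono N that by blast
  \<comment> \<open>Low enough to leave distance 1 below the first pair, high enough that no pair before N reaches T.\<close>
  define T where "T = (real N * pi - 3/2)\<^sup>2"
  have Np: "real N * pi - 3/2 \<ge> 3/2" using N lip_const_ge mass_nonneg unfolding far_def by linarith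
  show ?thesis
  proof (rule paired_gaps_small[where a = a and N = N and T = T, OF _ _ _ _ _ _ _ _ gap e])
    show "mono a" using a by (simp add: eigenvalue_sequence_def)
    fix n assume n: "N \<le> n" "even n = even r"
    note D = edge_pairD[OF far[OF n(1)]] and L = edge_large[OF far[OF n(1)]]
    show "(km n)\<^sup>2 \<le> (kp n)\<^sup>2" using D L by (intro power_mono) auto
    show "(km n)\<^sup>2 \<in> range a" "(kp n)\<^sup>2 \<in> range a"
      using edge_is_eigenvalue[OF far[OF n(1)] a n(2)] by auto
    have "real N * pi \<le> real n * pi" using n by (intro mult_right_mono) auto
    then have "real N * pi - 3/2 + 1/2 \<le> km n" "0 \<le> real N * pi - 3/2 + 1/2" using D(1) Np by linarith+
    then have "(real N * pi - 3/2 + 1/2)\<^sup>2 \<le> (km n)\<^sup>2" by (intro power_mono)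
    moreover have "(real N * pi - 3/2 + 1/2)\<^sup>2 = T + (real N * pi - 3/2) + 1/4" by (simp add: T_def power2_eq_square algebra_simps)
    ultimately show "T + 1 \<le> (km n)\<^sup>2" using Np by linarith
    show "i = j" if lt: "(km n)\<^sup>2 < (kp n)\<^sup>2" and i: "a i = (km n)\<^sup>2 \<or> a i = (kp n)\<^sup>2" and ij: "a i = a j" for i j
    proof (rule eigenvalue_sequence_simple[OF a _ ij])
      have "km n < kp n" using lt D(2) by (cases "km n = kp n") auto
      moreover have "(-1::real) ^ n = (-1) ^ r" using n(2) by (simp add: minus_one_power_iff)
      ultimately have ne: "of_real ((-1) ^ r) * A (km n) \<noteq> 1" "of_real ((-1) ^ r) * A (kp n) \<noteq> 1"
        using D(6,7) by (simp_all del: of_real_power)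
      have "multiplicity_of q ((-1) ^ r) ((km n)\<^sup>2) \<le> 1" "multiplicity_of q ((-1) ^ r) ((kp n)\<^sup>2) \<le> 1"
        by (rule multiplicity_le_1[OF L(1) ne(1)] multiplicity_le_1[OF L(2) ne(2)])+
      then show "multiplicity_of q ((-1) ^ r) (a i) \<le> 1" using i by auto
    qed
  next
    fix i assume t: "T \<le> a i"
    have T0: "0 \<le> T" by (simp add: T_def)
    have "sqrt T \<le> sqrt (a i)" using t by simp
    then have "real N * pi - 3/2 \<le> sqrt (a i)" using Np by (simp add: T_def)
    then obtain n where "n \<ge> N" "even n = even r" "sqrt (a i) = km n \<or> sqrt (a i) = kp n"
      using eigenvalue_is_edge[OF N a r, of "a i" "sqrt (a i)"] t T0 by auto
    moreover have "a i = (sqrt (a i))\<^sup>2" using t T0 by simp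
    ultimately show "\<exists>n\<ge>N. even n = even r \<and> (a i = (km n)\<^sup>2 \<or> a i = (kp n)\<^sup>2)" by metis
  next
    fix n m assume nm: "N \<le> n" "n < m" "even n = even r" "even m = even r"
    have "m \<ge> n + 2" using nm by (metis Suc_leI add_2_eq_Suc' even_Suc le_neq_implies_less)
    then have "real (n + 2) \<le> real m" by (simp only: of_nat_le_iff)
    then have "real (n + 2) * pi \<le> real m * pi" by (intro mult_right_mono) auto
    then have mp: "real n * pi + 5 \<le> km m"
      using pi_gt3 edge_pairD(1)[OF far, of m] nm by (simp add: algebra_simps)
    have "(kp n)\<^sup>2 + 1 \<le> (real n * pi + 1)\<^sup>2 + 1"
      using edge_pairD(3)[OF far[OF nm(1)]] edge_large[OF far[OF nm(1)]] by (intro add_right_mono power_mono) auto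
    also have "\<dots> \<le> (real n * pi + 5)\<^sup>2" by (simp add: power2_eq_square algebra_simps)
    also have "\<dots> \<le> (km m)\<^sup>2" using mp by (intro power_mono) auto
    finally show "(kp n)\<^sup>2 + 1 \<le> (km m)\<^sup>2" .
  qed auto
qed

section \<open>Asymptotic expansion of the monodromy\<close>

text \<open>
  The oscillating integral from which \<open>alpha\<close> and \<open>beta\<close> are built to leading order.
\<close>

definition G :: "real \<Rightarrow> real \<Rightarrow> complex" where
  "G k x = integral {0..x} (\<lambda>t. of_real (q t) * cis (- (2 * theta k t)))"

definition Gsup :: "real \<Rightarrow> real" where "Gsup k = (SUP x\<in>{0..1}. norm (G k x))"

lemma G_L1: "(\<lambda>t. of_real (q t) * cis (- (2 * theta k t))) absolutely_integrable_on {0..1}"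
  by (intro L1_mult_of_real_continuous q_L1 cis_continuous continuous_intros theta_continuous)

lemma G_primitive: "primitive_of (G k) (\<lambda>t. of_real (q t) * cis (- (2 * theta k t)))"
  using primitive_integral[OF G_L1, of 0 k] by (simp add: G_def[abs_def])

lemma G_le_mass: "0 \<le> x \<Longrightarrow> x \<le> 1 \<Longrightarrow> norm (G k x) \<le> mass"
  unfolding G_def using norm_integral_le_L1[OF q_L1 G_L1[of k], where M = 1 and a = 0 and b = x] by (simp add: mass_def norm_mult)

lemma G_le_Gsup: "0 \<le> x \<Longrightarrow> x \<le> 1 \<Longrightarrow> norm (G k x) \<le> Gsup k"
  unfolding Gsup_def by (rule cSUP_upper) (auto intro!: bdd_aboveI2[where M = mass] G_le_mass)

lemma Gsup_nonneg: "Gsup k \<ge> 0"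
  using G_le_Gsup[of 0 k] norm_ge_zero[of "G k 0"] by linarith

lemma integral_diff_L1_bound:
  fixes u v :: "real \<Rightarrow> complex"
  assumes u: "continuous_on {0..1} u" and v: "continuous_on {0..1} v" and x: "0 \<le> x" "x \<le> 1"
    and le: "\<And>t. 0 \<le> t \<Longrightarrow> t \<le> 1 \<Longrightarrow> norm (u t - v t) \<le> M"
  shows "norm (integral {0..x} (\<lambda>t. of_real (q t) * u t) - integral {0..x} (\<lambda>t. of_real (q t) * v t)) \<le> M * mass"
proof -
  have uv: "(\<lambda>t. of_real (q t) * (u t - v t)) absolutely_integrable_on {0..1}"
    by (intro L1_mult_of_real_continuous q_L1 continuous_intros u v)
  have "integral {0..x} (\<lambda>t. of_real (q t) * u t) - integral {0..x} (\<lambda>t. of_real (q t) * v t)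
      = integral {0..x} (\<lambda>t. of_real (q t) * (u t - v t))"
    unfolding right_diff_distrib
    by (rule hk_integral_diff[symmetric])
      (use x in \<open>auto intro!: L1_integrable L1_mult_of_real_continuous q_L1 u v\<close>)
  also have "norm \<dots> \<le> M * integral {0..1} (\<lambda>t. norm (q t))"
  proof (rule norm_integral_le_L1[OF q_L1 uv])
    show "norm (of_real (q t) * (u t - v t)) \<le> M * norm (q t)" if "0 \<le> t" "t \<le> 1" for t
      using mult_left_mono[OF le[OF that], of "\<bar>q t\<bar>"] by (simp add: norm_mult mult.commute)
    show "0 \<le> M" using le[of 0] norm_ge_zero[of "u 0 - v 0"] by linarith
  qed (use x in auto)
  finally show ?thesis by (simp add: mass_def)
qed

text \<open>
  The correction \<open>q1 / k\<close> of the phase is negligible, and the pure oscillation is handled by the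
  Riemann-Lebesgue lemma, which is uniform in the upper limit.
\<close>

lemma Gsup_tendsto_0: "(Gsup \<longlongrightarrow> 0) at_top"
proof (rule tendstoI)
  fix e :: real assume e: "e > 0"
  obtain K where K: "K > 0" "\<And>k x. k \<ge> K \<Longrightarrow> x \<in> {0..1} \<Longrightarrow> norm (integral {0..x} (\<lambda>t. of_real (q t) * cis (- (2 * k * t)))) \<le> e / 4"
    using riemann_lebesgue[OF q_L1, of "e / 4"] e by auto
  define K' where "K' = max K (4 * mass * mass / e + 1)"
  have "dist (Gsup k) 0 < e" if k: "k \<ge> K'" for k
  proof -
    have k0: "k > 0" "k \<ge> K" "k \<ge> 4 * mass * mass / e + 1" using k K by (auto simp: K'_def)
    have "norm (G k x) \<le> e / 2" if x: "0 \<le> x" "x \<le> 1" for x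
    proof -
      have "norm (G k x - integral {0..x} (\<lambda>t. of_real (q t) * cis (- (2 * k * t)))) \<le> (mass / k) * mass"
        unfolding G_def
      proof (intro integral_diff_L1_bound cis_continuous continuous_intros theta_continuous x)
        fix t :: real assume t: "0 \<le> t" "t \<le> 1"
        have "norm (cis (- (2 * theta k t)) - cis (- (2 * k * t))) \<le> \<bar>- (2 * theta k t) - - (2 * k * t)\<bar>"
          by (rule norm_cis_diff_le)
        also have "\<dots> = \<bar>q1 t\<bar> / k" using k0 by (simp add: theta_def)
        also have "\<dots> \<le> mass / k" using q1_le[OF t] k0 by (intro divide_right_mono) auto
        finally show "norm (cis (- (2 * theta k t)) - cis (- (2 * k * t))) \<le> mass / k" .
      qed
      also have "\<dots> \<le> e / 4"
      proof -
        have "4 * mass * mass \<le> e * k" using k0(3) e by (simp add: field_simps)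
        then show ?thesis using k0 by (simp add: field_simps)
      qed
      finally show ?thesis using K(2)[OF k0(2), of x] x
          norm_triangle_sub[of "G k x" "integral {0..x} (\<lambda>t. of_real (q t) * cis (- (2 * k * t)))"] by simp
    qed
    then have "Gsup k \<le> e / 2" unfolding Gsup_def by (intro cSUP_least) auto
    then show ?thesis using Gsup_nonneg[of k] e by simp
  qed
  then show "\<forall>\<^sub>F k in at_top. dist (Gsup k) 0 < e"
    unfolding eventually_at_top_linorder by blast
qed

abbreviation second_order :: "real \<Rightarrow> complex" where
  "second_order k \<equiv> integral {0..1} (\<lambda>t. of_real (q t) * cis (- (2 * theta k t)) * cnj (G k t))"

lemma expansion:
  assumes k: "1 + mass \<le> k"
  shows "norm (beta k 1) \<le> 3 * Gsup k / (2 * k)"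
    "norm (alpha k 1 - 1) \<le> 3 * Gsup k * mass / (4 * k\<^sup>2)"
    "norm (beta k 1 - \<i> / of_real (2 * k) * G k 1) \<le> 3 * Gsup k * mass\<^sup>2 / (8 * k ^ 3)"
    "norm (alpha k 1 - 1 - second_order k / of_real (4 * k\<^sup>2))
       \<le> 3 * Gsup k * mass ^ 3 / (16 * k ^ 4)"
proof -
  note g = gam_small[OF k]
  have ig: "integral {0..x} (gam k) = \<i> / of_real (2 * k) * G k x" for x
  proof -
    have "gam k = (\<lambda>t. \<i> / of_real (2 * k) * (of_real (q t) * cis (- (2 * theta k t))))"
      by (simp add: gam_def fun_eq_iff)
    then show ?thesis unfolding G_def by simp
  qed
  have \<eta>: "norm (integral {0..x} (gam k)) \<le> Gsup k / (2 * k)" if "0 \<le> x" "x \<le> 1" for x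
    using G_le_Gsup[OF that] g(1) unfolding ig by (simp add: norm_mult norm_divide divide_right_mono)
  note E = volterra_pair_expansion[OF gam_L1 refl g(2) alpha_beta[OF k] \<eta> zero_le_one order_refl]
  note E' = E[unfolded integral_norm_gam[OF g(1)]]
  show "norm (beta k 1) \<le> 3 * Gsup k / (2 * k)" using E'(1) by simp
  show "norm (alpha k 1 - 1) \<le> 3 * Gsup k * mass / (4 * k\<^sup>2)" using E'(2) by (simp add: power2_eq_square)
  show "norm (beta k 1 - \<i> / of_real (2 * k) * G k 1) \<le> 3 * Gsup k * mass\<^sup>2 / (8 * k ^ 3)"
    using E'(3) unfolding ig by (simp add: power2_eq_square power3_eq_cube mult_ac)
  have "(\<lambda>t. gam k t * cnj (\<i> / of_real (2 * k) * G k t))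
     = (\<lambda>t. (1 / of_real (4 * k\<^sup>2)) * (of_real (q t) * cis (- (2 * theta k t)) * cnj (G k t)))"
    using g(1) by (simp add: gam_def fun_eq_iff power2_eq_square field_simps)
  then have "integral {0..1} (\<lambda>t. gam k t * cnj (\<i> / of_real (2 * k) * G k t))
     = (1 / of_real (4 * k\<^sup>2)) * integral {0..1} (\<lambda>t. of_real (q t) * cis (- (2 * theta k t)) * cnj (G k t))"
    by simp
  then show "norm (alpha k 1 - 1 - second_order k / of_real (4 * k\<^sup>2))
       \<le> 3 * Gsup k * mass ^ 3 / (16 * k ^ 4)"
    using E'(4) unfolding ig by (simp add: power3_eq_cube power4_eq_xxxx mult_ac)
qed

lemma abs_le_2_abs_sin:
  fixes x :: real
  assumes "\<bar>x\<bar> \<le> 1" shows "\<bar>x\<bar> \<le> 2 * \<bar>sin x\<bar>"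
  using sin_diff_ge[of 0 x] sin_diff_ge[of x 0] assms by (cases "x \<ge> 0") auto

text \<open>
  At an eigenvalue \<open>|Im A| = |B|\<close>. Both \<open>beta\<close> and \<open>alpha - 1\<close> are small, so the phase must be close to a
  multiple of \<open>\<pi>\<close>.
\<close>

lemma eigenvalue_phase:
  assumes k: "1 + mass \<le> k" and e: "(-1) ^ n * Re (A k) = 1"
  shows "\<bar>sin (theta k 1 - real n * pi)\<bar> \<le> norm (beta k 1) + norm (alpha k 1 - 1)"
    "\<bar>Im (cis (theta k 1 - real n * pi) * alpha k 1)\<bar> = norm (beta k 1)"
proof -
  define s where "s = (-1::real) ^ n"
  have s: "s * s = 1" by (simp add: s_def power_mult_distrib[symmetric])
  have a: "of_real s * A k = cis (theta k 1 - real n * pi) * alpha k 1"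
    unfolding A_def cis_minus_nat_pi s_def by simp
  have "(s * Re (A k))\<^sup>2 + (s * Im (A k))\<^sup>2 = (s * s) * (norm (A k))\<^sup>2"
    unfolding cmod_power2 by (simp add: power2_eq_square algebra_simps)
  also have "\<dots> = 1 + (norm (B k))\<^sup>2" using A_B_conserved[OF k] s by simp
  finally have "(s * Im (A k))\<^sup>2 = (norm (B k))\<^sup>2" using e by (simp add: s_def)
  then have "\<bar>s * Im (A k)\<bar> = norm (B k)" unfolding power2_eq_iff by auto
  moreover have "Im (of_real s * A k) = s * Im (A k)" by simp
  moreover have "norm (B k) = norm (beta k 1)" by (simp add: B_def norm_mult)
  ultimately show 1: "\<bar>Im (cis (theta k 1 - real n * pi) * alpha k 1)\<bar> = norm (beta k 1)" unfolding a by simp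
  let ?c = "cis (theta k 1 - real n * pi)"
  have "sin (theta k 1 - real n * pi) = Im (?c * alpha k 1) - Im (?c * (alpha k 1 - 1))"
    by (simp add: algebra_simps)
  moreover have "\<bar>Im (?c * (alpha k 1 - 1))\<bar> \<le> norm (alpha k 1 - 1)"
    using abs_Im_le_cmod[of "?c * (alpha k 1 - 1)"] by (simp add: norm_mult)
  ultimately show "\<bar>sin (theta k 1 - real n * pi)\<bar> \<le> norm (beta k 1) + norm (alpha k 1 - 1)" using 1 by linarith
qed

text \<open>
  At \<open>k = n \<pi>\<close> the phase differs from \<open>n \<pi>\<close> by \<open>q1 1 / (2 k)\<close>, which \<open>eigenvalue_phase\<close> bounds by
  \<open>o(1/k)\<close>.
\<close>

lemma mean_zero:
  assumes inf: "\<And>M::nat. \<exists>n\<ge>M. (-1) ^ n * Re (A (real n * pi)) = 1"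
  shows "q1 1 = 0"
proof -
  have "\<bar>q1 1\<bar> \<le> 0"
  proof (rule field_le_epsilon)
    fix e :: real assume e: "e > 0"
    \<comment> \<open>C collects the bound 2 (3 G / 2k + 3 G mass / 4k) for q1 1 / 2k, where G stands for Gsup k.\<close>
    define C where "C = 6 + 3 * mass"
    have C: "C > 0" using mass_nonneg by (simp add: C_def)
    have "\<forall>\<^sub>F k in at_top. Gsup k < e / C"
      using Gsup_tendsto_0 by (rule order_tendstoD) (use e C in auto)
    then obtain K where K: "\<And>k. k \<ge> K \<Longrightarrow> Gsup k < e / C" unfolding eventually_at_top_linorder by blast
    obtain M :: nat where M: "real M \<ge> max K (1 + mass)" using real_arch_simple by blast
    obtain n where n: "n \<ge> M" "(-1) ^ n * Re (A (real n * pi)) = 1" using inf by blast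
    define k where "k = real n * pi"
    have "real n * pi \<ge> real n * 1" using pi_ge_two by (intro mult_left_mono) auto
    then have k: "k \<ge> K" "k \<ge> 1 + mass" using M n by (auto simp: k_def)
    then have k1: "k \<ge> 1" "k > 0" using mass_nonneg by auto
    have th: "theta k 1 - k = - q1 1 / (2 * k)" by (simp add: theta_def k_def)
    have "\<bar>- q1 1 / (2 * k)\<bar> \<le> 2 * \<bar>sin (- q1 1 / (2 * k))\<bar>"
    proof (rule abs_le_2_abs_sin)
      have "\<bar>q1 1\<bar> \<le> 2 * k" using q1_le[of 1] k k1 by auto
      then show "\<bar>- q1 1 / (2 * k)\<bar> \<le> 1" using k1 by simp
    qed
    also have "\<dots> \<le> 2 * (norm (beta k 1) + norm (alpha k 1 - 1))"
      using eigenvalue_phase(1)[OF k(2), of n] n unfolding k_def[symmetric] th by simp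
    also have "\<dots> \<le> 2 * (3 * Gsup k / (2 * k) + 3 * Gsup k * mass / (4 * k))"
    proof -
      have "3 * Gsup k * mass / (4 * k\<^sup>2) \<le> 3 * Gsup k * mass / (4 * k)"
        using k1 Gsup_nonneg[of k] mass_nonneg by (intro divide_left_mono) (auto simp: power2_eq_square)
      then show ?thesis
        by (intro mult_left_mono add_mono expansion(1)[OF k(2)] order_trans[OF expansion(2)[OF k(2)]]) auto
    qed
    finally have "\<bar>q1 1\<bar> / (2 * k) \<le> (C * Gsup k) / (2 * k)"
      using k1 by (simp add: C_def field_simps)
    then have "\<bar>q1 1\<bar> \<le> C * Gsup k" using k1 by (simp add: divide_le_cancel)
    also have "\<dots> \<le> C * (e / C)" using K[OF k(1)] C by (intro mult_left_mono) auto
    finally show "\<bar>q1 1\<bar> \<le> 0 + e" using C by simp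
  qed
  then show ?thesis by simp
qed

end

lemma tendsto_0_le_const:
  fixes f g :: "nat \<Rightarrow> real"
  assumes g: "g \<longlonglongrightarrow> 0" and le: "\<forall>\<^sub>F n in sequentially. \<bar>f n\<bar> \<le> C * g n"
  shows "f \<longlonglongrightarrow> 0"
proof (rule Lim_null_comparison)
  show "\<forall>\<^sub>F n in sequentially. norm (f n) \<le> C * g n" using le by simp
  show "(\<lambda>n. C * g n) \<longlonglongrightarrow> 0" using tendsto_mult_left[OF g, of C] by simp
qed

context L1_potential
begin

text \<open>
  The instability intervals have length \<open>o(n\<^sup>-\<^sup>2)\<close>, expressed by the edges near \<open>n \<pi>\<close>.
\<close>

definition small_gaps :: bool where
  "small_gaps \<longleftrightarrow> (\<forall>e>0. \<exists>M. \<forall>n\<ge>M. (kp n)\<^sup>2 - (km n)\<^sup>2 \<le> e / (real n)\<^sup>2)"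

lemma eventually_far: "\<forall>\<^sub>F n in sequentially. far n"
proof -
  obtain N where "far N" using far_exists by blast
  then show ?thesis using far_mono unfolding eventually_sequentially by blast
qed

lemma edge_size:
  assumes "far n"
  shows "real n \<le> km n" "real n \<le> kp n" "kp n \<le> 5 * real n" "real n \<ge> 1" "real n * pi \<le> 4 * real n"
proof -
  note D = edge_pairD(1-3)[OF assms]
  have n1: "real n \<ge> 1"
  proof (cases "n = 0")
    case True
    then show ?thesis using assms mass_nonneg unfolding far_def by simp
  qed simp
  have "real n * 3 \<le> real n * pi" using pi_gt3 by (intro mult_left_mono) auto
  moreover show "real n * pi \<le> 4 * real n" using pi_less_4 mult_left_mono[of pi 4 "real n"] by (simp add: mult.commute)
  ultimately show "real n \<le> km n" "real n \<le> kp n" "kp n \<le> 5 * real n" using D n1 by linarith+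
  show "real n \<ge> 1" by fact
qed

text \<open>
  \<open>kp\<^sup>2 - km\<^sup>2\<close> is at least \<open>n (kp - km)\<close>, and \<open>kp - km\<close> bounds \<open>B\<close> at the edges.
\<close>

lemma n_cubed_B_edges:
  assumes gaps: small_gaps
  shows "(\<lambda>n. real n ^ 3 * (norm (B (km n)) + norm (B (kp n)))) \<longlonglongrightarrow> 0"
proof (rule tendstoI)
  fix e :: real assume e: "e > 0"
  obtain M where M: "\<And>n. n \<ge> M \<Longrightarrow> (kp n)\<^sup>2 - (km n)\<^sup>2 \<le> (e / 4) / (real n)\<^sup>2"
    using gaps e unfolding small_gaps_def by (meson divide_pos_pos zero_less_numeral)
  show "\<forall>\<^sub>F n in sequentially. dist (real n ^ 3 * (norm (B (km n)) + norm (B (kp n)))) 0 < e"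
    using eventually_far eventually_ge_at_top[of M]
  proof eventually_elim
    case (elim n)
    note D = edge_pairD(2,5)[OF elim(1)] and S = edge_size[OF elim(1)]
    have "real n * (kp n - km n) \<le> (kp n + km n) * (kp n - km n)"
      using D S by (intro mult_right_mono) auto
    also have "\<dots> = (kp n)\<^sup>2 - (km n)\<^sup>2" by (simp add: power2_eq_square algebra_simps)
    also have "\<dots> \<le> (e / 4) / (real n)\<^sup>2" using M elim by blast
    finally have "(real n)\<^sup>2 * (real n * (kp n - km n)) \<le> (real n)\<^sup>2 * ((e / 4) / (real n)\<^sup>2)"
      by (rule mult_left_mono) auto
    then have 1: "real n ^ 3 * (kp n - km n) \<le> e / 4" using S(4) by (simp add: power2_eq_square power3_eq_cube mult.assoc)
    have "real n ^ 3 * (norm (B (km n)) + norm (B (kp n))) \<le> real n ^ 3 * (2 * (kp n - km n))"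
      using D(2) by (intro mult_left_mono) auto
    also have "\<dots> = 2 * (real n ^ 3 * (kp n - km n))" by simp
    also have "\<dots> < e" using 1 e by linarith
    finally have "real n ^ 3 * (norm (B (km n)) + norm (B (kp n))) < e" .
    moreover have "real n ^ 3 * (norm (B (km n)) + norm (B (kp n))) \<ge> 0" by simp
    ultimately show ?case by simp
  qed
qed

lemma kp_at_top: "filterlim kp at_top sequentially"
proof (rule filterlim_at_top_mono[OF filterlim_real_sequentially])
  show "\<forall>\<^sub>F n in sequentially. real n \<le> kp n" using eventually_far by eventually_elim (rule edge_size)
qed

lemma Gsup_kp: "(\<lambda>n. Gsup (kp n)) \<longlonglongrightarrow> 0"
  using filterlim_compose[OF Gsup_tendsto_0 kp_at_top] by (simp add: o_def)

lemma kp_eigen: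
  assumes "far n" shows "(-1) ^ n * Re (A (kp n)) = 1"
  using edge_pairD(1-3)[OF assms] edge_pairD(4)[OF assms, of "kp n"] by auto

text \<open>
  \<open>beta\<close> equals \<open>i G / (2 k)\<close> up to \<open>o(k\<^sup>-\<^sup>3)\<close>.
\<close>

lemma n_squared_G_edge:
  assumes gaps: small_gaps
  shows "(\<lambda>n. (real n)\<^sup>2 * norm (G (kp n) 1)) \<longlonglongrightarrow> 0"
proof (rule tendsto_0_le_const[where C = 1])
  let ?g = "\<lambda>n. 10 * (real n ^ 3 * (norm (B (km n)) + norm (B (kp n)))) + mass\<^sup>2 * Gsup (kp n)"
  show "?g \<longlonglongrightarrow> 0"
    using tendsto_add[OF tendsto_mult_left[OF n_cubed_B_edges[OF gaps], of 10] tendsto_mult_left[OF Gsup_kp, of "mass\<^sup>2"]] by simp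
  show "\<forall>\<^sub>F n in sequentially. \<bar>(real n)\<^sup>2 * norm (G (kp n) 1)\<bar> \<le> 1 * ?g n"
    using eventually_far
  proof eventually_elim
    case (elim n)
    note S = edge_size[OF elim] and L = edge_large[OF elim]
    define k where "k = kp n"
    have k: "k \<ge> 1" "k > 0" "k \<le> 5 * real n" "real n \<le> k" using L S by (auto simp: k_def)
    have "norm (beta k 1) = norm (B k)" by (simp add: B_def norm_mult)
    moreover have "norm (beta k 1 - \<i> / of_real (2 * k) * G k 1) \<le> 3 * Gsup k * mass\<^sup>2 / (8 * k ^ 3)"
      using L(2) by (intro expansion) (simp add: k_def)
    moreover have "norm (\<i> / of_real (2 * k) * G k 1) \<le> norm (beta k 1) + norm (beta k 1 - \<i> / of_real (2 * k) * G k 1)"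
      by (metis norm_minus_commute norm_triangle_sub)
    moreover have "norm (\<i> / of_real (2 * k) * G k 1) = norm (G k 1) / (2 * k)"
      using k by (simp add: norm_mult norm_divide)
    ultimately have "norm (G k 1) / (2 * k) \<le> norm (B k) + 3 * Gsup k * mass\<^sup>2 / (8 * k ^ 3)" by linarith
    then have "2 * k * (norm (G k 1) / (2 * k)) \<le> 2 * k * (norm (B k) + 3 * Gsup k * mass\<^sup>2 / (8 * k ^ 3))"
      using k by (intro mult_left_mono) auto
    moreover have "2 * k * (norm (G k 1) / (2 * k)) = norm (G k 1)" using k by simp
    moreover have "2 * k * (norm (B k) + 3 * Gsup k * mass\<^sup>2 / (8 * k ^ 3)) = 2 * k * norm (B k) + 3 * Gsup k * mass\<^sup>2 / (4 * k\<^sup>2)"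
      using k(2) by (simp add: distrib_left power2_eq_square power3_eq_cube)
    ultimately have "norm (G k 1) \<le> 2 * k * norm (B k) + 3 * Gsup k * mass\<^sup>2 / (4 * k\<^sup>2)" by simp
    then have "(real n)\<^sup>2 * norm (G k 1) \<le> (real n)\<^sup>2 * (2 * k * norm (B k)) + (real n)\<^sup>2 * (3 * Gsup k * mass\<^sup>2 / (4 * k\<^sup>2))"
      by (metis distrib_left mult_left_mono zero_le_power2)
    also have "(real n)\<^sup>2 * (2 * k * norm (B k)) \<le> (real n)\<^sup>2 * (2 * (5 * real n) * norm (B k))"
      using k by (intro mult_left_mono mult_right_mono) auto
    also have "(real n)\<^sup>2 * (3 * Gsup k * mass\<^sup>2 / (4 * k\<^sup>2)) \<le> k\<^sup>2 * (3 * Gsup k * mass\<^sup>2 / (4 * k\<^sup>2))"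
      using k Gsup_nonneg[of k] by (intro mult_right_mono power_mono) auto
    also have "\<dots> = 3/4 * (mass\<^sup>2 * Gsup k)" using k by (simp add: power2_eq_square)
    also have "\<dots> \<le> mass\<^sup>2 * Gsup k" using Gsup_nonneg[of k] by simp
    finally have "(real n)\<^sup>2 * norm (G k 1) \<le> 10 * (real n ^ 3 * norm (B k)) + mass\<^sup>2 * Gsup k"
      by (simp add: power2_eq_square power3_eq_cube mult_ac)
    moreover have "real n ^ 3 * norm (B k) \<le> real n ^ 3 * (norm (B (km n)) + norm (B k))"
      by (intro mult_left_mono) auto
    ultimately show ?case unfolding k_def[symmetric] by simp
  qed
qed

text \<open>
  \<open>k - n \<pi>\<close> is bounded by \<open>|B| + |alpha - 1|\<close>, and \<open>alpha - 1 = o(k\<^sup>-\<^sup>2)\<close>.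
\<close>

lemma n_squared_edge_shift:
  assumes gaps: small_gaps and mean: "q1 1 = 0"
  shows "(\<lambda>n. (real n)\<^sup>2 * \<bar>kp n - real n * pi\<bar>) \<longlonglongrightarrow> 0"
proof (rule tendsto_0_le_const[where C = 2])
  let ?g = "\<lambda>n. (real n ^ 3 * (norm (B (km n)) + norm (B (kp n)))) + mass * Gsup (kp n)"
  show "?g \<longlonglongrightarrow> 0"
    using tendsto_add[OF n_cubed_B_edges[OF gaps] tendsto_mult_left[OF Gsup_kp, of "mass"]] by simp
  show "\<forall>\<^sub>F n in sequentially. \<bar>(real n)\<^sup>2 * \<bar>kp n - real n * pi\<bar>\<bar> \<le> 2 * ?g n"
    using eventually_far
  proof eventually_elim
    case (elim n)
    note S = edge_size[OF elim] and L = edge_large[OF elim]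
    define k where "k = kp n"
    have k: "k \<ge> 1" "k > 0" "real n \<le> k" "1 + mass \<le> k" using L S by (auto simp: k_def)
    have th: "theta k 1 = k" using mean by (simp add: theta_def)
    have "\<bar>k - real n * pi\<bar> \<le> 2 * \<bar>sin (k - real n * pi)\<bar>"
      using edge_pairD(1-3)[OF elim] by (intro abs_le_2_abs_sin) (auto simp: k_def)
    also have "\<dots> \<le> 2 * (norm (beta k 1) + norm (alpha k 1 - 1))"
      using eigenvalue_phase(1)[OF k(4), of n, unfolded th] kp_eigen[OF elim, folded k_def] by simp
    also have "\<dots> \<le> 2 * (norm (B k) + 3 * Gsup k * mass / (4 * k\<^sup>2))"
      using expansion(2)[OF k(4)] by (intro mult_left_mono add_mono) (auto simp: B_def norm_mult)
    finally have "(real n)\<^sup>2 * \<bar>k - real n * pi\<bar> \<le> (real n)\<^sup>2 * (2 * (norm (B k) + 3 * Gsup k * mass / (4 * k\<^sup>2)))"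
      by (rule mult_left_mono) auto
    also have "\<dots> = 2 * ((real n)\<^sup>2 * norm (B k) + (real n)\<^sup>2 * (3 * Gsup k * mass / (4 * k\<^sup>2)))"
      by (simp add: algebra_simps)
    also have "(real n)\<^sup>2 * (3 * Gsup k * mass / (4 * k\<^sup>2)) \<le> k\<^sup>2 * (3 * Gsup k * mass / (4 * k\<^sup>2))"
      using k Gsup_nonneg[of k] mass_nonneg by (intro mult_right_mono power_mono) auto
    also have "\<dots> = 3/4 * (mass * Gsup k)" using k by (simp add: power2_eq_square)
    also have "\<dots> \<le> mass * Gsup k" using Gsup_nonneg[of k] mass_nonneg by simp
    also have "(real n)\<^sup>2 * norm (B k) \<le> real n ^ 3 * (norm (B (km n)) + norm (B k))"
      using S(4) by (intro mult_mono power_increasing) auto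
    finally show ?case unfolding k_def[symmetric] by simp
  qed
qed

text \<open>
  \<open>G k 1\<close> with \<open>k\<close> replaced by \<open>n \<pi>\<close>; the edges approach \<open>n \<pi>\<close> so fast that the difference is \<open>o(n\<^sup>-\<^sup>2)\<close>.
\<close>

definition mid_coeff :: "nat \<Rightarrow> complex" where
  "mid_coeff n = integral {0..1} (\<lambda>t. of_real (q t) * (cis (- (2 * pi * real n * t)) * cis (q1 t / (real n * pi))))"

lemma n_squared_mid_coeff:
  assumes gaps: small_gaps and mean: "q1 1 = 0"
  shows "(\<lambda>n. (real n)\<^sup>2 * norm (mid_coeff n)) \<longlonglongrightarrow> 0"
proof (rule tendsto_0_le_const[where C = 1])
  let ?g = "\<lambda>n. (real n)\<^sup>2 * norm (G (kp n) 1) + (2 + mass) * mass * ((real n)\<^sup>2 * \<bar>kp n - real n * pi\<bar>)"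
  show "?g \<longlonglongrightarrow> 0"
    using tendsto_add[OF n_squared_G_edge[OF gaps] tendsto_mult_left[OF n_squared_edge_shift[OF gaps mean], of "(2 + mass) * mass"]] by simp
  show "\<forall>\<^sub>F n in sequentially. \<bar>(real n)\<^sup>2 * norm (mid_coeff n)\<bar> \<le> 1 * ?g n"
    using eventually_far
  proof eventually_elim
    case (elim n)
    note S = edge_size[OF elim] and L = edge_large[OF elim]
    define k where "k = kp n"
    define \<kappa> where "\<kappa> = real n * pi"
    have k: "k \<ge> 1" using L by (auto simp: k_def)
    have kap: "\<kappa> \<ge> 1" using S(4) pi_ge_two mult_mono[of 1 "real n" 1 pi] by (simp add: \<kappa>_def)
    have "norm (mid_coeff n - G k 1) \<le> ((2 + mass) * \<bar>k - \<kappa>\<bar>) * mass"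
      unfolding mid_coeff_def G_def
    proof (intro integral_diff_L1_bound cis_continuous continuous_intros theta_continuous)
      fix t :: real assume t: "0 \<le> t" "t \<le> 1"
      have "cis (- (2 * pi * real n * t)) * cis (q1 t / (real n * pi)) = cis (- (2 * \<kappa> * t) + q1 t / \<kappa>)"
        by (simp add: cis_mult \<kappa>_def mult_ac)
      also have "norm (\<dots> - cis (- (2 * theta k t))) \<le> \<bar>- (2 * \<kappa> * t) + q1 t / \<kappa> - - (2 * theta k t)\<bar>"
        by (rule norm_cis_diff_le)
      also have "- (2 * \<kappa> * t) + q1 t / \<kappa> - - (2 * theta k t) = 2 * (k - \<kappa>) * t + q1 t * ((k - \<kappa>) / (\<kappa> * k))"
        using k kap by (simp add: theta_def field_simps)
      also have "\<bar>\<dots>\<bar> \<le> \<bar>2 * (k - \<kappa>) * t\<bar> + \<bar>q1 t * ((k - \<kappa>) / (\<kappa> * k))\<bar>" by (rule abs_triangle_ineq)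
      also have "\<bar>2 * (k - \<kappa>) * t\<bar> \<le> 2 * \<bar>k - \<kappa>\<bar>" using t unfolding abs_mult by (simp add: mult_left_le)
      also have "\<bar>q1 t * ((k - \<kappa>) / (\<kappa> * k))\<bar> \<le> mass * \<bar>k - \<kappa>\<bar>"
      proof -
        have "1 * 1 \<le> \<kappa> * k" using k kap by (intro mult_mono) auto
        then have "\<bar>k - \<kappa>\<bar> / (\<kappa> * k) \<le> \<bar>k - \<kappa>\<bar> / 1" by (intro divide_left_mono) auto
        then show ?thesis using q1_le[OF t] k kap unfolding abs_mult abs_divide
          by (intro mult_mono) auto
      qed
      finally show "norm (cis (- (2 * pi * real n * t)) * cis (q1 t / (real n * pi)) - cis (- (2 * theta k t))) \<le> (2 + mass) * \<bar>k - \<kappa>\<bar>"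
        by (simp add: algebra_simps)
    qed (use S(4) in auto)
    then have "norm (mid_coeff n) \<le> norm (G k 1) + (2 + mass) * mass * \<bar>k - \<kappa>\<bar>"
      using norm_triangle_sub[of "mid_coeff n" "G k 1"] by (simp add: mult_ac)
    then have "(real n)\<^sup>2 * norm (mid_coeff n) \<le> (real n)\<^sup>2 * (norm (G k 1) + (2 + mass) * mass * \<bar>k - \<kappa>\<bar>)"
      by (rule mult_left_mono) auto
    then show ?case unfolding k_def \<kappa>_def by (simp add: algebra_simps)
  qed
qed

end

section \<open>Fourier coefficients of the Riccati transform\<close>

lemma riemann_lebesgue_nat:
  fixes f :: "real \<Rightarrow> real"
  assumes f: "f absolutely_integrable_on {0..1}" and e: "e > 0"
  shows "\<exists>M. \<forall>n\<ge>M. \<forall>x\<in>{0..1}. norm (integral {0..x} (\<lambda>t. of_real (f t) * cis (- (2 * pi * real n * t)))) \<le> e"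
proof -
  obtain K where K: "\<And>k x. k \<ge> K \<Longrightarrow> x \<in> {0..1} \<Longrightarrow> norm (integral {0..x} (\<lambda>t. of_real (f t) * cis (- (2 * k * t)))) \<le> e"
    using riemann_lebesgue[OF f e] by blast
  obtain M :: nat where M: "real M \<ge> K" using real_arch_simple by blast
  have "norm (integral {0..x} (\<lambda>t. of_real (f t) * cis (- (2 * pi * real n * t)))) \<le> e" if "n \<ge> M" "x \<in> {0..1}" for n x
  proof -
    have "real n * 1 \<le> real n * pi" using pi_ge_two by (intro mult_left_mono) auto
    then have "real n * pi \<ge> K" using M that(1) by (smt (verit) of_nat_le_iff mult.right_neutral)
    from K[OF this that(2)] show ?thesis by (simp add: mult_ac)
  qed
  then show ?thesis by blast
qed

lemma norm_cis_taylor_2: "norm (cis t - (1 + \<i> * of_real t - of_real (t\<^sup>2) / 2)) \<le> \<bar>t\<bar> ^ 3"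
proof -
  have "norm (exp (\<i> * of_real t) - (\<Sum>i\<le>2. (\<i> * of_real t) ^ i / fact i)) \<le> exp \<bar>Re (\<i> * of_real t)\<bar> * norm (\<i> * of_real t) ^ Suc 2 / fact 2"
    by (rule Taylor_exp)
  also have "\<dots> = \<bar>t\<bar> ^ 3 / 2" by (simp add: norm_mult fact_numeral eval_nat_numeral)
  also have "\<dots> \<le> \<bar>t\<bar> ^ 3" by simp
  finally show ?thesis
    by (simp add: cis_conv_exp numeral_2_eq_2 power2_eq_square algebra_simps)
qed

context L1_potential
begin

lemma integral_q1_squared_cis:
  assumes x: "0 \<le> x" "x \<le> 1"
  shows "\<i> * of_real (2 * pi * real n) * integral {0..x} (\<lambda>t. of_real ((q1 t)\<^sup>2) * cis (- (2 * pi * real n * t)))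
      = 2 * integral {0..x} (\<lambda>t. of_real (q t * q1 t) * cis (- (2 * pi * real n * t)))
        - of_real ((q1 x)\<^sup>2) * cis (- (2 * pi * real n * x))"
proof -
  let ?w = "2 * pi * real n"
  let ?e = "\<lambda>t. cis (- (?w * t))"
  have ec: "continuous_on {0..1} ?e" by (intro cis_continuous continuous_intros)
  have E: "primitive_of ?e (\<lambda>t. - (\<i> * of_real ?w) * ?e t)"
    using primitive_cis_linear[of "- ?w"] by simp
  have i1: "(\<lambda>t. of_real (q t * q1 t) * ?e t) integrable_on {0..x}"
    by (rule L1_integrable[OF L1_mult_of_real_continuous[OF L1_mult_real_continuous[OF q_L1 q1_continuous] ec]]) (use x in auto)
  have c2: "continuous_on {0..1} (\<lambda>t. of_real ((q1 t)\<^sup>2) * ?e t)" by (intro continuous_intros ec)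
  have i2: "(\<lambda>t. of_real ((q1 t)\<^sup>2) * ?e t) integrable_on {0..x}"
    by (rule integrable_continuous_real, rule continuous_on_subset[OF c2]) (use x in auto)
  have "primitive_of (\<lambda>t. of_real (q1 t) * of_real (q1 t) * ?e t)
     (\<lambda>t. 2 * (of_real (q t * q1 t) * ?e t) + - (\<i> * of_real ?w) * (of_real ((q1 t)\<^sup>2) * ?e t))"
    by (rule primitive_cong[OF primitive_mult[OF primitive_mult[OF q1_primitive q1_primitive] E]])
      (auto simp: power2_eq_square algebra_simps)
  from primitive_ofD(2)[OF this x]
  have "of_real ((q1 x)\<^sup>2) * ?e x = integral {0..x} (\<lambda>t. 2 * (of_real (q t * q1 t) * ?e t) + - (\<i> * of_real ?w) * (of_real ((q1 t)\<^sup>2) * ?e t))"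
    by (simp add: power2_eq_square)
  also have "\<dots> = 2 * integral {0..x} (\<lambda>t. of_real (q t * q1 t) * ?e t) + - (\<i> * of_real ?w) * integral {0..x} (\<lambda>t. of_real ((q1 t)\<^sup>2) * ?e t)"
    by (subst hk_integral_add[OF integrable_on_mult_right[OF i1] integrable_on_mult_right[OF i2]])
      (simp only: hk_integral_mult_right)
  finally show ?thesis by (simp add: algebra_simps)
qed

text \<open>
  Expand \<open>cis (q1 / \<kappa>)\<close>, \<open>\<kappa> = n \<pi>\<close>, to second order in \<open>1 / \<kappa>\<close>. In the first-order term \<open>q q1\<close> is the
  derivative of \<open>q1\<^sup>2 / 2\<close>, and integrating by parts compensates the factor \<open>1 / \<kappa>\<close>: this term becomes minus
  the Fourier coefficient of \<open>q1\<^sup>2\<close>. The second-order term is the Fourier coefficient of a summable function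
  divided by \<open>2 \<kappa>\<^sup>2\<close>.
\<close>

lemma fourier_coeff_vs_mid_coeff:
  assumes mean: "q1 1 = 0" and n: "n \<ge> 1"
  shows "norm (integral {0..1} (\<lambda>t. of_real (q t - (q1 t)\<^sup>2) * cis (- (2 * pi * real n * t))))
    \<le> norm (mid_coeff n)
      + norm (integral {0..1} (\<lambda>t. of_real (q t * (q1 t)\<^sup>2) * cis (- (2 * pi * real n * t)))) / (2 * (real n * pi)\<^sup>2)
      + mass ^ 4 / (real n * pi) ^ 3"
proof -
  define \<kappa> where "\<kappa> = real n * pi"
  have kap: "\<kappa> > 0" using n by (simp add: \<kappa>_def)
  let ?e = "\<lambda>t. cis (- (2 * pi * real n * t))"
  have ec: "continuous_on {0..1} ?e" by (intro cis_continuous continuous_intros)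
  define I0 where "I0 = integral {0..1} (\<lambda>t. of_real (q t) * ?e t)"
  define I1 where "I1 = integral {0..1} (\<lambda>t. of_real (q t * q1 t) * ?e t)"
  define I2 where "I2 = integral {0..1} (\<lambda>t. of_real (q t * (q1 t)\<^sup>2) * ?e t)"
  define S where "S = integral {0..1} (\<lambda>t. of_real ((q1 t)\<^sup>2) * ?e t)"
  have I1: "I1 = \<i> * of_real \<kappa> * S"
    using integral_q1_squared_cis[of 1 n] mean by (simp add: I1_def S_def \<kappa>_def mult_ac)
  have i: "(\<lambda>t. of_real (q t) * ?e t) integrable_on {0..1}" "(\<lambda>t. of_real (q t * q1 t) * ?e t) integrable_on {0..1}"
      "(\<lambda>t. of_real (q t * (q1 t)\<^sup>2) * ?e t) integrable_on {0..1}" "(\<lambda>t. of_real ((q1 t)\<^sup>2) * ?e t) integrable_on {0..1}"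
    by (rule L1_integrable[OF L1_mult_of_real_continuous[OF _ ec]];
        intro q_L1 L1_mult_real_continuous continuous_intros absolutely_integrable_continuous_real order_refl)+
  let ?v = "\<lambda>t. ?e t * (1 + \<i> * of_real (q1 t / \<kappa>) - of_real ((q1 t / \<kappa>)\<^sup>2) / 2)"
  have vI: "integral {0..1} (\<lambda>t. of_real (q t) * ?v t) = I0 + \<i> / of_real \<kappa> * I1 - 1 / of_real (2 * \<kappa>\<^sup>2) * I2"
  proof -
    have split: "(\<lambda>t. of_real (q t) * ?v t) = (\<lambda>t. (of_real (q t) * ?e t + \<i> / of_real \<kappa> * (of_real (q t * q1 t) * ?e t))
        - 1 / of_real (2 * \<kappa>\<^sup>2) * (of_real (q t * (q1 t)\<^sup>2) * ?e t))"
      using kap by (simp add: fun_eq_iff field_simps power2_eq_square)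
    show ?thesis
      unfolding split I0_def I1_def I2_def
        hk_integral_diff[OF integrable_add[OF i(1) integrable_on_mult_right[OF i(2)]] integrable_on_mult_right[OF i(3)]]
        hk_integral_add[OF i(1) integrable_on_mult_right[OF i(2)]]
        hk_integral_mult_right ..
  qed
  have "norm (mid_coeff n - integral {0..1} (\<lambda>t. of_real (q t) * ?v t)) \<le> (mass / \<kappa>) ^ 3 * mass"
    unfolding mid_coeff_def
  proof (intro integral_diff_L1_bound)
    show "continuous_on {0..1} (\<lambda>t. ?e t * cis (q1 t / (real n * pi)))"
      using n by (intro continuous_intros ec cis_continuous) auto
    show "continuous_on {0..1} ?v" using kap by (intro continuous_intros ec) auto
    fix t :: real assume t: "0 \<le> t" "t \<le> 1"
    have "norm (?e t * cis (q1 t / (real n * pi)) - ?v t)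
        = norm (cis (q1 t / \<kappa>) - (1 + \<i> * of_real (q1 t / \<kappa>) - of_real ((q1 t / \<kappa>)\<^sup>2) / 2))"
      unfolding right_diff_distrib[symmetric] norm_mult \<kappa>_def by simp
    also have "\<dots> \<le> \<bar>q1 t / \<kappa>\<bar> ^ 3" by (rule norm_cis_taylor_2)
    also have "\<dots> \<le> (mass / \<kappa>) ^ 3"
      using q1_le[OF t] kap by (intro power_mono) (auto simp: divide_right_mono)
    finally show "norm (?e t * cis (q1 t / (real n * pi)) - ?v t) \<le> (mass / \<kappa>) ^ 3" .
  qed auto
  moreover have "(mass / \<kappa>) ^ 3 * mass = mass ^ 4 / \<kappa> ^ 3"
    by (simp add: power_divide power3_eq_cube power4_eq_xxxx)
  moreover have "I0 - S = integral {0..1} (\<lambda>t. of_real (q t) * ?v t) + 1 / of_real (2 * \<kappa>\<^sup>2) * I2"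
    unfolding vI I1 using kap by simp
  ultimately have "norm (mid_coeff n - ((I0 - S) - 1 / of_real (2 * \<kappa>\<^sup>2) * I2)) \<le> mass ^ 4 / \<kappa> ^ 3" by simp
  moreover have "norm (1 / of_real (2 * \<kappa>\<^sup>2) * I2) = norm I2 / (2 * \<kappa>\<^sup>2)" by (simp add: norm_mult norm_divide norm_power)
  moreover have "norm (I0 - S) \<le> norm (mid_coeff n) + norm (1 / of_real (2 * \<kappa>\<^sup>2) * I2) + norm (mid_coeff n - ((I0 - S) - 1 / of_real (2 * \<kappa>\<^sup>2) * I2))"
  proof -
    have eq: "I0 - S = mid_coeff n + 1 / of_real (2 * \<kappa>\<^sup>2) * I2 - (mid_coeff n - ((I0 - S) - 1 / of_real (2 * \<kappa>\<^sup>2) * I2))" by simp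
    have "norm (I0 - S) = norm (mid_coeff n + 1 / of_real (2 * \<kappa>\<^sup>2) * I2 - (mid_coeff n - ((I0 - S) - 1 / of_real (2 * \<kappa>\<^sup>2) * I2)))"
      by (rule arg_cong[OF eq])
    also have "\<dots> \<le> norm (mid_coeff n) + norm (1 / of_real (2 * \<kappa>\<^sup>2) * I2) + norm (mid_coeff n - ((I0 - S) - 1 / of_real (2 * \<kappa>\<^sup>2) * I2))"
      by (rule order_trans[OF norm_triangle_ineq4], rule add_right_mono, rule norm_triangle_ineq)
    finally show ?thesis .
  qed
  moreover have "integral {0..1} (\<lambda>t. of_real (q t - (q1 t)\<^sup>2) * ?e t) = I0 - S"
    unfolding I0_def S_def of_real_diff left_diff_distrib
    by (rule hk_integral_diff[OF i(1,4)])
  ultimately show ?thesis unfolding I2_def[symmetric] \<kappa>_def[symmetric] by simp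
qed

end

section \<open>Fourier series with quadratically decaying coefficients\<close>

text \<open>
  The Fourier series of a real function, with the frequencies \<open>m\<close> and \<open>- m\<close> taken together.
\<close>

definition fourier_term :: "(nat \<Rightarrow> complex) \<Rightarrow> nat \<Rightarrow> real \<Rightarrow> real" where
  "fourier_term c m x = (if m = 0 then Re (c 0) else 2 * Re (c m * cis (2 * pi * real m * x)))"

definition fourier_sum :: "(nat \<Rightarrow> complex) \<Rightarrow> real \<Rightarrow> real" where
  "fourier_sum c x = (\<Sum>m. fourier_term c m x)"

definition cis_integral :: "int \<Rightarrow> real \<Rightarrow> complex" where
  "cis_integral j x = integral {0..x} (\<lambda>t. cis (2 * pi * of_int j * t))"

lemma cis_integral_eq:
  assumes "j \<noteq> 0" "0 \<le> x" "x \<le> 1"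
  shows "cis_integral j x = (cis (2 * pi * of_int j * x) - 1) / (2 * pi * \<i> * of_int j)"
proof -
  have "\<i> * of_real (2 * pi * of_int j) * cis_integral j x = cis (2 * pi * of_int j * x) - 1"
    using primitive_ofD(2)[OF primitive_cis_linear[of "2 * pi * of_int j"] assms(2,3)] by (simp add: cis_integral_def)
  then show ?thesis using assms(1) by (simp add: field_simps)
qed

lemma cis_integral_1: "cis_integral j 1 = (if j = 0 then 1 else 0)"
  using cis_integral_eq[of j 1] by (auto simp: cis_multiple_2pi) (simp add: cis_integral_def)

text \<open>
  For the frequency \<open>j = m - n\<close> the numerator is \<open>|m|\<close>: the boundary terms of an integration by parts
  against the frequency \<open>- n\<close> describe the integral of a single Fourier mode up to an error that is
  small for \<open>m\<close> far from \<open>n\<close>.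
\<close>

lemma cis_integral_asymp:
  assumes n: "n \<ge> 1" and x: "0 \<le> x" "x \<le> 1" and j: "j \<noteq> 0"
  shows "norm (cis_integral j x - \<i> / of_real (2 * pi * real n) * (cis (2 * pi * of_int j * x) - 1))
     \<le> \<bar>of_int j + real n\<bar> / (real n * \<bar>of_int j\<bar>)"
proof -
  have "cis_integral j x - \<i> / of_real (2 * pi * real n) * (cis (2 * pi * of_int j * x) - 1)
      = (cis (2 * pi * of_int j * x) - 1) * (of_real (of_int j + real n) / (2 * of_real pi * \<i> * of_int j * of_real (real n)))"
    unfolding cis_integral_eq[OF j x] using j n by (simp add: field_simps)
  also have "norm \<dots> \<le> 2 * (\<bar>of_int j + real n\<bar> / (2 * pi * \<bar>of_int j\<bar> * real n))"
    unfolding norm_mult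
  proof (intro mult_mono)
    show "norm (cis (2 * pi * of_int j * x) - 1) \<le> 2"
      using norm_triangle_ineq4[of "cis (2 * pi * of_int j * x)" 1] by simp
    show "norm (of_real (of_int j + real n) / (2 * complex_of_real pi * \<i> * of_int j * of_real (real n)))
        \<le> \<bar>of_int j + real n\<bar> / (2 * pi * \<bar>of_int j\<bar> * real n)"
      by (simp add: norm_divide norm_mult del: of_real_add)
  qed auto
  also have "\<dots> = (\<bar>of_int j + real n\<bar> / (real n * \<bar>of_int j\<bar>)) / pi" by (simp add: field_simps)
  also have "\<dots> \<le> (\<bar>of_int j + real n\<bar> / (real n * \<bar>of_int j\<bar>)) / 1"
    using pi_ge_two by (intro divide_left_mono) auto
  finally show ?thesis by simp
qed

text \<open>
  The power \<open>j\<close> to \<open>- 3/2\<close>, with value 0 at \<open>j = 0\<close>.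
\<close>

definition inv32 :: "nat \<Rightarrow> real" where "inv32 j = (1 / sqrt (real j)) ^ 3"

lemma summable_inv32: "summable inv32"
proof -
  have "inv32 = (\<lambda>j. real j powr (- (3/2)))"
  proof
    fix j
    show "inv32 j = real j powr (- (3/2))"
    proof (cases "j = 0")
      case False
      then have "sqrt (real j) ^ 3 = real j powr (3/2)"
        by (simp add: powr_half_sqrt[symmetric] powr_power)
      then show ?thesis unfolding inv32_def powr_minus_divide power_one_over by (rule arg_cong)
    qed (simp add: inv32_def)
  qed
  then show ?thesis using summable_real_powr_iff[of "- (3/2)"] by simp
qed

lemma inv32_nonneg: "inv32 j \<ge> 0" by (simp add: inv32_def)

text \<open>
  \<open>1 / (m l)\<close> alone is not summable uniformly along \<open>m + l = n\<close>; spending \<open>sqrt n \<le> sqrt m + sqrt l\<close> leaves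
  \<open>a b\<^sup>2 + a\<^sup>2 b \<le> a\<^sup>3 + b\<^sup>3\<close> with \<open>a = 1 / sqrt m\<close>, \<open>b = 1 / sqrt l\<close>.
\<close>

lemma sqrt_div_mult_le_inv32:
  assumes "m \<ge> 1" "l \<ge> 1" "n \<le> m + l"
  shows "sqrt (real n) / (real m * real l) \<le> inv32 m + inv32 l"
proof -
  define a where "a = 1 / sqrt (real m)"
  define b where "b = 1 / sqrt (real l)"
  have ab: "a > 0" "b > 0" using assms by (auto simp: a_def b_def)
  have "real n \<le> real m + real l" using assms(3) by linarith
  then have "sqrt (real n) \<le> sqrt (real m + real l)" by (rule real_sqrt_le_mono)
  also have "\<dots> \<le> sqrt (real m) + sqrt (real l)" by (rule sqrt_add_le_add_sqrt) auto
  finally have "sqrt (real n) \<le> sqrt (real m) + sqrt (real l)" .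
  then have "sqrt (real n) / (real m * real l) \<le> (sqrt (real m) + sqrt (real l)) / (real m * real l)"
    by (intro divide_right_mono) auto
  also have "\<dots> = a * b\<^sup>2 + a\<^sup>2 * b"
  proof -
    have "sqrt (real m) / real m = a" "sqrt (real l) / real l = b"
      unfolding a_def b_def using assms by (simp_all add: real_div_sqrt field_simps)
    moreover have "1 / real m = a\<^sup>2" "1 / real l = b\<^sup>2"
      unfolding a_def b_def by (simp_all add: power_divide)
    moreover have "(sqrt (real m) + sqrt (real l)) / (real m * real l)
        = (sqrt (real m) / real m) * (1 / real l) + (1 / real m) * (sqrt (real l) / real l)"
      by (simp add: add_divide_distrib)
    ultimately show ?thesis by simp
  qed
  also have "\<dots> \<le> a ^ 3 + b ^ 3"
  proof -
    have "0 \<le> (a - b)\<^sup>2 * (a + b)" using ab by simp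
    then show ?thesis by (simp add: power2_eq_square power3_eq_cube algebra_simps)
  qed
  finally show ?thesis by (simp add: inv32_def a_def b_def)
qed

lemma sqrt_div_mult_add_le_inv32:
  assumes "m \<ge> 1" "n \<ge> 1"
  shows "sqrt (real n) / (real m * (real m + real n)) \<le> inv32 m"
proof -
  have "sqrt (real n) * sqrt (real m) \<le> real m + real n"
  proof -
    have "0 \<le> (sqrt (real n) - sqrt (real m))\<^sup>2" by simp
    then have "2 * (sqrt (real n) * sqrt (real m)) \<le> real m + real n" by (simp add: power2_diff algebra_simps)
    moreover have "0 \<le> sqrt (real n) * sqrt (real m)" by simp
    ultimately show ?thesis by linarith
  qed
  then have "sqrt (real n) / (real m + real n) \<le> 1 / sqrt (real m)"
    using assms by (simp add: field_simps)
  then have "sqrt (real n) / (real m + real n) / real m \<le> 1 / sqrt (real m) / real m"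
    by (rule divide_right_mono) simp
  moreover have "inv32 m = 1 / sqrt (real m) / real m"
    by (simp add: inv32_def power_divide power3_eq_cube)
  ultimately show ?thesis by (simp add: mult.commute)
qed

lemma sum_two_sided_le:
  fixes f :: "nat \<Rightarrow> real"
  assumes f: "summable f" and nonneg: "\<And>j. f j \<ge> 0"
  shows "(\<Sum>m\<in>{..<M} - {n}. f (nat \<bar>int m - int n\<bar>)) \<le> 2 * suminf f"
proof -
  let ?g = "\<lambda>m. nat \<bar>int m - int n\<bar>"
  have part: "(\<Sum>m\<in>A. f (?g m)) \<le> suminf f" if "finite A" "inj_on ?g A" for A
  proof -
    have "(\<Sum>m\<in>A. f (?g m)) = sum f (?g ` A)" using that by (simp add: sum.reindex)
    also have "\<dots> \<le> suminf f" using that by (intro sum_le_suminf f nonneg) auto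
    finally show ?thesis .
  qed
  have "{..<M} - {n} = {m. m < M \<and> m < n} \<union> {m. m < M \<and> n < m}" by auto
  then have "(\<Sum>m\<in>{..<M} - {n}. f (?g m)) = (\<Sum>m\<in>{m. m < M \<and> m < n}. f (?g m)) + (\<Sum>m\<in>{m. m < M \<and> n < m}. f (?g m))"
    by (simp add: sum.union_disjoint disjoint_iff)
  also have "\<dots> \<le> suminf f + suminf f"
    by (intro add_mono part) (auto simp: inj_on_def)
  finally show ?thesis by simp
qed

context
  fixes c :: "nat \<Rightarrow> complex" and C :: real
  assumes c: "\<And>m. m \<ge> 1 \<Longrightarrow> norm (c m) \<le> C / (real m)\<^sup>2"
begin

lemma C_nonneg: "C \<ge> 0" using order_trans[OF norm_ge_zero c[of 1]] by simp

definition "term_bound m = 2 * C * inverse (real m ^ 2) + (if m = 0 then \<bar>Re (c 0)\<bar> else 0)"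

lemma fourier_term_le: "norm (fourier_term c m x) \<le> term_bound m"
proof (cases "m = 0")
  case False
  have "\<bar>Re (c m * cis (2 * pi * real m * x))\<bar> \<le> norm (c m)"
    using abs_Re_le_cmod[of "c m * cis (2 * pi * real m * x)"] by (simp add: norm_mult)
  also have "\<dots> \<le> C / (real m)\<^sup>2" using c[of m] False by simp
  finally show ?thesis using False by (simp add: fourier_term_def term_bound_def abs_mult divide_inverse)
qed (simp add: fourier_term_def term_bound_def C_nonneg)

lemma term_bound_summable: "summable term_bound"
  unfolding term_bound_def
  by (intro summable_add summable_mult inverse_power_summable) (use summable_single[of 0 "\<lambda>_. \<bar>Re (c 0)\<bar>"] in auto)

lemma term_bound_nonneg: "term_bound m \<ge> 0" using fourier_term_le[of m 0] norm_ge_zero order_trans by blast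

lemma fourier_term_summable: "summable (\<lambda>m. fourier_term c m x)"
  by (rule summable_comparison_test'[OF term_bound_summable]) (rule fourier_term_le)

lemma fourier_term_continuous: "continuous_on A (fourier_term c m)"
  unfolding fourier_term_def by (cases "m = 0") (auto simp: cis_conv_exp intro!: continuous_intros)

lemma fourier_sum_continuous: "continuous_on A (fourier_sum c)"
proof -
  have "uniform_limit A (\<lambda>n x. \<Sum>i<n. fourier_term c i x) (\<lambda>x. \<Sum>i. fourier_term c i x) sequentially"
    by (rule Weierstrass_m_test[OF fourier_term_le term_bound_summable])
  then have "continuous_on A (\<lambda>x. \<Sum>i. fourier_term c i x)"
    by (rule uniform_limit_theorem[rotated]) (auto intro!: continuous_intros fourier_term_continuous eventuallyI)
  then show ?thesis by (simp add: fourier_sum_def[abs_def])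
qed

lemma fourier_sum_integral_sums:
  assumes x: "0 \<le> x" "x \<le> 1"
  shows "(\<lambda>m. integral {0..x} (\<lambda>t. of_real (fourier_term c m t) * cis (- (2 * pi * real n * t))))
     sums integral {0..x} (\<lambda>t. of_real (fourier_sum c t) * cis (- (2 * pi * real n * t)))"
proof -
  let ?e = "\<lambda>t. cis (- (2 * pi * real n * t))"
  have ec: "continuous_on A ?e" for A by (simp add: cis_conv_exp continuous_intros)
  have ti: "(\<lambda>t. of_real (fourier_term c m t) * ?e t) integrable_on {0..x}" for m
    by (intro integrable_continuous_real continuous_intros ec fourier_term_continuous)
  have "(\<lambda>N. integral {0..x} (\<lambda>t. of_real (\<Sum>m<N. fourier_term c m t) * ?e t))
      \<longlonglongrightarrow> integral {0..x} (\<lambda>t. of_real (fourier_sum c t) * ?e t)"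
  proof (rule dominated_convergence(2)[where h = "\<lambda>_. suminf term_bound"])
    show "(\<lambda>t. of_real (\<Sum>m<N. fourier_term c m t) * ?e t) integrable_on {0..x}" for N
      by (intro integrable_continuous_real continuous_intros ec fourier_term_continuous)
    show "norm (of_real (\<Sum>m<N. fourier_term c m t) * ?e t) \<le> suminf term_bound" for N t
    proof -
      have "norm (\<Sum>m<N. fourier_term c m t) \<le> (\<Sum>m<N. term_bound m)"
        by (rule sum_norm_le) (rule fourier_term_le)
      also have "\<dots> \<le> suminf term_bound"
        by (intro sum_le_suminf term_bound_summable) (auto simp: term_bound_nonneg)
      finally show ?thesis by (simp add: norm_mult del: of_real_sum)
    qed
    show "(\<lambda>N. of_real (\<Sum>m<N. fourier_term c m t) * ?e t) \<longlonglongrightarrow> of_real (fourier_sum c t) * ?e t" for t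
      unfolding fourier_sum_def by (intro tendsto_intros summable_LIMSEQ fourier_term_summable)
  qed auto
  moreover have "integral {0..x} (\<lambda>t. of_real (\<Sum>m<N. fourier_term c m t) * ?e t)
      = (\<Sum>m<N. integral {0..x} (\<lambda>t. of_real (fourier_term c m t) * ?e t))" for N
    unfolding of_real_sum sum_distrib_right by (rule integral_sum) (use ti in auto)
  ultimately show ?thesis by (simp add: sums_def)
qed

lemma fourier_term_mult_cis:
  assumes "m \<ge> 1"
  shows "of_real (fourier_term c m t) * cis (- (2 * pi * real n * t))
    = c m * cis (2 * pi * of_int (int m - int n) * t) + cnj (c m) * cis (2 * pi * of_int (- (int m + int n)) * t)"
proof -
  have "of_real (fourier_term c m t) = c m * cis (2 * pi * real m * t) + cnj (c m * cis (2 * pi * real m * t))"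
    unfolding complex_add_cnj using assms by (simp only: fourier_term_def) simp
  then show ?thesis by (simp add: cis_cnj distrib_right mult.assoc cis_mult) (simp add: algebra_simps)
qed

lemma integral_fourier_term:
  assumes "m \<ge> 1"
  shows "integral {0..x} (\<lambda>t. of_real (fourier_term c m t) * cis (- (2 * pi * real n * t)))
     = c m * cis_integral (int m - int n) x + cnj (c m) * cis_integral (- (int m + int n)) x"
proof -
  have i: "(\<lambda>t. cis (2 * pi * of_int j * t)) integrable_on {0..x}" for j :: int
    by (intro integrable_continuous_real) (simp add: cis_conv_exp continuous_intros)
  show ?thesis unfolding fourier_term_mult_cis[OF assms] cis_integral_def
      hk_integral_add[OF integrable_on_mult_right[OF i] integrable_on_mult_right[OF i]]
      hk_integral_mult_right ..
qed

lemma integral_fourier_term_0: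
  "integral {0..x} (\<lambda>t. of_real (fourier_term c 0 t) * cis (- (2 * pi * real n * t)))
     = of_real (Re (c 0)) * cis_integral (- int n) x"
  by (simp add: fourier_term_def cis_integral_def)

lemma fourier_sum_coeff:
  assumes "Im (c 0) = 0"
  shows "integral {0..1} (\<lambda>t. of_real (fourier_sum c t) * cis (- (2 * pi * real n * t))) = c n"
proof -
  let ?I = "\<lambda>m. integral {0..1} (\<lambda>t. of_real (fourier_term c m t) * cis (- (2 * pi * real n * t)))"
  have "?I m = (if m = n then c n else 0)" for m
  proof (cases "m = 0")
    case True
    then show ?thesis using assms unfolding True integral_fourier_term_0 cis_integral_1
      by (auto simp: complex_eq_iff)
  next
    case False
    then have m: "m \<ge> 1" by simp
    show ?thesis unfolding integral_fourier_term[OF m] cis_integral_1 using m by auto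
  qed
  then have "?I sums c n" using sums_single[of n "\<lambda>_. c n"] by (simp add: eq_commute)
  then show ?thesis by (rule sums_unique2[OF fourier_sum_integral_sums, rotated -1]) auto
qed

text \<open>
  The partial Fourier integrals of the sum behave like the boundary terms of an integration by parts, up to
  \<open>O(n^(-3/2))\<close> uniformly in \<open>x\<close>, although the sum need not be differentiable. The \<open>m\<close>-th term contributes at most
  \<open>C / (m |m - n|) + C / (m (m + n))\<close> to \<open>n\<close> times the error, and the term \<open>m = n\<close> at most \<open>2 C / n\<close>.
\<close>

lemma fourier_sum_primitive_asymp:
  assumes n: "n \<ge> 1" and x: "0 \<le> x" "x \<le> 1"
  shows "real n * norm (integral {0..x} (\<lambda>t. of_real (fourier_sum c t) * cis (- (2 * pi * real n * t)))
      - \<i> / of_real (2 * pi * real n) * (of_real (fourier_sum c x) * cis (- (2 * pi * real n * x)) - of_real (fourier_sum c 0)))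
     \<le> C * (4 * suminf inv32 + 2) / sqrt (real n)"
proof -
  let ?e = "\<lambda>t. cis (- (2 * pi * real n * t))"
  let ?w = "\<i> / of_real (2 * pi * real n)"
  define R where "R = (\<lambda>m. integral {0..x} (\<lambda>t. of_real (fourier_term c m t) * ?e t)
      - ?w * (of_real (fourier_term c m x) * ?e x - of_real (fourier_term c m 0)))"
  have "(\<lambda>m. fourier_term c m y) sums fourier_sum c y" for y
    unfolding fourier_sum_def by (rule summable_sums[OF fourier_term_summable])
  then have Rs: "R sums (integral {0..x} (\<lambda>t. of_real (fourier_sum c t) * ?e t)
      - ?w * (of_real (fourier_sum c x) * ?e x - of_real (fourier_sum c 0)))"
    unfolding R_def
    by (intro sums_diff sums_mult sums_mult2 sums_of_real fourier_sum_integral_sums[OF x])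
  define D where "D = (\<lambda>j. cis_integral j x - ?w * (cis (2 * pi * of_int j * x) - 1))"
  have D: "norm (D j) \<le> \<bar>of_int j + real n\<bar> / (real n * \<bar>of_int j\<bar>)" if "j \<noteq> 0" for j
    unfolding D_def by (rule cis_integral_asymp[OF n x that])
  have R0: "R 0 = 0"
  proof -
    have "R 0 = of_real (Re (c 0)) * D (- int n)"
      unfolding R_def D_def integral_fourier_term_0 by (simp add: fourier_term_def algebra_simps)
    then show ?thesis using D[of "- int n"] n by simp
  qed
  have Rm: "R m = c m * D (int m - int n) + cnj (c m) * D (- (int m + int n))" if "m \<ge> 1" for m
    using fourier_term_mult_cis[OF that, of x n] fourier_term_mult_cis[OF that, of 0 n]
    unfolding R_def D_def integral_fourier_term[OF that] by (simp add: algebra_simps add_divide_distrib)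
  have n0: "real n > 0" using n by simp
  have Rle: "sqrt (real n) * (real n * norm (R m)) \<le> C * (2 * inv32 m + inv32 (nat \<bar>int m - int n\<bar>))" if m: "m \<ge> 1" "m \<noteq> n" for m
  proof -
    let ?l = "nat \<bar>int m - int n\<bar>"
    have l: "?l \<ge> 1" "n \<le> m + ?l" "real ?l = \<bar>real m - real n\<bar>" using m by auto
    have d1: "norm (D (int m - int n)) \<le> real m / (real n * real ?l)"
      using D[of "int m - int n"] m l(3) by simp
    have d2: "norm (D (- (int m + int n))) \<le> real m / (real n * (real m + real n))"
      using D[of "- (int m + int n)"] m by (simp add: add.commute)
    have "norm (R m) \<le> norm (c m) * norm (D (int m - int n)) + norm (c m) * norm (D (- (int m + int n)))"
      unfolding Rm[OF m(1)] by (rule order_trans[OF norm_triangle_ineq]) (simp add: norm_mult)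
    also have "\<dots> \<le> C / (real m)\<^sup>2 * (real m / (real n * real ?l)) + C / (real m)\<^sup>2 * (real m / (real n * (real m + real n)))"
      by (intro add_mono mult_mono c[OF m(1)] d1 d2) (auto simp: C_nonneg)
    also have "\<dots> = C / real n * (1 / (real m * real ?l) + 1 / (real m * (real m + real n)))"
    proof -
      have eq: "C / (real m)\<^sup>2 * (real m / (real n * y)) = C / real n * (1 / (real m * y))" for y
        using m by (simp add: power2_eq_square)
      show ?thesis unfolding eq by (rule distrib_left[symmetric])
    qed
    finally have "sqrt (real n) * (real n * norm (R m)) \<le> sqrt (real n) * (real n * (C / real n * (1 / (real m * real ?l) + 1 / (real m * (real m + real n)))))"
      by (intro mult_left_mono) auto
    also have "\<dots> = C * (sqrt (real n) / (real m * real ?l) + sqrt (real n) / (real m * (real m + real n)))"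
      using n0 by (simp add: field_simps)
    also have "\<dots> \<le> C * ((inv32 m + inv32 ?l) + inv32 m)"
      by (intro mult_left_mono add_mono sqrt_div_mult_le_inv32 sqrt_div_mult_add_le_inv32 m l n C_nonneg)
    finally show ?thesis by simp
  qed
  have Rn: "sqrt (real n) * (real n * norm (R n)) \<le> C * 2"
  proof -
    have "norm (D (int n - int n)) \<le> 1"
      using x by (simp add: D_def cis_integral_def)
    moreover have "norm (D (- (int n + int n))) \<le> 1"
    proof -
      have "norm (D (- (int n + int n))) \<le> \<bar>real_of_int (- (int n + int n)) + real n\<bar> / (real n * \<bar>real_of_int (- (int n + int n))\<bar>)"
        using n by (intro D) auto
      also have "\<dots> = 1 / (2 * real n)" using n0 by (simp add: field_simps)
      also have "\<dots> \<le> 1" using n by simp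
      finally show ?thesis .
    qed
    ultimately have "norm (R n) \<le> norm (c n) * 1 + norm (c n) * 1"
      unfolding Rm[OF n] by (intro order_trans[OF norm_triangle_ineq] add_mono) (simp_all add: norm_mult mult_left_le)
    also have "\<dots> \<le> 2 * (C / (real n)\<^sup>2)" using c[OF n] by simp
    finally have "sqrt (real n) * (real n * norm (R n)) \<le> sqrt (real n) * (real n * (2 * (C / (real n)\<^sup>2)))"
      by (intro mult_left_mono) auto
    also have "\<dots> = 2 * C * (sqrt (real n) / real n)" using n0 by (simp add: power2_eq_square)
    also have "\<dots> \<le> 2 * C * 1"
    proof (intro mult_left_mono)
      have "sqrt (real n) \<le> real n" using n by (intro real_le_lsqrt) (auto simp: power2_eq_square)
      then show "sqrt (real n) / real n \<le> 1" using n0 by simp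
    qed (simp add: C_nonneg)
    finally show ?thesis by simp
  qed
  have partial: "norm (\<Sum>m<M. R m) \<le> C * (4 * suminf inv32 + 2) / sqrt (real n) / real n" for M
  proof -
    have "sqrt (real n) * (real n * norm (\<Sum>m<M. R m)) \<le> sqrt (real n) * (real n * (\<Sum>m<M. norm (R m)))"
      by (intro mult_left_mono norm_sum) auto
    also have "\<dots> = (\<Sum>m<M. sqrt (real n) * (real n * norm (R m)))" by (simp add: sum_distrib_left)
    also have "\<dots> \<le> (\<Sum>m\<in>insert n ({..<M} - {n}). sqrt (real n) * (real n * norm (R m)))"
      by (intro sum_mono2) auto
    also have "\<dots> = sqrt (real n) * (real n * norm (R n)) + (\<Sum>m\<in>{..<M} - {n}. sqrt (real n) * (real n * norm (R m)))"
      by (subst sum.insert) auto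
    also have "\<dots> \<le> C * 2 + (\<Sum>m\<in>{..<M} - {n}. C * (2 * inv32 m + inv32 (nat \<bar>int m - int n\<bar>)))"
    proof (intro add_mono Rn sum_mono)
      fix m assume m: "m \<in> {..<M} - {n}"
      show "sqrt (real n) * (real n * norm (R m)) \<le> C * (2 * inv32 m + inv32 (nat \<bar>int m - int n\<bar>))"
        using m Rle[of m] by (cases "m = 0") (auto simp: R0 C_nonneg inv32_nonneg)
    qed
    also have "\<dots> = C * 2 + C * (2 * (\<Sum>m\<in>{..<M} - {n}. inv32 m) + (\<Sum>m\<in>{..<M} - {n}. inv32 (nat \<bar>int m - int n\<bar>)))"
      by (simp add: sum_distrib_left sum.distrib distrib_left)
    also have "\<dots> \<le> C * 2 + C * (2 * suminf inv32 + 2 * suminf inv32)"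
      by (intro add_left_mono mult_left_mono add_mono C_nonneg sum_two_sided_le summable_inv32 inv32_nonneg sum_le_suminf) auto
    finally have "sqrt (real n) * (real n * norm (\<Sum>m<M. R m)) \<le> C * (4 * suminf inv32 + 2)"
      by (simp add: algebra_simps)
    then show ?thesis using n0 by (simp add: field_simps)
  qed
  have "norm (integral {0..x} (\<lambda>t. of_real (fourier_sum c t) * ?e t)
      - ?w * (of_real (fourier_sum c x) * ?e x - of_real (fourier_sum c 0))) \<le> C * (4 * suminf inv32 + 2) / sqrt (real n) / real n"
    using tendsto_norm[OF Rs[unfolded sums_def]] by (rule LIMSEQ_le_const2) (use partial in auto)
  then show ?thesis using n0 by (simp add: field_simps)
qed

end

section \<open>Vanishing of the potential\<close>

context L1_potential
begin

text \<open>
  \<open>q - q1\<^sup>2\<close> is the Riccati (Miura) transform of \<open>q1\<close>.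
\<close>

definition riccati_coeff :: "nat \<Rightarrow> complex" where
  "riccati_coeff n = integral {0..1} (\<lambda>t. of_real (q t - (q1 t)\<^sup>2) * cis (- (2 * pi * real n * t)))"

lemma riccati_L1: "(\<lambda>t. q t - (q1 t)\<^sup>2) absolutely_integrable_on {0..1}"
  by (intro set_integral_diff q_L1 absolutely_integrable_continuous_real continuous_intros)

text \<open>
  Multiplied by \<open>n\<^sup>2\<close>, the three terms of \<open>fourier_coeff_vs_mid_coeff\<close> are \<open>o(1)\<close> by the choice of the edges, by
  the Riemann-Lebesgue lemma, and trivially.
\<close>

lemma n_squared_riccati_coeff:
  assumes gaps: small_gaps and mean: "q1 1 = 0"
  shows "(\<lambda>n. (real n)\<^sup>2 * norm (riccati_coeff n)) \<longlonglongrightarrow> 0"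
proof (rule tendsto_0_le_const[where C = 1])
  define I2 where "I2 = (\<lambda>n. norm (integral {0..1} (\<lambda>t. of_real (q t * (q1 t)\<^sup>2) * cis (- (2 * pi * real n * t)))))"
  let ?g = "\<lambda>n. (real n)\<^sup>2 * norm (mid_coeff n) + I2 n + mass ^ 4 / real n"
  have f: "(\<lambda>t. q t * (q1 t)\<^sup>2) absolutely_integrable_on {0..1}"
    by (intro L1_mult_real_continuous q_L1 continuous_intros)
  have "I2 \<longlonglongrightarrow> 0"
  proof (rule LIMSEQ_I)
    fix e :: real assume "e > 0"
    then obtain M where "\<forall>n\<ge>M. \<forall>x\<in>{0..1}. norm (integral {0..x} (\<lambda>t. of_real (q t * (q1 t)\<^sup>2) * cis (- (2 * pi * real n * t)))) \<le> e / 2"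
      using riemann_lebesgue_nat[OF f, of "e / 2"] by auto
    then have "\<forall>n\<ge>M. I2 n \<le> e / 2" by (simp add: I2_def)
    moreover have "I2 n \<ge> 0" for n by (simp add: I2_def)
    ultimately show "\<exists>M. \<forall>n\<ge>M. norm (I2 n - 0) < e" using \<open>e > 0\<close> by (intro exI[of _ M]) fastforce
  qed
  from tendsto_add[OF tendsto_add[OF n_squared_mid_coeff[OF gaps mean] this] lim_const_over_n[of "mass ^ 4"]]
  show "?g \<longlonglongrightarrow> 0" by simp
  show "\<forall>\<^sub>F n in sequentially. \<bar>(real n)\<^sup>2 * norm (riccati_coeff n)\<bar> \<le> 1 * ?g n"
    using eventually_ge_at_top[of 1]
  proof eventually_elim
    case (elim n)
    have n: "real n \<ge> 1" using elim by simp
    have np: "real n \<le> real n * pi" using pi_ge_two mult_left_mono[of 1 pi "real n"] by simp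
    then have p0: "real n * pi > 0" using n by linarith
    have "(real n)\<^sup>2 * norm (riccati_coeff n) \<le> (real n)\<^sup>2 * (norm (mid_coeff n) + I2 n / (2 * (real n * pi)\<^sup>2) + mass ^ 4 / (real n * pi) ^ 3)"
      unfolding riccati_coeff_def I2_def by (intro mult_left_mono fourier_coeff_vs_mid_coeff mean elim) auto
    also have "\<dots> = (real n)\<^sup>2 * norm (mid_coeff n) + (real n)\<^sup>2 * (I2 n / (2 * (real n * pi)\<^sup>2)) + (real n)\<^sup>2 * (mass ^ 4 / (real n * pi) ^ 3)"
      by (simp only: distrib_left)
    also have "(real n)\<^sup>2 * (I2 n / (2 * (real n * pi)\<^sup>2)) \<le> (real n * pi)\<^sup>2 * (I2 n / (2 * (real n * pi)\<^sup>2))"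
      using np by (intro mult_right_mono power_mono) (auto simp: I2_def)
    also have "\<dots> = I2 n / 2" using p0 elim by simp
    also have "\<dots> \<le> I2 n" by (simp add: I2_def)
    also have "(real n)\<^sup>2 * (mass ^ 4 / (real n * pi) ^ 3) \<le> (real n)\<^sup>2 * (mass ^ 4 / real n ^ 3)"
      using n np p0 by (intro mult_left_mono divide_left_mono power_mono) auto
    also have "\<dots> = mass ^ 4 / real n" using n by (simp add: power2_eq_square power3_eq_cube)
    finally show ?case by simp
  qed
qed

lemma continuous_representative:
  assumes gaps: small_gaps and mean: "q1 1 = 0"
  shows "\<exists>C. (\<forall>m\<ge>1. norm (riccati_coeff m) \<le> C / (real m)\<^sup>2) \<and>
    (AE x in lebesgue. x \<in> {0..1} \<longrightarrow> q x = fourier_sum riccati_coeff x + (q1 x)\<^sup>2)"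
proof -
  have "Bseq (\<lambda>n. (real n)\<^sup>2 * norm (riccati_coeff n))"
    using n_squared_riccati_coeff[OF gaps mean] convergentI convergent_imp_Bseq by blast
  then obtain C where C: "\<And>n. norm ((real n)\<^sup>2 * norm (riccati_coeff n)) \<le> C" unfolding Bseq_def by blast
  have c: "norm (riccati_coeff m) \<le> C / (real m)\<^sup>2" if "m \<ge> 1" for m
    using C[of m] that by (simp add: field_simps)
  have im: "Im (riccati_coeff 0) = 0"
  proof -
    have "riccati_coeff 0 = of_real (integral {0..1} (\<lambda>t. q t - (q1 t)\<^sup>2))"
      using integral_linear[OF L1_integrable[OF riccati_L1 order_refl order_refl] bounded_linear_of_real[where 'a=complex]]
      by (simp add: riccati_coeff_def o_def)
    then show ?thesis by simp
  qed
  have fc: "continuous_on A (fourier_sum riccati_coeff)" for A by (rule fourier_sum_continuous[OF c])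
  let ?h = "\<lambda>t. (q t - (q1 t)\<^sup>2) - fourier_sum riccati_coeff t"
  have fL: "fourier_sum riccati_coeff absolutely_integrable_on {0..1}"
    by (intro absolutely_integrable_continuous_real fc)
  have "AE x in lebesgue. x \<in> {0..1} \<longrightarrow> ?h x = 0"
  proof (rule L1_fourier_uniqueness)
    show "?h absolutely_integrable_on {0..1}" by (intro set_integral_diff riccati_L1 fL)
    fix n
    let ?e = "\<lambda>t. cis (- (2 * pi * real n * t))"
    have ec: "continuous_on {0..1} ?e" by (intro cis_continuous continuous_intros)
    have "integral {0..1} (\<lambda>t. of_real (?h t) * ?e t)
        = integral {0..1} (\<lambda>t. of_real (q t - (q1 t)\<^sup>2) * ?e t) - integral {0..1} (\<lambda>t. of_real (fourier_sum riccati_coeff t) * ?e t)"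
      unfolding of_real_diff[of "q _ - (q1 _)\<^sup>2"] left_diff_distrib
      by (rule hk_integral_diff; rule L1_integrable[OF L1_mult_of_real_continuous[OF _ ec]])
        (use riccati_L1 fL in auto)
    also have "integral {0..1} (\<lambda>t. of_real (fourier_sum riccati_coeff t) * ?e t) = riccati_coeff n"
      by (rule fourier_sum_coeff[OF c im])
    finally have "integral {0..1} (\<lambda>t. of_real (?h t) * ?e t) = 0" by (simp only: riccati_coeff_def[of n] diff_self)
    then show "integral {0..1} (\<lambda>t. of_real (?h t) * ?e t) = 0" .
  qed
  then have "AE x in lebesgue. x \<in> {0..1} \<longrightarrow> q x = fourier_sum riccati_coeff x + (q1 x)\<^sup>2"
    by eventually_elim (auto simp: algebra_simps)
  then show ?thesis using c by blast
qed

abbreviation partial_coeff :: "nat \<Rightarrow> real \<Rightarrow> complex" where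
  "partial_coeff n x \<equiv> integral {0..x} (\<lambda>t. of_real (q t) * cis (- (2 * pi * real n * t)))"

text \<open>
  What integrating \<open>r\<close> by parts against the frequency \<open>- n\<close> leaves at the ends of \<open>[0, x]\<close>.
\<close>

abbreviation boundary_term :: "(real \<Rightarrow> real) \<Rightarrow> nat \<Rightarrow> real \<Rightarrow> complex" where
  "boundary_term r n x \<equiv> \<i> / of_real (2 * pi * real n) * (of_real (r x) * cis (- (2 * pi * real n * x)) - of_real (r 0))"

text \<open>
  The partial Fourier integrals of \<open>q\<close> are known up to \<open>o(1/n)\<close> as if \<open>q\<close> were differentiable: the Fourier
  series is covered by \<open>fourier_sum_primitive_asymp\<close>, and \<open>q1\<^sup>2\<close> has the summable derivative \<open>2 q q1\<close>.
\<close>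

lemma primitive_cis_asymp:
  assumes gaps: small_gaps and mean: "q1 1 = 0"
  obtains r where "continuous_on {0..1} r" "AE x in lebesgue. x \<in> {0..1} \<longrightarrow> q x = r x"
    "\<And>e. e > 0 \<Longrightarrow> \<exists>M. \<forall>n\<ge>M. \<forall>x\<in>{0..1}. real n * norm (partial_coeff n x - boundary_term r n x) \<le> e"
proof -
  obtain C where c: "\<And>m. m \<ge> 1 \<Longrightarrow> norm (riccati_coeff m) \<le> C / (real m)\<^sup>2"
    and ae: "AE x in lebesgue. x \<in> {0..1} \<longrightarrow> q x = fourier_sum riccati_coeff x + (q1 x)\<^sup>2"
    using continuous_representative[OF assms] by blast
  define f where "f = fourier_sum riccati_coeff"
  define r where "r = (\<lambda>x. f x + (q1 x)\<^sup>2)"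
  have fc: "continuous_on A f" for A unfolding f_def by (rule fourier_sum_continuous[OF c])
  have rc: "continuous_on {0..1} r" unfolding r_def by (intro continuous_intros fc)
  have ae': "AE x in lebesgue. x \<in> {0..1} \<longrightarrow> q x = r x" using ae by (simp add: r_def f_def)
  have main: "\<exists>M. \<forall>n\<ge>M. \<forall>x\<in>{0..1}. real n * norm (partial_coeff n x - boundary_term r n x) \<le> e" if e: "e > 0" for e
  proof -
    obtain M1 where M1: "\<And>n x. n \<ge> M1 \<Longrightarrow> x \<in> {0..1} \<Longrightarrow>
        norm (integral {0..x} (\<lambda>t. of_real (q t * q1 t) * cis (- (2 * pi * real n * t)))) \<le> e / 2"
      using riemann_lebesgue_nat[OF L1_mult_real_continuous[OF q_L1 q1_continuous] half_gt_zero[OF e]] by blast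
    define L where "L = C * (4 * suminf inv32 + 2)"
    obtain M2 :: nat where M2: "real M2 \<ge> (2 * L / e)\<^sup>2" using real_arch_simple by blast
    have "real n * norm (partial_coeff n x - boundary_term r n x) \<le> e"
      if n: "n \<ge> M1 + M2 + 1" and x: "x \<in> {0..1}" for n x
    proof -
      let ?e = "\<lambda>t. cis (- (2 * pi * real n * t))"
      let ?w = "2 * pi * real n"
      have ec: "continuous_on A ?e" for A by (intro cis_continuous continuous_intros)
      have n1: "n \<ge> 1" using n by simp
      have w: "complex_of_real ?w \<noteq> 0" using n1 by simp
      have i: "(\<lambda>t. of_real (f t) * ?e t) integrable_on {0..x}" "(\<lambda>t. of_real ((q1 t)\<^sup>2) * ?e t) integrable_on {0..x}"
        by (rule L1_integrable[OF L1_mult_of_real_continuous[OF _ ec]];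
            use x in \<open>auto intro!: absolutely_integrable_continuous_real continuous_intros fc\<close>)+
      have "integral {0..x} (\<lambda>t. of_real (q t) * ?e t) = integral {0..x} (\<lambda>t. of_real (f t) * ?e t + of_real ((q1 t)\<^sup>2) * ?e t)"
      proof (rule AE_integral_cong)
        show "AE t in lebesgue. t \<in> {0..1} \<longrightarrow> of_real (q t) * ?e t = of_real (f t) * ?e t + of_real ((q1 t)\<^sup>2) * ?e t"
          using ae' by eventually_elim (auto simp: r_def algebra_simps)
      qed (use x in auto)
      also have "\<dots> = integral {0..x} (\<lambda>t. of_real (f t) * ?e t) + integral {0..x} (\<lambda>t. of_real ((q1 t)\<^sup>2) * ?e t)"
        by (rule hk_integral_add[OF i])
      finally have split: "integral {0..x} (\<lambda>t. of_real (q t) * ?e t)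
          = integral {0..x} (\<lambda>t. of_real (f t) * ?e t) + integral {0..x} (\<lambda>t. of_real ((q1 t)\<^sup>2) * ?e t)" .
      define I where "I = integral {0..x} (\<lambda>t. of_real (q t * q1 t) * ?e t)"
      have "\<i> * of_real ?w * integral {0..x} (\<lambda>t. of_real ((q1 t)\<^sup>2) * ?e t) = 2 * I - of_real ((q1 x)\<^sup>2) * ?e x"
        unfolding I_def by (rule integral_q1_squared_cis) (use x in auto)
      then have q12: "integral {0..x} (\<lambda>t. of_real ((q1 t)\<^sup>2) * ?e t) = \<i> / of_real ?w * (of_real ((q1 x)\<^sup>2) * ?e x) - 2 * \<i> / of_real ?w * I"
      proof -
        assume eq: "\<i> * of_real ?w * integral {0..x} (\<lambda>t. of_real ((q1 t)\<^sup>2) * ?e t) = 2 * I - of_real ((q1 x)\<^sup>2) * ?e x"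
        have "integral {0..x} (\<lambda>t. of_real ((q1 t)\<^sup>2) * ?e t)
            = - \<i> / of_real ?w * (\<i> * of_real ?w * integral {0..x} (\<lambda>t. of_real ((q1 t)\<^sup>2) * ?e t))"
          using w by simp
        then show ?thesis unfolding eq by (simp add: algebra_simps diff_divide_distrib)
      qed
      define E where "E = integral {0..x} (\<lambda>t. of_real (f t) * ?e t) - \<i> / of_real ?w * (of_real (f x) * ?e x - of_real (f 0))"
      have "integral {0..x} (\<lambda>t. of_real (q t) * ?e t) - \<i> / of_real ?w * (of_real (r x) * ?e x - of_real (r 0))
          = E - 2 * \<i> / of_real ?w * I"
        unfolding split q12 E_def r_def by (simp add: algebra_simps add_divide_distrib)
      then have "real n * norm (integral {0..x} (\<lambda>t. of_real (q t) * ?e t) - \<i> / of_real ?w * (of_real (r x) * ?e x - of_real (r 0)))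
          \<le> real n * (norm E + norm (2 * \<i> / of_real ?w * I))"
        by (simp only:) (intro mult_left_mono norm_triangle_ineq4, simp)
      also have "\<dots> = real n * norm E + norm I / pi"
        using n1 by (simp add: norm_mult norm_divide distrib_left)
      also have "norm I / pi \<le> norm I / 1" using pi_ge_two by (intro divide_left_mono) auto
      also have "norm I / 1 \<le> e / 2" using M1[of n x] n x by (simp add: I_def)
      also have "real n * norm E \<le> L / sqrt (real n)"
        unfolding E_def f_def L_def by (rule fourier_sum_primitive_asymp[OF c n1]) (use x in auto)
      also have "L / sqrt (real n) \<le> e / 2"
      proof -
        have "(2 * L / e)\<^sup>2 \<le> real n" using M2 n by linarith
        then have "2 * L / e \<le> sqrt (real n)" by (rule real_le_rsqrt)
        then show ?thesis using e n1 by (simp add: field_simps)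
      qed
      finally show ?thesis by simp
    qed
    then show ?thesis by blast
  qed
  show ?thesis by (rule that[OF rc ae' main])
qed

text \<open>
  Put \<open>\<kappa> = n \<pi>\<close> and let \<open>D\<close> be the partial Fourier integral of \<open>q\<close>. Up to \<open>O(\<kappa>\<^sup>-\<^sup>2)\<close>, \<open>G\<close> is \<open>D\<close> times the slowly varying
  factor \<open>P = cis (q1 / \<kappa>)\<close>, and this factor cancels against its conjugate. Replacing \<open>D\<close> by its boundary terms
  turns the integrand into \<open>(- i / 2\<kappa>) q r\<close> plus an oscillating term.
\<close>

lemma second_order_limit:
  assumes rc: "continuous_on {0..1} r" and ae: "AE x in lebesgue. x \<in> {0..1} \<longrightarrow> q x = r x"
    and asymp: "\<And>e. e > 0 \<Longrightarrow> \<exists>M. \<forall>n\<ge>M. \<forall>x\<in>{0..1}. real n * norm (partial_coeff n x - boundary_term r n x) \<le> e"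
    and e: "e > 0"
  shows "\<exists>M. \<forall>n\<ge>M. \<bar>real n * Im (second_order (real n * pi))
      + integral {0..1} (\<lambda>t. (r t)\<^sup>2) / (2 * pi)\<bar> \<le> e"
proof -
  have "bounded (r ` {0..1})" by (intro compact_imp_bounded compact_continuous_image rc) auto
  then obtain R where R: "R > 0" "\<And>x. 0 \<le> x \<Longrightarrow> x \<le> 1 \<Longrightarrow> \<bar>r x\<bar> \<le> R" unfolding bounded_pos by auto
  \<comment> \<open>The tolerance enters once with the factor mass (from J1 - J2) and once with the factor R (from D 1).\<close>
  define \<delta> where "\<delta> = min 1 (e / (2 * (mass + R)))"
  have mR: "mass + R > 0" using R mass_nonneg by simp
  have "\<delta> * (mass + R) \<le> e / (2 * (mass + R)) * (mass + R)"
    using mR unfolding \<delta>_def by (intro mult_right_mono) auto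
  also have "\<dots> = e / 2" using mR by (simp add: divide_simps)
  finally have \<delta>: "\<delta> > 0" "\<delta> \<le> 1" "\<delta> * (mass + R) \<le> e / 2"
    using e mR unfolding \<delta>_def by auto
  obtain M1 where M1: "\<And>n x. n \<ge> M1 \<Longrightarrow> x \<in> {0..1} \<Longrightarrow> real n * norm (partial_coeff n x - boundary_term r n x) \<le> \<delta>"
    using asymp[OF \<delta>(1)] by blast
  obtain M2 where M2: "\<And>n x. n \<ge> M2 \<Longrightarrow> x \<in> {0..1} \<Longrightarrow> norm (partial_coeff n x) \<le> \<delta>"
    using riemann_lebesgue_nat[OF q_L1 \<delta>(1)] by blast
  obtain M3 :: nat where M3: "real M3 \<ge> 2 * mass\<^sup>2 * (1 + R) / e" using real_arch_simple by blast
  have "\<bar>real n * Im (second_order (real n * pi))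
      + integral {0..1} (\<lambda>t. (r t)\<^sup>2) / (2 * pi)\<bar> \<le> e" if n: "n \<ge> M1 + M2 + M3 + 1" for n
  proof -
    define \<kappa> where "\<kappa> = real n * pi"
    let ?w = "2 * pi * real n"
    let ?e = "\<lambda>t. cis (- (2 * pi * real n * t))"
    have n1: "real n \<ge> 1" using n by simp
    have kn: "\<kappa> \<ge> real n" using pi_ge_two n1 mult_left_mono[of 1 pi "real n"] by (simp add: \<kappa>_def)
    have k0: "\<kappa> > 0" using kn n1 by linarith
    define P where "P = (\<lambda>t. cis (q1 t / \<kappa>))"
    define D where "D = (\<lambda>x. integral {0..x} (\<lambda>t. of_real (q t) * ?e t))"
    have ec [continuous_intros]: "continuous_on {0..1} ?e" by (intro cis_continuous continuous_intros)
    have Pc [continuous_intros]: "continuous_on {0..1} P" unfolding P_def using k0 by (intro cis_continuous continuous_intros) auto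
    have D: "primitive_of D (\<lambda>t. of_real (q t) * ?e t)"
      using primitive_integral[OF L1_mult_of_real_continuous[OF q_L1 ec], of 0] by (simp add: D_def)
    note Dc [continuous_intros] = primitive_continuous[OF D]
    note Gc [continuous_intros] = primitive_continuous[OF G_primitive[of \<kappa>]]
    have th: "cis (- (2 * theta \<kappa> t)) = ?e t * P t" for t
      using k0 by (simp add: P_def theta_def cis_mult \<kappa>_def algebra_simps)
    have Dasymp: "norm (D x - \<i> / of_real ?w * (of_real (r x) * ?e x - of_real (r 0))) \<le> \<delta> / real n" if "0 \<le> x" "x \<le> 1" for x
      using M1[of n x] n that n1 by (simp add: D_def field_simps)
    have Dle: "norm (D x) \<le> (1 + R) / real n" if x: "0 \<le> x" "x \<le> 1" for x
    proof -
      have "norm (of_real (r x) * ?e x - of_real (r 0)) \<le> R + R"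
        using R(2)[OF x] R(2)[of 0] by (intro order_trans[OF norm_triangle_ineq4] add_mono) (auto simp: norm_mult)
      then have "norm (\<i> / of_real ?w * (of_real (r x) * ?e x - of_real (r 0))) \<le> 1 / ?w * (R + R)"
        using n1 unfolding norm_mult by (intro mult_mono) (auto simp: norm_divide norm_mult)
      also have "\<dots> = R / real n / pi" by simp
      also have "\<dots> \<le> R / real n / 1" using pi_ge_two R n1 by (intro divide_left_mono) auto
      finally have "norm (\<i> / of_real ?w * (of_real (r x) * ?e x - of_real (r 0))) \<le> R / real n" by simp
      moreover have "\<delta> / real n \<le> 1 / real n" using \<delta> n1 by (intro divide_right_mono) auto
      ultimately have "norm (D x) \<le> R / real n + 1 / real n"
        using Dasymp[OF x] norm_triangle_sub[of "D x" "\<i> / of_real ?w * (of_real (r x) * ?e x - of_real (r 0))"] by linarith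
      then show ?thesis by (simp add: add_divide_distrib)
    qed
    have G_D: "norm (G \<kappa> x - D x * P x) \<le> (1 + R) / real n / \<kappa> * mass" if x: "0 \<le> x" "x \<le> 1" for x
    proof -
      have q1k: "primitive_of (\<lambda>x. of_real (q1 x / \<kappa>)) (\<lambda>x. of_real (q x / \<kappa>))"
        using primitive_cmult[OF q1_primitive, of "1 / of_real \<kappa>"] by simp
      have PP: "primitive_of P (\<lambda>x. \<i> * of_real (q x / \<kappa>) * P x)"
        unfolding P_def by (rule primitive_cis[OF q1k])
      have "primitive_of (\<lambda>x. D x * P x + - 1 * G \<kappa> x) (\<lambda>t. of_real (q t) * (\<i> / of_real \<kappa> * P t * D t))"
        by (rule primitive_cong[OF primitive_add[OF primitive_mult[OF D PP] primitive_cmult[OF G_primitive, of "-1" \<kappa>]]])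
          (auto simp: th algebra_simps)
      from primitive_ofD(2)[OF this x] have eq: "integral {0..x} (\<lambda>t. of_real (q t) * (\<i> / of_real \<kappa> * P t * D t)) = D x * P x - G \<kappa> x"
        by (simp add: D_def G_def)
      have "norm (integral {0..x} (\<lambda>t. of_real (q t) * (\<i> / of_real \<kappa> * P t * D t)) - integral {0..x} (\<lambda>t. of_real (q t) * 0))
          \<le> (1 + R) / real n / \<kappa> * mass"
      proof (intro integral_diff_L1_bound x)
        fix t :: real assume t: "0 \<le> t" "t \<le> 1"
        show "norm (\<i> / of_real \<kappa> * P t * D t - 0) \<le> (1 + R) / real n / \<kappa>"
        proof -
          have "norm (\<i> / of_real \<kappa> * P t * D t - 0) = norm (D t) / \<kappa>"
            using k0 by (simp add: norm_mult norm_divide P_def)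
          also have "\<dots> \<le> (1 + R) / real n / \<kappa>" using k0 by (intro divide_right_mono Dle t) auto
          finally show ?thesis .
        qed
      qed (use k0 in \<open>auto intro!: continuous_intros\<close>)
      then show ?thesis unfolding eq by (simp add: norm_minus_commute)
    qed
    define J where "J = integral {0..1} (\<lambda>t. of_real (q t) * (?e t * P t * cnj (G \<kappa> t)))"
    define J1 where "J1 = integral {0..1} (\<lambda>t. of_real (q t) * (?e t * cnj (D t)))"
    define J2 where "J2 = integral {0..1} (\<lambda>t. of_real (q t) * (?e t * cnj (\<i> / of_real ?w * (of_real (r t) * ?e t - of_real (r 0)))))"
    have JJ1: "norm (J - J1) \<le> (1 + R) / real n / \<kappa> * mass * mass"
      unfolding J_def J1_def
    proof (intro integral_diff_L1_bound)
      fix t :: real assume t: "0 \<le> t" "t \<le> 1"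
      have PPc: "P t * cnj (P t) = 1" by (simp add: P_def cis_cnj cis_mult)
      have "?e t * P t * cnj (G \<kappa> t) - ?e t * cnj (D t) = ?e t * P t * cnj (G \<kappa> t) - ?e t * cnj (D t) * (P t * cnj (P t))"
        unfolding PPc by simp
      also have "\<dots> = ?e t * P t * cnj (G \<kappa> t - D t * P t)" by (simp add: algebra_simps)
      also have "norm \<dots> = norm (G \<kappa> t - D t * P t)" by (simp add: norm_mult P_def del: complex_cnj_diff complex_cnj_mult)
      finally show "norm (?e t * P t * cnj (G \<kappa> t) - ?e t * cnj (D t)) \<le> (1 + R) / real n / \<kappa> * mass"
        using G_D[OF t] by simp
    qed (auto intro!: continuous_intros)
    have J12: "norm (J1 - J2) \<le> \<delta> / real n * mass"
      unfolding J1_def J2_def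
    proof (intro integral_diff_L1_bound)
      fix t :: real assume t: "0 \<le> t" "t \<le> 1"
      show "norm (?e t * cnj (D t) - ?e t * cnj (\<i> / of_real ?w * (of_real (r t) * ?e t - of_real (r 0)))) \<le> \<delta> / real n"
        unfolding right_diff_distrib[symmetric] complex_cnj_diff[symmetric] norm_mult complex_mod_cnj norm_cis mult_1
        using Dasymp[OF t] by (simp only: right_diff_distrib)
    qed (use n1 in \<open>auto intro!: continuous_intros rc\<close>)
    have J2: "J2 = - \<i> / of_real ?w * (of_real (integral {0..1} (\<lambda>t. (r t)\<^sup>2)) - of_real (r 0) * D 1)"
    proof -
      have i: "(\<lambda>t. complex_of_real (q t) * of_real (r t)) integrable_on {0..1}" "(\<lambda>t. of_real (q t) * ?e t) integrable_on {0..1}"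
        by (rule L1_integrable[OF L1_mult_of_real_continuous[OF q_L1]]; intro continuous_intros rc order_refl)+
      have "J2 = integral {0..1} (\<lambda>t. - \<i> / of_real ?w * (of_real (q t) * of_real (r t) - of_real (r 0) * (of_real (q t) * ?e t)))"
        unfolding J2_def
      proof (rule Henstock_Kurzweil_Integration.integral_cong)
        fix t
        have ee: "?e t * cnj (?e t) = 1" by (simp add: cis_cnj cis_mult)
        have "of_real (q t) * (?e t * cnj (\<i> / of_real ?w * (of_real (r t) * ?e t - of_real (r 0))))
          = - \<i> / of_real ?w * (of_real (q t) * of_real (r t) * (?e t * cnj (?e t)) - of_real (r 0) * (of_real (q t) * ?e t))"
          by (simp add: algebra_simps)
        then show "of_real (q t) * (?e t * cnj (\<i> / of_real ?w * (of_real (r t) * ?e t - of_real (r 0))))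
          = - \<i> / of_real ?w * (of_real (q t) * of_real (r t) - of_real (r 0) * (of_real (q t) * ?e t))"
          unfolding ee by simp
      qed
      also have "\<dots> = - \<i> / of_real ?w * integral {0..1} (\<lambda>t. of_real (q t) * of_real (r t) - of_real (r 0) * (of_real (q t) * ?e t))"
        by (rule hk_integral_mult_right)
      also have "integral {0..1} (\<lambda>t. of_real (q t) * of_real (r t) - of_real (r 0) * (of_real (q t) * ?e t))
          = integral {0..1} (\<lambda>t. of_real (q t) * of_real (r t)) - integral {0..1} (\<lambda>t. of_real (r 0) * (of_real (q t) * ?e t))"
        by (rule hk_integral_diff[OF i(1) integrable_on_mult_right[OF i(2)]])
      also have "integral {0..1} (\<lambda>t. of_real (r 0) * (of_real (q t) * ?e t)) = of_real (r 0) * D 1"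
        unfolding D_def by (rule hk_integral_mult_right)
      finally have "J2 = - \<i> / of_real ?w * (integral {0..1} (\<lambda>t. of_real (q t) * of_real (r t)) - of_real (r 0) * D 1)" .
      moreover have "integral {0..1} (\<lambda>t. complex_of_real (q t) * of_real (r t)) = integral {0..1} (\<lambda>t. of_real ((r t)\<^sup>2))"
      proof (rule AE_integral_cong)
        show "AE t in lebesgue. t \<in> {0..1} \<longrightarrow> complex_of_real (q t) * of_real (r t) = of_real ((r t)\<^sup>2)"
          using ae by eventually_elim (auto simp: power2_eq_square)
      qed auto
      moreover have "integral {0..1} (\<lambda>t. complex_of_real ((r t)\<^sup>2)) = of_real (integral {0..1} (\<lambda>t. (r t)\<^sup>2))"
      proof -
        have "(\<lambda>t. (r t)\<^sup>2) integrable_on {0..1}" by (intro integrable_continuous_real continuous_intros rc)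
        from integral_linear[OF this bounded_linear_of_real[where 'a=complex]] show ?thesis by (simp add: o_def)
      qed
      ultimately show ?thesis by simp
    qed
    define V where "V = integral {0..1} (\<lambda>t. (r t)\<^sup>2)"
    have ImJ2: "real n * Im J2 + V / (2 * pi) = r 0 * Re (D 1) / (2 * pi)"
    proof -
      have "- \<i> / complex_of_real ?w = Complex 0 (- 1 / ?w)" using n1 by (simp add: complex_eq_iff Re_divide Im_divide power2_eq_square)
      then have "Im J2 = - 1 / ?w * (V - r 0 * Re (D 1))" unfolding J2 V_def[symmetric] by simp
      then show ?thesis using n1 by (simp add: field_simps)
    qed
    have D1: "\<bar>r 0 * Re (D 1) / (2 * pi)\<bar> \<le> R * \<delta>"
    proof -
      have "norm (D 1) \<le> \<delta>" using M2[of n 1] n by (simp add: D_def)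
      then have "\<bar>Re (D 1)\<bar> \<le> \<delta>" using abs_Re_le_cmod order_trans by blast
      then have "\<bar>r 0\<bar> * \<bar>Re (D 1)\<bar> \<le> R * \<delta>" using R(2)[of 0] R(1) by (intro mult_mono) auto
      moreover have "\<bar>r 0 * Re (D 1) / (2 * pi)\<bar> \<le> \<bar>r 0 * Re (D 1)\<bar> / 1"
        unfolding abs_divide using pi_ge_two by (intro divide_left_mono) auto
      ultimately show ?thesis by (simp add: abs_mult)
    qed
    have "\<bar>real n * Im (J - J2)\<bar> \<le> real n * norm (J - J2)"
      using abs_Im_le_cmod[of "J - J2"] n1 by (simp add: abs_mult)
    also have "\<dots> \<le> real n * ((1 + R) / real n / \<kappa> * mass * mass + \<delta> / real n * mass)"
      using JJ1 J12 norm_triangle_ineq[of "J - J1" "J1 - J2"] n1 by (intro mult_left_mono) auto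
    also have "\<dots> = mass\<^sup>2 * (1 + R) / \<kappa> + \<delta> * mass"
      using n1 k0 by (simp add: field_simps power2_eq_square)
    also have "mass\<^sup>2 * (1 + R) / \<kappa> \<le> e / 2"
    proof -
      have "2 * mass\<^sup>2 * (1 + R) / e \<le> \<kappa>" using M3 n kn by linarith
      then show ?thesis using e k0 by (simp add: field_simps)
    qed
    finally have "\<bar>real n * Im (J - J2)\<bar> \<le> e / 2 + \<delta> * mass" by simp
    moreover have "real n * Im J + V / (2 * pi) = real n * Im (J - J2) + r 0 * Re (D 1) / (2 * pi)"
      unfolding ImJ2[symmetric] by (simp add: algebra_simps)
    moreover have "\<delta> * mass + R * \<delta> \<le> e / 2" using \<delta>(3) by (simp add: algebra_simps)
    ultimately have "\<bar>real n * Im J + V / (2 * pi)\<bar> \<le> e" using D1 by linarith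
    moreover have "J = second_order \<kappa>"
      unfolding J_def th by (simp add: mult.assoc)
    ultimately show ?thesis unfolding \<kappa>_def V_def by simp
  qed
  then show ?thesis by blast
qed

text \<open>
  At an eigenvalue \<open>k = n \<pi>\<close> the imaginary part of \<open>alpha k 1\<close> has modulus \<open>|B k|\<close>, and \<open>k\<close> is one of the
  edges, where \<open>B = o(n\<^sup>-\<^sup>3)\<close>.
\<close>

lemma n_Im_second_order_small:
  assumes gaps: small_gaps and mean: "q1 1 = 0" and e: "e > 0"
  shows "\<exists>M. \<forall>n\<ge>M. (-1) ^ n * Re (A (real n * pi)) = 1 \<longrightarrow>
     real n * \<bar>Im (second_order (real n * pi))\<bar> \<le> e"
proof -
  \<comment> \<open>With k at most 4 n, the factor n 4 k^2 of the leading error B is at most 64 n^3.\<close>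
  let ?x = "\<lambda>n. real n ^ 3 * (norm (B (km n)) + norm (B (kp n)))"
  have "filterlim (\<lambda>n. real n * pi) at_top sequentially"
  proof (rule filterlim_at_top_mono[OF filterlim_real_sequentially])
    have "real n \<le> real n * pi" for n using pi_ge_two mult_left_mono[of 1 pi "real n"] by simp
    then show "\<forall>\<^sub>F n in sequentially. real n \<le> real n * pi" by simp
  qed
  then have "(\<lambda>n. Gsup (real n * pi)) \<longlonglongrightarrow> 0"
    by (rule filterlim_compose[OF Gsup_tendsto_0])
  from tendsto_add[OF tendsto_mult_left[OF n_cubed_B_edges[OF gaps], of 64] tendsto_mult_left[OF this, of "mass ^ 3"]]
  have "(\<lambda>n. 64 * ?x n + mass ^ 3 * Gsup (real n * pi)) \<longlonglongrightarrow> 0" by simp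
  then have "\<forall>\<^sub>F n in sequentially. 64 * ?x n + mass ^ 3 * Gsup (real n * pi) < e"
    by (rule order_tendstoD) (rule e)
  then have "\<forall>\<^sub>F n in sequentially. (-1) ^ n * Re (A (real n * pi)) = 1 \<longrightarrow>
     real n * \<bar>Im (second_order (real n * pi))\<bar> \<le> e"
    using eventually_far
  proof eventually_elim
    case (elim n)
    show ?case
    proof
      assume ev: "(-1) ^ n * Re (A (real n * pi)) = 1"
      define k where "k = real n * pi"
      define J where "J = second_order k"
      have n1: "real n \<ge> 1" "k \<le> 4 * real n" using edge_size[OF elim(2)] by (auto simp: k_def)
      have kn: "real n \<le> k" using pi_ge_two n1 mult_left_mono[of 1 pi "real n"] by (simp add: k_def)
      have k1: "k \<ge> 1 + mass" "k > 0" using elim(2) mass_nonneg unfolding far_def k_def by linarith+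
      have th: "theta k 1 - k = 0" using mean by (simp add: theta_def)
      have "k = km n \<or> k = kp n" using edge_pairD(4)[OF elim(2), of k] ev by (simp add: k_def)
      then have B: "norm (B k) \<le> norm (B (km n)) + norm (B (kp n))" by auto
      have "\<bar>Im (alpha k 1)\<bar> = norm (beta k 1)"
        using eigenvalue_phase(2)[OF k1(1), of n] ev unfolding k_def[symmetric] th by simp
      then have ia: "\<bar>Im (alpha k 1)\<bar> = norm (B k)" by (simp add: B_def norm_mult)
      have ex: "norm (alpha k 1 - 1 - J / of_real (4 * k\<^sup>2)) \<le> 3 * Gsup k * mass ^ 3 / (16 * k ^ 4)"
        unfolding J_def by (rule expansion(4)[OF k1(1)])
      have "Im (J / of_real (4 * k\<^sup>2)) = Im (alpha k 1) - Im (alpha k 1 - 1 - J / of_real (4 * k\<^sup>2))" by simp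
      then have "\<bar>Im J / (4 * k\<^sup>2)\<bar> \<le> norm (B k) + 3 * Gsup k * mass ^ 3 / (16 * k ^ 4)"
        using ia ex abs_Im_le_cmod[of "alpha k 1 - 1 - J / of_real (4 * k\<^sup>2)"] unfolding Im_divide_of_real by linarith
      then have "real n * (4 * k\<^sup>2) * \<bar>Im J / (4 * k\<^sup>2)\<bar> \<le> real n * (4 * k\<^sup>2) * (norm (B k) + 3 * Gsup k * mass ^ 3 / (16 * k ^ 4))"
        using n1 by (intro mult_left_mono) auto
      then have "real n * \<bar>Im J\<bar> \<le> real n * (4 * k\<^sup>2) * (norm (B k) + 3 * Gsup k * mass ^ 3 / (16 * k ^ 4))"
        using k1 by (simp add: abs_divide)
      also have "\<dots> = real n * (4 * k\<^sup>2) * norm (B k) + 3/4 * (mass ^ 3 * Gsup k) * (real n / k\<^sup>2)"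
        using k1(2) by (simp add: distrib_left power2_eq_square power4_eq_xxxx)
      also have "real n * (4 * k\<^sup>2) * norm (B k) \<le> real n * (4 * (4 * real n)\<^sup>2) * (norm (B (km n)) + norm (B (kp n)))"
        using n1 k1 B by (intro mult_mono mult_left_mono power_mono) auto
      also have "\<dots> = 64 * ?x n" by (simp add: power2_eq_square power3_eq_cube)
      also have "3/4 * (mass ^ 3 * Gsup k) * (real n / k\<^sup>2) \<le> 1 * (mass ^ 3 * Gsup k) * 1"
      proof (intro mult_mono)
        have "real n * 1 \<le> k * k" using kn n1 by (intro mult_mono) auto
        then show "real n / k\<^sup>2 \<le> 1" using k1 by (simp add: power2_eq_square)
      qed (use Gsup_nonneg[of k] mass_nonneg in auto)
      finally show "real n * \<bar>Im (second_order (real n * pi))\<bar> \<le> e"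
        using elim(1) unfolding J_def k_def by simp
    qed
  qed
  then show ?thesis by (simp add: eventually_sequentially)
qed

text \<open>
  Two evaluations of the same quantity: along the eigenvalues \<open>n \<pi>\<close>, \<open>n\<close> times the imaginary part of the
  second-order term tends to 0, whereas in general it tends to a negative multiple of the integral of \<open>r\<^sup>2\<close>.
\<close>

theorem potential_zero:
  assumes gaps: small_gaps and ev: "\<And>M::nat. \<exists>n\<ge>M. (-1) ^ n * Re (A (real n * pi)) = 1"
  shows "AE x in lebesgue. x \<in> {0..1} \<longrightarrow> q x = 0"
proof -
  have mean: "q1 1 = 0" by (rule mean_zero[OF ev])
  obtain r where rc: "continuous_on {0..1} r" and ae: "AE x in lebesgue. x \<in> {0..1} \<longrightarrow> q x = r x"
    and asymp: "\<And>e. e > 0 \<Longrightarrow> \<exists>M. \<forall>n\<ge>M. \<forall>x\<in>{0..1}. real n * norm (partial_coeff n x - boundary_term r n x) \<le> e"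
    by (rule primitive_cis_asymp[OF gaps mean]) blast
  let ?V = "integral {0..1} (\<lambda>t. (r t)\<^sup>2)"
  let ?J = "\<lambda>n. second_order (real n * pi)"
  have "?V / (2 * pi) \<le> 0"
  proof (rule field_le_epsilon)
    fix e :: real assume e: "e > 0"
    obtain M1 where M1: "\<And>n. n \<ge> M1 \<Longrightarrow> \<bar>real n * Im (?J n) + ?V / (2 * pi)\<bar> \<le> e / 2"
      using second_order_limit[OF rc ae asymp half_gt_zero[OF e]] by blast
    obtain M2 where M2: "\<And>n. n \<ge> M2 \<Longrightarrow> (-1) ^ n * Re (A (real n * pi)) = 1 \<Longrightarrow> real n * \<bar>Im (?J n)\<bar> \<le> e / 2"
      using n_Im_second_order_small[OF gaps mean half_gt_zero[OF e]] by blast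
    obtain n where n: "n \<ge> max M1 M2" "(-1) ^ n * Re (A (real n * pi)) = 1" using ev by blast
    have "\<bar>real n * Im (?J n)\<bar> \<le> e / 2" using M2[of n] n by (simp add: abs_mult)
    then show "?V / (2 * pi) \<le> 0 + e" using M1[of n] n by linarith
  qed
  then have "?V \<le> 0" using pi_gt_zero by (auto simp: divide_le_0_iff)
  moreover have "?V \<ge> 0"
    by (intro hk_integral_nonneg integrable_continuous_real continuous_intros rc) auto
  ultimately have "?V = 0" by simp
  then have "\<forall>x\<in>{0..1}. (r x)\<^sup>2 = 0"
    by (subst (asm) integral_eq_0_iff) (auto intro!: continuous_intros rc)
  then have "r x = 0" if "x \<in> {0..1}" for x using that by simp
  then show ?thesis using ae by (auto elim: eventually_mono)
qed

end

lemma AE_periodic_extension: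
  fixes q :: "real \<Rightarrow> real"
  assumes per: "\<And>x. q (x + 1) = q x" and ae: "AE x in lebesgue. x \<in> {0..1} \<longrightarrow> q x = 0"
  shows "AE x in lebesgue. q x = 0"
proof -
  obtain N where N: "N \<in> null_sets lebesgue" "{x \<in> space lebesgue. \<not> (x \<in> {0..1} \<longrightarrow> q x = 0)} \<subseteq> N"
    using ae unfolding eventually_ae_filter by blast
  have perN: "q (x + real n) = q x" for x n
  proof (induction n)
    case (Suc n)
    have "q (x + real (Suc n)) = q ((x + real n) + 1)" by (simp add: algebra_simps)
    then show ?case using Suc per by simp
  qed simp
  have perZ: "q (x + of_int m) = q x" for x m
  proof (cases "m \<ge> 0")
    case True
    then show ?thesis using perN[of x "nat m"] by simp
  next
    case False
    then show ?thesis using perN[of "x + of_int m" "nat (- m)"] by simp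
  qed
  let ?U = "\<Union>m\<in>(UNIV :: int set). (+) (of_int m) ` N"
  have "negligible ?U"
    by (intro negligible_countable_Union) (use N in \<open>auto simp: negligible_iff_null_sets[symmetric] intro!: negligible_translation\<close>)
  moreover have "{x \<in> space lebesgue. \<not> q x = 0} \<subseteq> ?U"
  proof
    fix x assume "x \<in> {x \<in> space lebesgue. \<not> q x = 0}"
    then have x: "q x \<noteq> 0" by simp
    define y where "y = x + of_int (- \<lfloor>x\<rfloor>)"
    have "y \<in> {0..1}" unfolding y_def by (auto simp: algebra_simps) linarith
    moreover have "q y \<noteq> 0" using x perZ[of x "- \<lfloor>x\<rfloor>"] unfolding y_def by simp
    ultimately have "y \<in> N" using N(2) by auto
    moreover have "x = of_int \<lfloor>x\<rfloor> + y" by (simp add: y_def)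
    ultimately show "x \<in> ?U" by blast
  qed
  ultimately show ?thesis unfolding eventually_ae_filter negligible_iff_null_sets by blast
qed

theorem theorem1p2:
  fixes q :: "real \<Rightarrow> real" and lam mu :: "nat \<Rightarrow> real" and \<epsilon> n\<^sub>0 :: real
  assumes periodic: "\<And>x. q (x + 1) = q x"
    and summable: "q absolutely_integrable_on {0..1}"
    and lam_seq: "periodic_eigenvalues q lam"
    and mu_seq: "antiperiodic_eigenvalues q mu"
    and small: "instability_length lam mu \<in> o(\<lambda>n. 1 / (real n)\<^sup>2)"
    and eps: "\<epsilon> > 0" and n0: "n\<^sub>0 > 0"
    and bound: "\<And>n::nat. real n > n\<^sub>0 \<Longrightarrow> instability_length lam mu n < \<epsilon> / (real n)\<^sup>2"
  shows "({(real n * pi)\<^sup>2 | n::nat. even n \<and> real n > n\<^sub>0} \<subseteq> range lam \<longrightarrow>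
            (AE x in lebesgue. q x = 0)) \<and>
         ({(real n * pi)\<^sup>2 | n::nat. odd n \<and> real n > n\<^sub>0} \<subseteq> range mu \<longrightarrow>
            (AE x in lebesgue. q x = 0))"
proof -
  interpret L1_potential q by unfold_locales (rule summable)
  \<comment> \<open>Both spectra are treated alike: the parity r selects the boundary condition of sign (-1)^r.\<close>
  define a where "a = (\<lambda>r::nat. if r = 0 then lam else mu)"
  have a: "eigenvalue_sequence q ((-1) ^ r) (a r)" if "r \<le> 1" for r
    using that lam_seq mu_seq by (cases "r = 0") (auto simp: a_def le_Suc_eq)
  have gap: "\<exists>J. \<forall>j\<ge>J. even j = even r \<longrightarrow> a r j - a r (j - 1) \<le> e / (real j)\<^sup>2" if r: "r \<le> 1" and e: "e > 0" for r e
  proof -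
    have "\<forall>\<^sub>F j in sequentially. norm (instability_length lam mu j) \<le> e * norm (1 / (real j)\<^sup>2)"
      using landau_o.smallD[OF small e] .
    then obtain J where J: "\<And>j. j \<ge> J \<Longrightarrow> norm (instability_length lam mu j) \<le> e * norm (1 / (real j)\<^sup>2)"
      unfolding eventually_sequentially by blast
    have "a r j - a r (j - 1) \<le> e / (real j)\<^sup>2" if j: "j \<ge> J" "even j = even r" for j
    proof -
      have "a r j - a r (j - 1) = instability_length lam mu j"
        using r j by (cases "r = 0") (auto simp: a_def instability_length_def le_Suc_eq)
      then show ?thesis using J[OF j(1)] by simp
    qed
    then show ?thesis by blast
  qed
  have small_gaps
    unfolding small_gaps_def
  proof (intro allI impI)
    fix e :: real assume e: "e > 0"
    have "\<exists>M. \<forall>n\<ge>M. even n = even r \<longrightarrow> (kp n)\<^sup>2 - (km n)\<^sup>2 \<le> e / (real n)\<^sup>2" if "r \<le> 1" for r :: nat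
      by (rule edge_gap_small[OF a[OF that] that gap[OF that] e])
    from this[of 0] this[of 1] obtain M0 M1 where
      "\<And>n. n \<ge> M0 \<Longrightarrow> even n \<Longrightarrow> (kp n)\<^sup>2 - (km n)\<^sup>2 \<le> e / (real n)\<^sup>2"
      "\<And>n. n \<ge> M1 \<Longrightarrow> odd n \<Longrightarrow> (kp n)\<^sup>2 - (km n)\<^sup>2 \<le> e / (real n)\<^sup>2" by auto
    then show "\<exists>M. \<forall>n\<ge>M. (kp n)\<^sup>2 - (km n)\<^sup>2 \<le> e / (real n)\<^sup>2"
      by (intro exI[of _ "M0 + M1"]) (metis add_leD1 add_leD2)
  qed
  have main: "AE x in lebesgue. q x = 0"
    if r: "r \<le> 1" and sub: "\<And>n. even n = even r \<Longrightarrow> real n > n\<^sub>0 \<Longrightarrow> (real n * pi)\<^sup>2 \<in> range (a r)" for r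
  proof (rule AE_periodic_extension[where q = q, OF periodic], rule potential_zero[OF \<open>small_gaps\<close>])
    fix M :: nat
    obtain N where N: "far N" using far_exists by blast
    obtain L :: nat where L: "real L > n\<^sub>0" using reals_Archimedean2 by blast
    define n where "n = 2 * (M + N + L) + r"
    have "far n" using N by (rule far_mono) (simp add: n_def)
    then have k: "real n * pi \<ge> 1 + mass" unfolding far_def by linarith
    have "real n > n\<^sub>0" using L by (simp add: n_def)
    moreover have par: "even n = even r" by (simp add: n_def)
    ultimately have "(real n * pi)\<^sup>2 \<in> range (a r)" by (intro sub)
    then have "(-1) ^ r * Re (A (real n * pi)) = 1"
      unfolding eigenvalue_sequence_range[OF a[OF r]] using multiplicity_pos_iff[OF k, of "(-1) ^ r"] by (simp add: power_abs)
    moreover have "(-1::real) ^ n = (-1) ^ r" by (simp add: n_def power_add)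
    ultimately have "(-1) ^ n * Re (A (real n * pi)) = 1" by simp
    moreover have "n \<ge> M" by (simp add: n_def)
    ultimately show "\<exists>n\<ge>M. (-1) ^ n * Re (A (real n * pi)) = 1" by blast
  qed
  show ?thesis
    using main[of 0] main[of 1] by (auto simp: a_def)
qed

end
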